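(* Let $P_1,\dots,P_S$ be a set of $S$ binary-input memoryless symmetric channels that is stochastically degraded, with capacities $C_1\ge C_2\ge\cdots\ge C_S$ (so $P_{s'}$ is a stochastically degraded version of $P_s$ whenever $s<s'$). Then the parallel polar coding scheme defined in the context achieves the capacity $C_\Pi=\sum_{s=1}^S C_s$ of the arbitrarily-permuted parallel channel formed by $P_1,\dots,P_S$. That is: fix an integer $m\ge1$ with $2^m-1\ge S$ and MDS codes $\mathcal C^{(t)}_{\mathrm{MDS}}$, $t\in[S-1]$, over $\mathrm{GF}(2^m)$ of length $S$ and dimension $t$. For every $R<\sum_{s=1}^S C_s$ there are $\beta\in(0,\tfrac12)$, real numbers $R_s<C_s$ with $\sum_{s=1}^S R_s\ge R$, and, for all sufficiently large $n=2^i$, sets $\mathcal A_n^{(S)}\subseteq\mathcal A_n^{(S-1)}\subseteq\cdots\subseteq\mathcal A_n^{(1)}\subseteq[n]$ with $|\mathcal A_n^{(s)}|$ divisible by $m$, $|\mathcal A_n^{(s)}|\ge nR_s$, and $\Pr(\mathcal E_l(P_s))\le 2^{-n^\beta}$ for all $s\in[S]$, $l\in\mathcal A_n^{(s)}$, such that the parallel polar coding scheme with these sets (and any fixed frozen vectors $\mathbf b$), used over $P_1,\dots,P_S$, has rate $\frac1n\sum_{s=1}^S|\mathcal A_n^{(s)}|\ge R$ and, for every permutation $\pi$ of $[S]$, its average block error probability $P_{\mathrm e}^{(\pi)}(n)$ tends to $0$ as $n\to\infty$.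
   Context: $[N]=\{1,\dots,N\}$, $\mathcal X=\{0,1\}$, additions of bits are modulo 2. Channels. A binary-input memoryless channel with transition probabilities $p(y|x)$, $x\in\mathcal X$, $y\in\mathcal Y$ ($\mathcal Y$ finite) is symmetric if there is a permutation $\mathcal T$ of $\mathcal Y$ with $\mathcal T^{-1}=\mathcal T$ and $p(y|0)=p(\mathcal T(y)|1)$ for all $y$. $P_2$ (output alphabet $\mathcal Y_2$) is a stochastically degraded version of $P_1$ (output alphabet $\mathcal Y_1$) if there is a channel $D(y_2|y_1)$ with $P_2(y_2|x)=\sum_{y_1\in\mathcal Y_1}P_1(y_1|x)D(y_2|y_1)$ for all $x,y_2$. For vectors, $p(\mathbf y|\mathbf x)=\prod_t p(y_t|x_t)$. Arbitrarily-permuted parallel channel. A message is encoded into $S$ codewords $\mathbf x_1,\dots,\mathbf x_S\in\mathcal X^n$; for an arbitrary permutation $\pi$ of $[S]$, unknown to the encoder, known to the decoder and fixed during the block, $\mathbf x_{\pi(s)}$ is sent over $P_s$: the outputs $(\mathbf y_1,\dots,\mathbf y_S)$ have probability $\prod_{s=1}^S P_s(\mathbf y_s|\mathbf x_{\pi(s)})$. With $M$ messages the rate is $\frac1n\log_2 M$. $P_{\mathrm e}^{(\pi)}(n)$ is the block error probability for permutation $\pi$ averaged over uniformly distributed messages. The capacity $C_\Pi$ is the largest rate achievable with error probability tending to $0$ for all $S!$ permutations; it is known that $C_\Pi=\sum_s C_s$ for these channels, where $C_s$ is the capacity of $P_s$. Polar notions. For $n=2^i$ let $G_n=B_nF^{\otimes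 i}$ be the binary polar generator matrix, $F=\begin{pmatrix}1&0\\1&1\end{pmatrix}$, $B_n$ the bit-reversal permutation matrix. For a binary-input channel $p$ let $p_n(\mathbf y|\mathbf w)=p(\mathbf y|\mathbf wG_n)$, and let the split channels be $p_n^{(l)}(\mathbf y,\mathbf w|x)=2^{-(n-1)}\sum_{\mathbf c\in\mathcal X^{n-l}}p_n(\mathbf y|(\mathbf w,x,\mathbf c))$ for $l\in[n]$, $\mathbf w\in\mathcal X^{l-1}$, $x\in\mathcal X$. The event $\mathcal E_l(p)$ is $\{p_n^{(l)}(\mathbf y,(w_1,\dots,w_{l-1})|w_l)\le p_n^{(l)}(\mathbf y,(w_1,\dots,w_{l-1})|w_l+1)\}$, where $\mathbf w$ is uniform on $\mathcal X^n$ and $\mathbf y$ is distributed according to $p_n(\cdot|\mathbf w)$. For $\mathcal A\subseteq[n]$, $G_n(\mathcal A)$ is the submatrix of rows of $G_n$ indexed by $\mathcal A$. Successive cancellation decoding of $\mathbf w$ for channel $p$ with information set $\mathcal A$ processes $l=1,\dots,n$: if $l\notin\mathcal A$, $\hat w_l$ is set to a value supplied to the decoder; if $l\in\mathcal A$, $\hat w_l$ is a maximizer over $x\in\mathcal X$ of $p_n^{(l)}(\mathbf y,(\hat w_1,\dots,\hat w_{l-1})|x)$. MDS codes. A linear code of length $S$ and dimension $t$ is MDS if its minimum distance is $S-t+1$; then any $t$ coordinates determine a codeword. Blocks of $m$ bits are identified with symbols of $\mathrm{GF}(2^m)$ by a fixed bijection. The parallel polar coding scheme. Given nested sets $\mathcal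 A_n^{(S)}\subseteq\cdots\subseteq\mathcal A_n^{(1)}\subseteq[n]$, put $\mathcal A_n^{(S+1)}=\emptyset$, $k_s=|\mathcal A_n^{(s)}|$, $k_{S+1}=0$, all $k_s$ divisible by $m$. For each layer $t\in[S]$ and each $s\in[S]$ there is a vector $\mathbf v_{s,t}\in\mathcal X^{k_t-k_{t+1}}$, viewed also as a vector of $(k_t-k_{t+1})/m$ symbols of $\mathrm{GF}(2^m)$. For $s\le t$, $\mathbf v_{s,t}$ consists of information bits (so in total there are $\sum_t t(k_t-k_{t+1})=\sum_s k_s$ information bits). For $s>t$, $\mathbf v_{s,t}$ is determined by requiring that for each $j$ the symbols $(v_{1,t}(j),\dots,v_{S,t}(j))$ form the unique codeword of $\mathcal C^{(t)}_{\mathrm{MDS}}$ whose first $t$ symbols are $v_{1,t}(j),\dots,v_{t,t}(j)$. The codewords are $$\mathbf x_s=\sum_{t=1}^S\mathbf v_{s,t}\,G_n\bigl(\mathcal A_n^{(t)}\setminus\mathcal A_n^{(t+1)}\bigr)+\mathbf b\,G_n\bigl([n]\setminus\mathcal A_n^{(1)}\bigr),\qquad s\in[S],$$ with $\mathbf b\in\mathcal X^{n-k_1}$ a fixed (frozen) vector known to the decoder. Decoding is in stages $s=1,\dots,S$. At stage $s$ the output of $P_s$ (carrying $\mathbf x_{\pi(s)}$) is decoded by successive cancellation for $P_s$ with information set $\mathcal A_n^{(s)}$, the values supplied at indices outside $\mathcal A_n^{(s)}$ being those of $\mathbf b$ and of $\mathbf v_{\pi(s),t}$, $t<s$; the latter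 are computed from the already decoded $\mathbf v_{\pi(1),t},\dots,\mathbf v_{\pi(t),t}$ through the code $\mathcal C^{(t)}_{\mathrm{MDS}}$. After stage $S$ all information bits are recovered. *)

theory Defs
  imports Complex_Main "HOL-Library.FuncSet" "HOL-Library.Z2" "HOL-Library.Function_Algebras"
    "HOL-Combinatorics.Permutations"
    "Jordan_Normal_Form.Matrix" "Jordan_Normal_Form.DL_Submatrix"
begin

text \<open>Conventions. Positions inside a block are numbered from 0, so an index set is a subset of
  \<open>{..<n}\<close>; channels, layers and stages are numbered from 1. Block lengths are \<open>n = 2 ^ i\<close>.\<close>

section \<open>Binary-input channels\<close>

text \<open>\<open>p y x\<close> is the transition probability \<open>p(y|x)\<close>. The output alphabet is a separate finite set, so
  that channels with different alphabets can share one type.\<close>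

type_synonym 'y channel = "'y \<Rightarrow> bit \<Rightarrow> real"

definition is_channel :: "'y set \<Rightarrow> 'y channel \<Rightarrow> bool" where
  "is_channel Y p \<longleftrightarrow> finite Y \<and> (\<forall>x. (\<forall>y\<in>Y. 0 \<le> p y x) \<and> (\<Sum>y\<in>Y. p y x) = 1)"

definition symmetric_channel :: "'y set \<Rightarrow> 'y channel \<Rightarrow> bool" where
  "symmetric_channel Y p \<longleftrightarrow>
     (\<exists>T. bij_betw T Y Y \<and> (\<forall>y\<in>Y. T (T y) = y) \<and> (\<forall>y\<in>Y. p y 0 = p (T y) 1))"

text \<open>\<open>degraded Y1 p1 Y2 p2\<close>: the second channel is a degraded version of the first.\<close>

definition degraded :: "'y1 set \<Rightarrow> 'y1 channel \<Rightarrow> 'y2 set \<Rightarrow> 'y2 channel \<Rightarrow> bool" where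
  "degraded Y1 p1 Y2 p2 \<longleftrightarrow>
     (\<exists>D :: 'y2 \<Rightarrow> 'y1 \<Rightarrow> real.
        (\<forall>y1\<in>Y1. (\<forall>y2\<in>Y2. 0 \<le> D y2 y1) \<and> (\<Sum>y2\<in>Y2. D y2 y1) = 1) \<and>
        (\<forall>x. \<forall>y2\<in>Y2. p2 y2 x = (\<Sum>y1\<in>Y1. p1 y1 x * D y2 y1)))"

text \<open>\<open>I(X;Y)\<close> in bits for input distribution \<open>q\<close>. The argument of the logarithm is the ratio of
  \<open>p(y|x)\<close> and the output probability of \<open>y\<close>; where either vanishes, the factor \<open>q x * p y x\<close> is 0.\<close>

definition mutual_info :: "'y set \<Rightarrow> 'y channel \<Rightarrow> (bit \<Rightarrow> real) \<Rightarrow> real" where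
  "mutual_info Y p q =
     (\<Sum>x\<in>{0,1}. \<Sum>y\<in>Y. q x * p y x * log 2 (p y x / (\<Sum>x'\<in>{0,1}. q x' * p y x')))"

definition capacity :: "'y set \<Rightarrow> 'y channel \<Rightarrow> real" where
  "capacity Y p = (SUP q\<in>{q. 0 \<le> q 0 \<and> 0 \<le> q 1 \<and> q 0 + q 1 = 1}. mutual_info Y p q)"

definition blocks :: "'a set \<Rightarrow> nat \<Rightarrow> 'a list set" where
  "blocks Y n = {ys. set ys \<subseteq> Y \<and> length ys = n}"

abbreviation bit_blocks :: "nat \<Rightarrow> bit list set" where
  "bit_blocks n \<equiv> blocks UNIV n"

definition vec_channel :: "'y channel \<Rightarrow> 'y list \<Rightarrow> bit list \<Rightarrow> real" where
  "vec_channel p ys xs = (\<Prod>j<length xs. p (ys ! j) (xs ! j))"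

section \<open>The arbitrarily-permuted parallel channel\<close>

text \<open>A code is a finite message set \<open>M\<close>, an encoder mapping a message and \<open>s \<in> {1..S}\<close> to the
  codeword \<open>x_s\<close>, and a decoder that knows the permutation.\<close>

definition code_rate :: "nat \<Rightarrow> 'u set \<Rightarrow> real" where
  "code_rate n M = log 2 (real (card M)) / real n"

definition block_error_prob ::
  "nat \<Rightarrow> (nat \<Rightarrow> 'y set) \<Rightarrow> (nat \<Rightarrow> 'y channel) \<Rightarrow> nat \<Rightarrow> 'u set \<Rightarrow> ('u \<Rightarrow> nat \<Rightarrow> bit list)
   \<Rightarrow> ((nat \<Rightarrow> nat) \<Rightarrow> (nat \<Rightarrow> 'y list) \<Rightarrow> 'u) \<Rightarrow> (nat \<Rightarrow> nat) \<Rightarrow> real" where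
  "block_error_prob S Y P n M enc dec \<pi> =
     (\<Sum>u\<in>M. \<Sum>y\<in>(\<Pi>\<^sub>E s\<in>{1..S}. blocks (Y s) n).
        (\<Prod>s=1..S. vec_channel (P s) (y s) (enc u (\<pi> s))) * of_bool (dec \<pi> y \<noteq> u))
     / real (card M)"

section \<open>Polar transform and split channels\<close>

definition polar_kernel :: "bit mat" where
  "polar_kernel = mat_of_rows_list 2 [[1, 0], [1, 1]]"

definition kronecker :: "'a::semiring_1 mat \<Rightarrow> 'a mat \<Rightarrow> 'a mat" where
  "kronecker A B = mat (dim_row A * dim_row B) (dim_col A * dim_col B)
     (\<lambda>(r, c). A $$ (r div dim_row B, c div dim_col B) * B $$ (r mod dim_row B, c mod dim_col B))"

primrec kronecker_power :: "'a::semiring_1 mat \<Rightarrow> nat \<Rightarrow> 'a mat" where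
  "kronecker_power A 0 = 1\<^sub>m 1"
| "kronecker_power A (Suc i) = kronecker A (kronecker_power A i)"

text \<open>\<open>bit_reverse i r\<close> reverses the \<open>i\<close>-digit binary expansion of \<open>r < 2 ^ i\<close>.\<close>

primrec bit_reverse :: "nat \<Rightarrow> nat \<Rightarrow> nat" where
  "bit_reverse 0 r = 0"
| "bit_reverse (Suc i) r = 2 ^ i * (r mod 2) + bit_reverse i (r div 2)"

definition bit_reversal_mat :: "nat \<Rightarrow> bit mat" where
  "bit_reversal_mat i = mat (2 ^ i) (2 ^ i) (\<lambda>(r, c). of_bool (r = bit_reverse i c))"

definition polar_mat :: "nat \<Rightarrow> bit mat" where
  "polar_mat i = bit_reversal_mat i * kronecker_power polar_kernel i"

definition row_times :: "bit list \<Rightarrow> bit mat \<Rightarrow> bit list" where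
  "row_times v G = map (\<lambda>c. scalar_prod (vec_of_list v) (col G c)) [0..<dim_col G]"

definition polar_channel :: "'y channel \<Rightarrow> nat \<Rightarrow> 'y list \<Rightarrow> bit list \<Rightarrow> real" where
  "polar_channel p i y w = vec_channel p y (row_times w (polar_mat i))"

text \<open>The split channel whose position is the length of the past \<open>w\<close>.\<close>

definition split_channel :: "'y channel \<Rightarrow> nat \<Rightarrow> 'y list \<Rightarrow> bit list \<Rightarrow> bit \<Rightarrow> real" where
  "split_channel p i y w x =
     (\<Sum>c\<in>bit_blocks (2 ^ i - length w - 1). polar_channel p i y (w @ x # c)) / 2 ^ (2 ^ i - 1)"

text \<open>The probability of the event \<open>E_l(p)\<close>, for uniform \<open>w\<close> and \<open>y\<close> distributed as \<open>p_n(.|w)\<close>.\<close>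

definition split_error_prob :: "'y set \<Rightarrow> 'y channel \<Rightarrow> nat \<Rightarrow> nat \<Rightarrow> real" where
  "split_error_prob Y p i l =
     (\<Sum>w\<in>bit_blocks (2 ^ i). \<Sum>y\<in>blocks Y (2 ^ i).
        1 / 2 ^ (2 ^ i) * polar_channel p i y w *
        of_bool (split_channel p i y (take l w) (w ! l) \<le> split_channel p i y (take l w) (w ! l + 1)))"

section \<open>Successive cancellation decoding\<close>

text \<open>A bit decision rule maps the output block and the past decisions to a maximizer; ties may be
  broken in any way.\<close>

definition sc_rule :: "'y set \<Rightarrow> 'y channel \<Rightarrow> nat \<Rightarrow> ('y list \<Rightarrow> bit list \<Rightarrow> bit) \<Rightarrow> bool" where
  "sc_rule Y p i d \<longleftrightarrow>
     (\<forall>y\<in>blocks Y (2 ^ i). \<forall>h. length h < 2 ^ i \<longrightarrow>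
        is_arg_max (\<lambda>x. split_channel p i y h x) (\<lambda>_. True) (d y h))"

text \<open>\<open>sc_decode d I f y l\<close> is the list of the first \<open>l\<close> decisions for the information set \<open>I\<close> and the
  supplied values \<open>f\<close>.\<close>

primrec sc_decode ::
  "('y list \<Rightarrow> bit list \<Rightarrow> bit) \<Rightarrow> nat set \<Rightarrow> (nat \<Rightarrow> bit) \<Rightarrow> 'y list \<Rightarrow> nat \<Rightarrow> bit list" where
  "sc_decode d I f y 0 = []"
| "sc_decode d I f y (Suc l) =
     (let h = sc_decode d I f y l in h @ [if l \<in> I then d y h else f l])"

section \<open>MDS codes\<close>

text \<open>A word of length \<open>S\<close> is a function on the naturals that vanishes outside \<open>{1..S}\<close>.\<close>

definition linear_code :: "nat \<Rightarrow> nat \<Rightarrow> (nat \<Rightarrow> 'f::field) set \<Rightarrow> bool" where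
  "linear_code S t C \<longleftrightarrow>
     (\<forall>c\<in>C. \<forall>j. j \<notin> {1..S} \<longrightarrow> c j = 0) \<and>
     module.subspace (\<lambda>a c j. a * c j) C \<and>
     vector_space.dim (\<lambda>a c j. a * c j) C = t"

definition hamming_dist :: "nat \<Rightarrow> (nat \<Rightarrow> 'f) \<Rightarrow> (nat \<Rightarrow> 'f) \<Rightarrow> nat" where
  "hamming_dist S c c' = card {j\<in>{1..S}. c j \<noteq> c' j}"

definition min_dist :: "nat \<Rightarrow> (nat \<Rightarrow> 'f) set \<Rightarrow> nat" where
  "min_dist S C = Inf {hamming_dist S c c' | c c'. c \<in> C \<and> c' \<in> C \<and> c \<noteq> c'}"

definition mds_code :: "nat \<Rightarrow> nat \<Rightarrow> (nat \<Rightarrow> 'f::field) set \<Rightarrow> bool" where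
  "mds_code S t C \<longleftrightarrow> linear_code S t C \<and> min_dist S C = S - t + 1"

text \<open>\<open>symbol m \<phi> v j\<close> is the \<open>j\<close>-th symbol of the bit vector \<open>v\<close>, where \<open>\<phi>\<close> identifies blocks of \<open>m\<close>
  bits with field elements.\<close>

definition symbol :: "nat \<Rightarrow> (bit list \<Rightarrow> 'f) \<Rightarrow> bit list \<Rightarrow> nat \<Rightarrow> 'f" where
  "symbol m \<phi> v j = \<phi> (take m (drop (j * m) v))"

text \<open>Given the vectors \<open>v r\<close>, of length \<open>L\<close>, at the coordinates \<open>r \<in> T\<close>, the vector at coordinate \<open>s\<close>
  such that for each \<open>j\<close> the \<open>j\<close>-th symbols form the codeword of \<open>C\<close> determined by \<open>T\<close>.\<close>

definition mds_complete ::
  "nat \<Rightarrow> (bit list \<Rightarrow> 'f) \<Rightarrow> (nat \<Rightarrow> 'f) set \<Rightarrow> nat set \<Rightarrow> nat \<Rightarrow> (nat \<Rightarrow> bit list) \<Rightarrow> nat \<Rightarrow> bit list"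
where
  "mds_complete m \<phi> C T L v s =
     concat (map (\<lambda>j. inv_into (bit_blocks m) \<phi>
                        ((THE c. c \<in> C \<and> (\<forall>r\<in>T. c r = symbol m \<phi> (v r) j)) s))
                 [0..<L div m])"

section \<open>The parallel polar coding scheme\<close>

definition nested_sets :: "nat \<Rightarrow> nat \<Rightarrow> (nat \<Rightarrow> nat set) \<Rightarrow> bool" where
  "nested_sets S n A \<longleftrightarrow> A 1 \<subseteq> {..<n} \<and> (\<forall>s\<in>{1..S}. A (Suc s) \<subseteq> A s) \<and> A (Suc S) = {}"

definition layer :: "(nat \<Rightarrow> nat set) \<Rightarrow> nat \<Rightarrow> nat set" where
  "layer A t = A t - A (Suc t)"

definition layer_size :: "(nat \<Rightarrow> nat set) \<Rightarrow> nat \<Rightarrow> nat" where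
  "layer_size A t = card (A t) - card (A (Suc t))"

definition info_indices :: "nat \<Rightarrow> (nat \<times> nat) set" where
  "info_indices S = {(s, t). 1 \<le> s \<and> s \<le> t \<and> t \<le> S}"

text \<open>A message \<open>u\<close> consists of the information vectors \<open>v_{s,t} = u (s, t)\<close>, \<open>s \<le> t\<close>.\<close>

definition messages :: "nat \<Rightarrow> (nat \<Rightarrow> nat set) \<Rightarrow> (nat \<times> nat \<Rightarrow> bit list) set" where
  "messages S A = (\<Pi>\<^sub>E (s, t)\<in>info_indices S. bit_blocks (layer_size A t))"

definition layer_vector ::
  "nat \<Rightarrow> (bit list \<Rightarrow> 'f) \<Rightarrow> (nat \<Rightarrow> (nat \<Rightarrow> 'f) set) \<Rightarrow> (nat \<Rightarrow> nat set)
   \<Rightarrow> (nat \<times> nat \<Rightarrow> bit list) \<Rightarrow> nat \<Rightarrow> nat \<Rightarrow> bit list" where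
  "layer_vector m \<phi> C A u s t =
     (if s \<le> t then u (s, t)
      else mds_complete m \<phi> (C t) {1..t} (layer_size A t) (\<lambda>r. u (r, t)) s)"

definition polar_encode ::
  "nat \<Rightarrow> nat \<Rightarrow> (bit list \<Rightarrow> 'f) \<Rightarrow> (nat \<Rightarrow> (nat \<Rightarrow> 'f) set) \<Rightarrow> nat \<Rightarrow> (nat \<Rightarrow> nat set) \<Rightarrow> bit list
   \<Rightarrow> (nat \<times> nat \<Rightarrow> bit list) \<Rightarrow> nat \<Rightarrow> bit list" where
  "polar_encode S m \<phi> C i A b u s =
     map (\<lambda>j. (\<Sum>t=1..S. row_times (layer_vector m \<phi> C A u s t)
                           (submatrix (polar_mat i) (layer A t) UNIV) ! j)
              + row_times b (submatrix (polar_mat i) ({..<2 ^ i} - A 1) UNIV) ! j)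
         [0..<2 ^ i]"

text \<open>The value supplied at a position \<open>l \<notin> A s\<close>: a bit of \<open>b\<close> or of the vector \<open>v t\<close> of the layer that
  contains \<open>l\<close>. The bit's index is the rank of \<open>l\<close>, as the rows of a submatrix are in increasing order.\<close>

definition supplied_value ::
  "nat \<Rightarrow> (nat \<Rightarrow> nat set) \<Rightarrow> bit list \<Rightarrow> (nat \<Rightarrow> bit list) \<Rightarrow> nat \<Rightarrow> bit" where
  "supplied_value S A b v l =
     (if l \<notin> A 1 then b ! card {j. j < l \<and> j \<notin> A 1}
      else let t = (THE t. t \<in> {1..S} \<and> l \<in> layer A t)
           in v t ! card {j\<in>layer A t. j < l})"

text \<open>\<open>decode_stages ... \<pi> y s r t\<close> is the decoded \<open>v_{r,t}\<close> after stages \<open>1, ..., s\<close>; it is meaningful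
  for \<open>r \<in> \<pi> ` {1..s}\<close>. Stage \<open>s\<close> decodes the codeword with index \<open>\<pi> s\<close>. The arguments \<open>d\<close> are the bit
  decision rules for the \<open>S\<close> channels.\<close>

primrec decode_stages ::
  "nat \<Rightarrow> nat \<Rightarrow> (bit list \<Rightarrow> 'f) \<Rightarrow> (nat \<Rightarrow> (nat \<Rightarrow> 'f) set) \<Rightarrow> nat \<Rightarrow> (nat \<Rightarrow> nat set) \<Rightarrow> bit list
   \<Rightarrow> (nat \<Rightarrow> 'y list \<Rightarrow> bit list \<Rightarrow> bit) \<Rightarrow> (nat \<Rightarrow> nat) \<Rightarrow> (nat \<Rightarrow> 'y list)
   \<Rightarrow> nat \<Rightarrow> nat \<Rightarrow> nat \<Rightarrow> bit list" where
  "decode_stages S m \<phi> C i A b d \<pi> y 0 = (\<lambda>r t. [])"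
| "decode_stages S m \<phi> C i A b d \<pi> y (Suc s) =
     (let V = decode_stages S m \<phi> C i A b d \<pi> y s;
          known = (\<lambda>t. mds_complete m \<phi> (C t) (\<pi> ` {1..t}) (layer_size A t) (\<lambda>r. V r t) (\<pi> (Suc s)));
          w = sc_decode (d (Suc s)) (A (Suc s)) (supplied_value S A b known) (y (Suc s)) (2 ^ i)
      in V(\<pi> (Suc s) := (\<lambda>t. nths w (layer A t))))"

definition polar_decode ::
  "nat \<Rightarrow> nat \<Rightarrow> (bit list \<Rightarrow> 'f) \<Rightarrow> (nat \<Rightarrow> (nat \<Rightarrow> 'f) set) \<Rightarrow> nat \<Rightarrow> (nat \<Rightarrow> nat set) \<Rightarrow> bit list
   \<Rightarrow> (nat \<Rightarrow> 'y list \<Rightarrow> bit list \<Rightarrow> bit) \<Rightarrow> (nat \<Rightarrow> nat) \<Rightarrow> (nat \<Rightarrow> 'y list)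
   \<Rightarrow> nat \<times> nat \<Rightarrow> bit list" where
  "polar_decode S m \<phi> C i A b d \<pi> y =
     (\<lambda>(s, t)\<in>info_indices S. decode_stages S m \<phi> C i A b d \<pi> y S s t)"

definition scheme_error_prob ::
  "nat \<Rightarrow> (nat \<Rightarrow> 'y set) \<Rightarrow> (nat \<Rightarrow> 'y channel) \<Rightarrow> nat \<Rightarrow> (bit list \<Rightarrow> 'f) \<Rightarrow> (nat \<Rightarrow> (nat \<Rightarrow> 'f) set)
   \<Rightarrow> nat \<Rightarrow> (nat \<Rightarrow> nat set) \<Rightarrow> bit list \<Rightarrow> (nat \<Rightarrow> 'y list \<Rightarrow> bit list \<Rightarrow> bit) \<Rightarrow> (nat \<Rightarrow> nat) \<Rightarrow> real"
where
  "scheme_error_prob S Y P m \<phi> C i A b d \<pi> =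
     block_error_prob S Y P (2 ^ i) (messages S A)
       (polar_encode S m \<phi> C i A b) (polar_decode S m \<phi> C i A b d) \<pi>"

end

theory Submission
  imports Defs "HOL-Analysis.Convex" "HOL-Real_Asymp.Real_Asymp"
begin

text \<open>For the split channels let \<open>Z\<close> be the Bhattacharyya parameter, \<open>T\<close> the total variation distance of
  the two conditional laws and \<open>I\<close> the mutual information for uniform input. A plus step squares \<open>Z\<close>
  and satisfies \<open>T' \<le> 2T - T\<^sup>2\<close>; a minus step squares \<open>T\<close> and satisfies \<open>Z' \<le> 2Z - Z\<^sup>2\<close>. Since
  \<open>Z\<^sup>2 + T\<^sup>2 \<le> 1\<close>, the average of \<open>sqrt (Z T)\<close> over the two children is smaller than its value at the
  parent by a constant factor, so all but an exponentially small fraction of the split channels has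
  exponentially small \<open>Z\<close> or \<open>T\<close>. As \<open>I\<close> is preserved on average and \<open>I \<le> T / ln 2\<close>, the fraction
  with small \<open>Z\<close> is asymptotically at least \<open>I\<close>. In a last small fraction of the levels \<open>Z\<close> is squared
  linearly often, which gives the rate \<open>2 powr (- (n powr \<beta>))\<close>.

  Degradation makes \<open>Z\<close> larger, so the sets of good indices are nested. By symmetry the probability of
  \<open>E_l\<close> given the input \<open>w\<close> does not depend on \<open>w\<close>; hence neither the frozen bits nor the dependence
  between codewords created by the MDS codes matters, and the union bound over all stages and
  indices applies to each message separately.\<close>

text \<open>Total variation is carried along because the pair \<open>(Z, T)\<close> behaves
  symmetrically: each step squares one of the two and at most doubles the other. A contraction in
  mean thus holds at every node without any limit theorem, and with explicit constants. The bound
  \<open>Z^2 + T^2 \<le> 1\<close> is what excludes \<open>Z = T = 1\<close>, where nothing would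
  contract. The exponent \<open>1 / 1024\<close> is not tuned: on all but a vanishing fraction of
  the paths at least a quarter of the last \<open>i / 128\<close> steps are plus steps, and a factor
  2 absorbs rounding.

  The obstacle in the decoder is that a stage uses earlier decisions, both its own bits and those of
  other codewords. All error events are therefore stated with the true past; while none occurs,
  induction over bits and stages shows that the past in use is the true one. What makes the stages
  fit is a count: layer \<open>t\<close> is first supplied at stage \<open>t + 1\<close>, when
  exactly \<open>t\<close> of its vectors are decoded, the dimension of its code. Finally, the good
  sets must be trimmed to sizes divisible by \<open>m\<close> without breaking the nesting.\<close>

lemma UNIV_bit: "(UNIV :: bit set) = {0, 1}"
  by (auto intro: bit.exhaust)

lemma sum_bit: "(\<Sum>x\<in>UNIV. f x) = f 0 + f (1 :: bit)"
  by (simp add: UNIV_bit)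

lemma finite_bit [simp]: "finite (A :: bit set)"
  using finite_subset[of A "{0, 1}"] UNIV_bit by (metis finite.emptyI finite.insertI subset_UNIV)

subsection \<open>A single polarization step\<close>

definition bhattacharyya :: "'a set \<Rightarrow> 'a channel \<Rightarrow> real" where
  "bhattacharyya Y W = (\<Sum>y\<in>Y. sqrt (W y 0 * W y 1))"

definition tv_dist :: "'a set \<Rightarrow> 'a channel \<Rightarrow> real" where
  "tv_dist Y W = (\<Sum>y\<in>Y. \<bar>W y 0 - W y 1\<bar>) / 2"

text \<open>One term of the divergence of the law with mass \<open>a\<close> from the mixture with
  mass \<open>(a + b) / 2\<close>. For \<open>a = 0\<close> the factor in front gives 0 whatever the
  logarithm returns.\<close>

definition info_density :: "real \<Rightarrow> real \<Rightarrow> real" where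
  "info_density a b = a * log 2 (2 * a / (a + b))"

definition uniform_info :: "'a set \<Rightarrow> 'a channel \<Rightarrow> real" where
  "uniform_info Y W = (\<Sum>y\<in>Y. info_density (W y 0) (W y 1) + info_density (W y 1) (W y 0)) / 2"

text \<open>This and \<open>plus_channel\<close> are Arikan's one-step transforms, with inputs
  \<open>u + x\<close> and \<open>x\<close> to two copies of \<open>W\<close>. They are defined for
  arbitrary channels, so that the one-step inequalities need no block structure.\<close>

definition minus_channel :: "'a channel \<Rightarrow> ('a \<times> 'a) channel" where
  "minus_channel W = (\<lambda>(y, y') u. (\<Sum>x\<in>UNIV. W y (u + x) * W y' x) / 2)"

definition plus_channel :: "'a channel \<Rightarrow> ('a \<times> 'a \<times> bit) channel" where
  "plus_channel W = (\<lambda>(y, y', u) x. W y (u + x) * W y' x / 2)"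

lemma is_channelD:
  assumes "is_channel Y W"
  shows "finite Y" "\<And>y x. y \<in> Y \<Longrightarrow> 0 \<le> W y x" "\<And>x. (\<Sum>y\<in>Y. W y x) = 1"
  using assms by (auto simp: is_channel_def)

lemmas sum_mult_sum = sum_product[symmetric]

lemma is_channel_minus:
  assumes "is_channel Y W"
  shows "is_channel (Y \<times> Y) (minus_channel W)"
proof -
  note c = is_channelD[OF assms]
  have "(\<Sum>z\<in>Y \<times> Y. minus_channel W z u) = 1" for u
    by (simp add: minus_channel_def case_prod_beta' sum_bit sum.distrib c(3)
        flip: sum_divide_distrib sum.cartesian_product' sum_distrib_left sum_distrib_right)
       (simp add: sum.cartesian_product' sum.distrib sum_mult_sum c(3))
  then show ?thesis
    using c(1,2) by (auto simp: is_channel_def minus_channel_def sum_bit)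
qed

lemma is_channel_plus:
  assumes "is_channel Y W"
  shows "is_channel (Y \<times> Y \<times> UNIV) (plus_channel W)"
proof -
  note c = is_channelD[OF assms]
  have "(\<Sum>z\<in>Y \<times> Y \<times> UNIV. plus_channel W z x) = 1" for x
    by (simp add: plus_channel_def sum.cartesian_product' sum_bit sum.distrib sum_mult_sum c(3)
        flip: sum_divide_distrib)
  then show ?thesis
    using c(1,2) by (auto simp: is_channel_def plus_channel_def)
qed

lemma bhattacharyya_nonneg: "is_channel Y W \<Longrightarrow> 0 \<le> bhattacharyya Y W"
  by (auto simp: bhattacharyya_def is_channel_def intro!: sum_nonneg)

lemma tv_dist_nonneg: "0 \<le> tv_dist Y W"
  by (auto simp: tv_dist_def intro!: sum_nonneg)

lemma bhattacharyya_plus: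
  assumes "is_channel Y W"
  shows "bhattacharyya (Y \<times> Y \<times> UNIV) (plus_channel W) = (bhattacharyya Y W)\<^sup>2"
proof -
  have "sqrt (plus_channel W (y, y', u) 0 * plus_channel W (y, y', u) 1)
      = sqrt (W y 0 * W y 1) * sqrt (W y' 0 * W y' 1) / 2" for y y' u
    by (cases u) (simp_all add: plus_channel_def real_sqrt_mult real_sqrt_divide mult_ac)
  note * = this
  show ?thesis
    unfolding bhattacharyya_def sum.cartesian_product' sum_bit *
    by (simp add: sum_mult_sum power2_eq_square)
qed

text \<open>With \<open>p = a + b\<close>, \<open>q = 2 * sqrt (a * b)\<close> and likewise
  \<open>r\<close>, \<open>s\<close> for \<open>c\<close>, \<open>d\<close>, both squared sides are
  polynomials in \<open>p\<close>, \<open>q\<close>, \<open>r\<close>, \<open>s\<close>. Their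
  difference is a positive multiple of \<open>(p * s - q * s) * (q * r - q * s)\<close>, where both
  factors are nonnegative by the arithmetic-geometric mean inequality.\<close>

lemma minus_sqrt_bound:
  fixes a b c d :: real
  assumes "0 \<le> a" "0 \<le> b" "0 \<le> c" "0 \<le> d"
  shows "sqrt ((a * c + b * d) * (b * c + a * d))
     \<le> (a + b) * sqrt (c * d) + sqrt (a * b) * (c + d) - 2 * (sqrt (a * b) * sqrt (c * d))"
proof (rule real_le_lsqrt)
  define p q r s where "p = a + b" and "q = 2 * sqrt (a * b)" and "r = c + d" and "s = 2 * sqrt (c * d)"
  have q: "0 \<le> q" "q \<le> p" "q\<^sup>2 = 4 * (a * b)"
    using assms arith_geo_mean_sqrt[of a b] by (auto simp: p_def q_def power_mult_distrib)
  have s: "0 \<le> s" "s \<le> r" "s\<^sup>2 = 4 * (c * d)"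
    using assms arith_geo_mean_sqrt[of c d] by (auto simp: r_def s_def power_mult_distrib)
  have rhs: "(a + b) * sqrt (c * d) + sqrt (a * b) * (c + d) - 2 * (sqrt (a * b) * sqrt (c * d))
    = (p * s + q * r - q * s) / 2"
    by (simp add: p_def q_def r_def s_def field_simps)
  have lhs: "(a * c + b * d) * (b * c + a * d) = (p\<^sup>2 * s\<^sup>2 + q\<^sup>2 * r\<^sup>2 - q\<^sup>2 * s\<^sup>2) / 4"
    unfolding q(3) s(3) by (simp add: p_def r_def power2_eq_square algebra_simps)
  have X: "q * s \<le> p * s" "q * s \<le> q * r" "0 \<le> q * s"
    using q s by (auto intro: mult_mono)
  then show "0 \<le> (a + b) * sqrt (c * d) + sqrt (a * b) * (c + d) - 2 * (sqrt (a * b) * sqrt (c * d))"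
    unfolding rhs by simp
  have "0 \<le> (p * s - q * s) * (q * r - q * s)"
    using X by simp
  moreover have "(p * s + q * r - q * s)\<^sup>2 - (p\<^sup>2 * s\<^sup>2 + q\<^sup>2 * r\<^sup>2 - q\<^sup>2 * s\<^sup>2)
      = 2 * ((p * s - q * s) * (q * r - q * s))"
    by (simp add: power2_eq_square algebra_simps)
  ultimately show "(a * c + b * d) * (b * c + a * d) \<le>
    ((a + b) * sqrt (c * d) + sqrt (a * b) * (c + d) - 2 * (sqrt (a * b) * sqrt (c * d)))\<^sup>2"
    unfolding rhs lhs power_divide by simp
qed

lemma bhattacharyya_minus:
  assumes "is_channel Y W"
  shows "bhattacharyya (Y \<times> Y) (minus_channel W)
     \<le> 2 * bhattacharyya Y W - (bhattacharyya Y W)\<^sup>2"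
proof -
  note c = is_channelD[OF assms]
  let ?z = "\<lambda>y. sqrt (W y 0 * W y 1)"
  have "bhattacharyya (Y \<times> Y) (minus_channel W)
    = (\<Sum>y\<in>Y. \<Sum>y'\<in>Y. sqrt ((W y 0 * W y' 0 + W y 1 * W y' 1) * (W y 1 * W y' 0 + W y 0 * W y' 1)) / 2)"
    by (simp add: bhattacharyya_def sum.cartesian_product' minus_channel_def sum_bit
        real_sqrt_mult real_sqrt_divide)
  also have "\<dots> \<le> (\<Sum>y\<in>Y. \<Sum>y'\<in>Y. ((W y 0 + W y 1) * ?z y' + ?z y * (W y' 0 + W y' 1) - 2 * (?z y * ?z y')) / 2)"
    using c(2) by (intro sum_mono divide_right_mono minus_sqrt_bound) auto
  also have "\<dots> = ((\<Sum>y\<in>Y. W y 0 + W y 1) * (\<Sum>y\<in>Y. ?z y) + (\<Sum>y\<in>Y. ?z y) * (\<Sum>y\<in>Y. W y 0 + W y 1)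
      - 2 * ((\<Sum>y\<in>Y. ?z y) * (\<Sum>y\<in>Y. ?z y))) / 2"
    by (simp only: sum_divide_distrib[symmetric] sum.distrib sum_subtractf
        sum_distrib_left[symmetric] sum_distrib_right[symmetric])
  finally show ?thesis
    by (simp add: sum.distrib c(3) bhattacharyya_def power2_eq_square)
qed

lemma tv_dist_minus:
  assumes "is_channel Y W"
  shows "tv_dist (Y \<times> Y) (minus_channel W) = (tv_dist Y W)\<^sup>2"
proof -
  have "\<bar>minus_channel W (y, y') 0 - minus_channel W (y, y') 1\<bar>
      = \<bar>W y 0 - W y 1\<bar> * \<bar>W y' 0 - W y' 1\<bar> / 2" for y y'
  proof -
    have "minus_channel W (y, y') 0 - minus_channel W (y, y') 1 = (W y 0 - W y 1) * (W y' 0 - W y' 1) / 2"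
      by (simp add: minus_channel_def sum_bit field_simps)
    then show ?thesis by (simp only: abs_mult abs_divide abs_numeral)
  qed
  note * = this
  show ?thesis
    unfolding tv_dist_def sum.cartesian_product' *
    by (simp add: sum_mult_sum power2_eq_square flip: sum_divide_distrib)
qed

text \<open>A sum of two absolute values is the larger of the absolute values of the sum and the
  difference, and here these two factor. A product that is below both entries of a maximum can be
  subtracted from their sum without falling below the maximum.\<close>

lemma plus_abs_bound:
  fixes a b c d :: real
  assumes "0 \<le> a" "0 \<le> b" "0 \<le> c" "0 \<le> d"
  shows "\<bar>a * c - b * d\<bar> + \<bar>b * c - a * d\<bar>
     \<le> (a + b) * \<bar>c - d\<bar> + \<bar>a - b\<bar> * (c + d) - \<bar>a - b\<bar> * \<bar>c - d\<bar>"
proof -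
  have *: "\<bar>x\<bar> + \<bar>y\<bar> = max \<bar>x + y\<bar> \<bar>x - y\<bar>" for x y :: real
    by linarith
  have "a * c - b * d + (b * c - a * d) = (a + b) * (c - d)" "a * c - b * d - (b * c - a * d) = (a - b) * (c + d)"
    by (simp_all add: algebra_simps)
  then have "\<bar>a * c - b * d\<bar> + \<bar>b * c - a * d\<bar> = max \<bar>(a + b) * (c - d)\<bar> \<bar>(a - b) * (c + d)\<bar>"
    unfolding * by (simp only:)
  also have "\<dots> = max ((a + b) * \<bar>c - d\<bar>) (\<bar>a - b\<bar> * (c + d))"
    using assms by (simp only: abs_mult abs_of_nonneg add_nonneg_nonneg)
  also have "\<dots> \<le> (a + b) * \<bar>c - d\<bar> + \<bar>a - b\<bar> * (c + d) - \<bar>a - b\<bar> * \<bar>c - d\<bar>"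
  proof -
    have "\<bar>a - b\<bar> * \<bar>c - d\<bar> \<le> (a + b) * \<bar>c - d\<bar>" "\<bar>a - b\<bar> * \<bar>c - d\<bar> \<le> \<bar>a - b\<bar> * (c + d)"
      using assms by (auto intro!: mult_right_mono mult_left_mono)
    then show ?thesis by linarith
  qed
  finally show ?thesis .
qed

lemma tv_dist_plus:
  assumes "is_channel Y W"
  shows "tv_dist (Y \<times> Y \<times> UNIV) (plus_channel W) \<le> 2 * tv_dist Y W - (tv_dist Y W)\<^sup>2"
proof -
  note c = is_channelD[OF assms]
  let ?d = "\<lambda>y. \<bar>W y 0 - W y 1\<bar>"
  have "tv_dist (Y \<times> Y \<times> UNIV) (plus_channel W)
    = (\<Sum>y\<in>Y. \<Sum>y'\<in>Y. (\<bar>W y 0 * W y' 0 - W y 1 * W y' 1\<bar> + \<bar>W y 1 * W y' 0 - W y 0 * W y' 1\<bar>) / 4)"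
    by (simp add: tv_dist_def sum.cartesian_product' plus_channel_def sum_bit sum_divide_distrib
        diff_divide_distrib[symmetric] add_divide_distrib)
  also have "\<dots> \<le> (\<Sum>y\<in>Y. \<Sum>y'\<in>Y. ((W y 0 + W y 1) * ?d y' + ?d y * (W y' 0 + W y' 1) - ?d y * ?d y') / 4)"
    using c(2) by (intro sum_mono divide_right_mono plus_abs_bound) auto
  also have "\<dots> = ((\<Sum>y\<in>Y. W y 0 + W y 1) * (\<Sum>y\<in>Y. ?d y) + (\<Sum>y\<in>Y. ?d y) * (\<Sum>y\<in>Y. W y 0 + W y 1)
      - (\<Sum>y\<in>Y. ?d y) * (\<Sum>y\<in>Y. ?d y)) / 4"
    by (simp only: sum_divide_distrib[symmetric] sum_subtractf sum.distrib sum_mult_sum)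
  finally show ?thesis
    by (simp add: sum.distrib c(3) tv_dist_def power2_eq_square field_simps)
qed

text \<open>Cauchy-Schwarz, with \<open>W y 0 * W y 1\<close> written as minimum times maximum: the
  minima sum to \<open>1 - tv_dist Y W\<close>, the maxima to
  \<open>1 + tv_dist Y W\<close>.\<close>

lemma bhattacharyya_tv_dist:
  assumes "is_channel Y W"
  shows "(bhattacharyya Y W)\<^sup>2 + (tv_dist Y W)\<^sup>2 \<le> 1"
proof -
  note c = is_channelD[OF assms]
  let ?m = "\<lambda>y. (W y 0 + W y 1) / 2 - \<bar>W y 0 - W y 1\<bar> / 2"
  let ?M = "\<lambda>y. (W y 0 + W y 1) / 2 + \<bar>W y 0 - W y 1\<bar> / 2"
  have mM: "W y 0 * W y 1 = ?m y * ?M y" for y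
    by (auto simp: abs_if field_simps power2_eq_square)
  have nonneg: "0 \<le> ?m y" "0 \<le> ?M y" if "y \<in> Y" for y
    using c(2)[OF that] by (auto simp: abs_if add_nonneg_nonneg field_simps)
  have "bhattacharyya Y W = (\<Sum>y\<in>Y. sqrt (?m y) * sqrt (?M y))"
    unfolding bhattacharyya_def mM by (simp add: real_sqrt_mult)
  then have "(bhattacharyya Y W)\<^sup>2 \<le> (\<Sum>y\<in>Y. (sqrt (?m y))\<^sup>2) * (\<Sum>y\<in>Y. (sqrt (?M y))\<^sup>2)"
    using Cauchy_Schwarz_ineq_sum[of "\<lambda>y. sqrt (?m y)" "\<lambda>y. sqrt (?M y)" Y] by simp
  also have "\<dots> = (\<Sum>y\<in>Y. ?m y) * (\<Sum>y\<in>Y. ?M y)"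
    using nonneg by (intro arg_cong2[where f = times] sum.cong refl) auto
  also have "\<dots> = (1 - tv_dist Y W) * (1 + tv_dist Y W)"
    by (simp add: sum.distrib sum_subtractf c(3) tv_dist_def flip: sum_divide_distrib)
  finally show ?thesis
    by (simp add: power2_eq_square algebra_simps)
qed

lemma info_density_le:
  assumes "0 \<le> a" "0 \<le> b"
  shows "info_density a b \<le> a"
proof (cases "a = 0")
  case False
  then have "log 2 (2 * a / (a + b)) \<le> log 2 2"
    using assms by (intro log_mono) (auto simp: field_simps)
  then show ?thesis
    using mult_left_mono[of _ 1 a] assms by (auto simp: info_density_def)
qed (simp add: info_density_def)

text \<open>By \<open>ln x \<le> x - 1\<close> the two terms add up to at most
  \<open>(a - b)^2 / (a + b)\<close> over \<open>ln 2\<close>, and the distance of \<open>a\<close>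
  and \<open>b\<close> is at most \<open>a + b\<close>.\<close>

lemma info_density_sum_le:
  assumes "0 \<le> a" "0 \<le> b"
  shows "info_density a b + info_density b a \<le> \<bar>a - b\<bar> / ln 2"
proof -
  have *: "info_density u v * ln 2 \<le> u * (u - v) / (u + v)" if "0 \<le> u" "0 \<le> v" for u v
  proof (cases "u = 0")
    case False
    then have "ln (2 * u / (u + v)) \<le> 2 * u / (u + v) - 1"
      using that by (intro ln_le_minus_one) auto
    also have "\<dots> = (u - v) / (u + v)"
      using that False by (simp add: field_simps)
    finally show ?thesis
      using that mult_left_mono[of _ _ u] by (fastforce simp: info_density_def log_def)
  qed (simp add: info_density_def)
  have "(info_density a b + info_density b a) * ln 2 \<le> a * (a - b) / (a + b) + b * (b - a) / (b + a)"
    using *[of a b] *[of b a] assms by (simp add: algebra_simps)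
  also have "\<dots> = \<bar>a - b\<bar> * (\<bar>a - b\<bar> / (a + b))"
    by (simp add: field_simps add_divide_distrib[symmetric] flip: power2_eq_square)
       (simp add: power2_eq_square algebra_simps)
  also have "\<dots> \<le> \<bar>a - b\<bar> * 1"
    using assms by (intro mult_left_mono) (auto simp: divide_le_eq_1)
  finally show ?thesis
    by (simp add: field_simps)
qed

lemma uniform_info_le_1:
  assumes "is_channel Y W"
  shows "uniform_info Y W \<le> 1"
proof -
  note c = is_channelD[OF assms]
  have "uniform_info Y W \<le> (\<Sum>y\<in>Y. W y 0 + W y 1) / 2"
    unfolding uniform_info_def using c(2)
    by (intro divide_right_mono sum_mono add_mono info_density_le) auto
  then show ?thesis by (simp add: sum.distrib c(3))
qed

lemma uniform_info_le_tv_dist: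
  assumes "is_channel Y W"
  shows "uniform_info Y W \<le> tv_dist Y W / ln 2"
proof -
  note c = is_channelD[OF assms]
  have "uniform_info Y W \<le> (\<Sum>y\<in>Y. \<bar>W y 0 - W y 1\<bar> / ln 2) / 2"
    unfolding uniform_info_def using c(2)
    by (intro divide_right_mono sum_mono info_density_sum_le) auto
  then show ?thesis by (simp add: tv_dist_def flip: sum_divide_distrib)
qed

text \<open>Chain rule for mutual information; the two sums telescope because the input of
  \<^term>\<open>minus_channel W\<close> is part of the output of \<^term>\<open>plus_channel W\<close>.\<close>

lemma info_density_chain:
  fixes a b c d :: real
  assumes "0 \<le> a" "0 \<le> b" "0 \<le> c" "0 \<le> d"
  shows "info_density ((a * c + b * d) / 2) ((b * c + a * d) / 2)
       + info_density (a * c / 2) (b * d / 2) + info_density (b * d / 2) (a * c / 2)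
     = (a * c * (log 2 (2 * a / (a + b)) + log 2 (2 * c / (c + d)))
      + b * d * (log 2 (2 * b / (b + a)) + log 2 (2 * d / (d + c)))) / 2"
proof -
  define s where "s = a * c + b * d"
  \<comment> \<open>The sum \<open>s\<close> stands in the numerator of one logarithm and in the
    denominator of the other, so it cancels. If the weight \<open>u * v\<close> is 0, both sides
    vanish.\<close>
  have step: "u * v * log 2 (2 * (s / 2) / (s / 2 + (b * c + a * d) / 2))
      + u * v * log 2 (2 * (u * v / 2) / (s / 2))
      = u * v * (log 2 (2 * u / (u + u')) + log 2 (2 * v / (v + v')))"
    if uv: "0 \<le> u" "0 \<le> v" "0 \<le> u'" "0 \<le> v'" "s = u * v + u' * v'" "u + u' = a + b" "v + v' = c + d" for u v u' v'
  proof (cases "u * v = 0")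
    case False
    then have pos: "0 < u" "0 < v" using uv by auto
    have s0: "0 < s" using pos uv by (simp add: add_pos_nonneg)
    have tot: "s + (b * c + a * d) = (u + u') * (v + v')"
      unfolding uv(6,7) s_def by (simp add: algebra_simps)
    have t0: "0 < (u + u') * (v + v')" using pos uv by (simp add: add_pos_nonneg)
    have "log 2 (2 * (s / 2) / (s / 2 + (b * c + a * d) / 2)) + log 2 (2 * (u * v / 2) / (s / 2))
      = log 2 (2 * s / ((u + u') * (v + v'))) + log 2 (2 * (u * v) / s)"
      unfolding tot[symmetric] by (simp add: field_simps)
    also have "\<dots> = log 2 (2 * s / ((u + u') * (v + v')) * (2 * (u * v) / s))"
      using s0 t0 pos by (intro log_mult_pos[symmetric]) auto
    also have "2 * s / ((u + u') * (v + v')) * (2 * (u * v) / s) = (2 * u / (u + u')) * (2 * v / (v + v'))"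
      using s0 by (simp add: field_simps)
    also have "log 2 \<dots> = log 2 (2 * u / (u + u')) + log 2 (2 * v / (v + v'))"
      using pos uv by (intro log_mult_pos) (auto simp: add_pos_nonneg)
    finally show ?thesis
      by (simp add: distrib_left[symmetric])
  qed auto
  have 1: "info_density (s / 2) ((b * c + a * d) / 2)
    = (a * c * log 2 (2 * (s / 2) / (s / 2 + (b * c + a * d) / 2))
      + b * d * log 2 (2 * (s / 2) / (s / 2 + (b * c + a * d) / 2))) / 2"
    unfolding info_density_def by (simp add: s_def algebra_simps add_divide_distrib)
  have 2: "info_density (a * c / 2) (b * d / 2) = a * c * log 2 (2 * (a * c / 2) / (s / 2)) / 2"
    "info_density (b * d / 2) (a * c / 2) = b * d * log 2 (2 * (b * d / 2) / (s / 2)) / 2"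
    by (simp_all add: info_density_def s_def add_divide_distrib add.commute)
  show ?thesis
    using step[of a c b d] step[of b d a c] assms
    unfolding 1[unfolded s_def, folded s_def] 2 s_def[symmetric]
    by (simp add: s_def add.commute add_divide_distrib)
qed

lemma uniform_info_chain:
  assumes "is_channel Y W"
  shows "uniform_info (Y \<times> Y) (minus_channel W) + uniform_info (Y \<times> Y \<times> UNIV) (plus_channel W)
     = 2 * uniform_info Y W"
proof -
  note c = is_channelD[OF assms]
  define L0 where "L0 y = log 2 (2 * W y 0 / (W y 0 + W y 1))" for y
  define L1 where "L1 y = log 2 (2 * W y 1 / (W y 1 + W y 0))" for y
  have "uniform_info (Y \<times> Y) (minus_channel W) + uniform_info (Y \<times> Y \<times> UNIV) (plus_channel W)
    = (\<Sum>y\<in>Y. \<Sum>y'\<in>Y.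
        (W y 0 * W y' 0 * (L0 y + L0 y') + W y 1 * W y' 1 * (L1 y + L1 y')) / 2
      + (W y 1 * W y' 0 * (L1 y + L0 y') + W y 0 * W y' 1 * (L0 y + L1 y')) / 2) / 2"
    unfolding uniform_info_def sum.cartesian_product' minus_channel_def plus_channel_def prod.case sum_bit
      add_divide_distrib[symmetric] sum.distrib[symmetric]
  proof (intro arg_cong2[where f = "(/)"] sum.cong refl)
    fix y y' assume y: "y \<in> Y" "y' \<in> Y"
    note nn = c(2)[OF y(1), of 0] c(2)[OF y(1), of 1] c(2)[OF y(2), of 0] c(2)[OF y(2), of 1]
    show "info_density ((W y (0 + 0) * W y' 0 + W y (0 + 1) * W y' 1) / 2) ((W y (1 + 0) * W y' 0 + W y (1 + 1) * W y' 1) / 2)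
      + info_density ((W y (1 + 0) * W y' 0 + W y (1 + 1) * W y' 1) / 2) ((W y (0 + 0) * W y' 0 + W y (0 + 1) * W y' 1) / 2)
      + (info_density (W y (0 + 0) * W y' 0 / 2) (W y (0 + 1) * W y' 1 / 2)
       + info_density (W y (0 + 1) * W y' 1 / 2) (W y (0 + 0) * W y' 0 / 2)
       + (info_density (W y (1 + 0) * W y' 0 / 2) (W y (1 + 1) * W y' 1 / 2)
       + info_density (W y (1 + 1) * W y' 1 / 2) (W y (1 + 0) * W y' 0 / 2)))
      = (W y 0 * W y' 0 * (L0 y + L0 y') + W y 1 * W y' 1 * (L1 y + L1 y')
         + (W y 1 * W y' 0 * (L1 y + L0 y') + W y 0 * W y' 1 * (L0 y + L1 y'))) / 2"
      \<comment> \<open>The second instance exchanges \<open>a\<close> and \<open>b\<close>; it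
        accounts for the minus input 1.\<close>
      using info_density_chain[OF nn] info_density_chain[OF nn(2,1,3,4)]
      by (simp add: L0_def L1_def add_divide_distrib)
  qed
  also have "\<dots> = (\<Sum>y\<in>Y. \<Sum>y'\<in>Y. ((W y 0 * L0 y + W y 1 * L1 y) * (W y' 0 + W y' 1)
      + (W y 0 + W y 1) * (W y' 0 * L0 y' + W y' 1 * L1 y')) / 2) / 2"
    by (intro arg_cong2[where f = "(/)"] sum.cong refl) (simp add: field_simps)
  also have "\<dots> = ((\<Sum>y\<in>Y. W y 0 * L0 y + W y 1 * L1 y) * (\<Sum>y\<in>Y. W y 0 + W y 1)
      + (\<Sum>y\<in>Y. W y 0 + W y 1) * (\<Sum>y\<in>Y. W y 0 * L0 y + W y 1 * L1 y)) / 2 / 2"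
    by (simp only: sum_divide_distrib[symmetric] sum.distrib[where A = Y] sum_mult_sum)
  also have "\<dots> = 2 * uniform_info Y W"
    by (simp add: sum.distrib c(3) uniform_info_def info_density_def L0_def L1_def)
  finally show ?thesis .
qed

subsection \<open>The rate of polarization\<close>

lemma sum_lessThan_double:
  fixes f :: "nat \<Rightarrow> 'a::comm_monoid_add"
  shows "(\<Sum>l<2 * n. f l) = (\<Sum>l<n. f (2 * l) + f (2 * l + 1))"
  by (induction n) (simp_all add: add.assoc)

lemma sum_lessThan_power_Suc:
  fixes f :: "nat \<Rightarrow> 'a::comm_monoid_add"
  shows "(\<Sum>l<2 ^ Suc i. f l) = (\<Sum>l<2 ^ i. f (2 * l) + f (2 * l + 1))"
  using sum_lessThan_double[of f "2 ^ i"] by simp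

text \<open>When the binary digits of \<open>r\<close> code a path in the tree of split channels,
  this counts its plus steps.\<close>

fun ones :: "nat \<Rightarrow> nat" where
  "ones r = (if r = 0 then 0 else ones (r div 2) + r mod 2)"

declare ones.simps [simp del]

lemma ones_0 [simp]: "ones 0 = 0"
  by (simp add: ones.simps)

lemma ones_double [simp]: "ones (2 * r) = ones r"
  by (cases "r = 0") (simp_all add: ones.simps[of "2 * r"])

lemma ones_Suc_double [simp]: "ones (Suc (2 * r)) = Suc (ones r)"
  by (simp add: ones.simps[of "Suc (2 * r)"])

text \<open>The generating function of the digit sum factors over the digits, each contributing
  \<open>1 + c\<close>.\<close>

lemma sum_power_ones:
  fixes c :: "'a::comm_semiring_1"
  shows "(\<Sum>r<2 ^ j. c ^ ones r) = (1 + c) ^ j"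
proof (induction j)
  case (Suc j)
  have "(\<Sum>r<2 ^ Suc j. c ^ ones r) = (\<Sum>r<2 ^ j. (1 + c) * c ^ ones r)"
    unfolding sum_lessThan_power_Suc by (simp add: distrib_right)
  then show ?case
    by (simp add: Suc.IH flip: sum_distrib_left)
qed simp

text \<open>A Chernoff bound: each counted \<open>r\<close> has weight
  \<open>c ^ (4 * ones r)\<close> at least \<open>c ^ j\<close>, while all weights together give
  \<open>(5 / 4) ^ j\<close> because \<open>c ^ 4 = 1 / 4\<close>. What matters is that
  \<open>5 / 8 * sqrt 2\<close> is below 1.\<close>

lemma card_few_ones:
  "real (card {r. r < 2 ^ j \<and> 4 * ones r < j}) \<le> 2 ^ j * (5 / 8 * sqrt 2) ^ j"
proof -
  define c :: real where "c = 1 / sqrt 2"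
  have c: "0 < c" "c \<le> 1" "c ^ 4 = 1 / 4" "1 / c = sqrt 2"
    by (auto simp: c_def power_divide power4_eq_xxxx)
  let ?B = "{r. r < 2 ^ j \<and> 4 * ones r < j}"
  have "real (card ?B) * c ^ j = (\<Sum>r\<in>?B. c ^ j)"
    by simp
  also have "\<dots> \<le> (\<Sum>r\<in>?B. (c ^ 4) ^ ones r)"
    using c by (intro sum_mono) (auto simp flip: power_mult intro!: power_decreasing)
  also have "\<dots> \<le> (\<Sum>r<2 ^ j. (c ^ 4) ^ ones r)"
    using c by (intro sum_mono2) auto
  also have "\<dots> = (5 / 4) ^ j"
    unfolding sum_power_ones c by simp
  finally have "real (card ?B) \<le> (5 / 4) ^ j / c ^ j"
    using c by (simp add: field_simps)
  also have "\<dots> = (5 / 4 * (1 / c)) ^ j"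
    by (simp add: power_divide power_mult_distrib)
  also have "\<dots> = 2 ^ j * (5 / 8 * sqrt 2) ^ j"
    unfolding c(4) by (simp flip: power_mult_distrib)
  finally show ?thesis .
qed

text \<open>The two terms are the factors by which the potential \<open>sqrt (z * t)\<close>
  changes, at most, in a plus and in a minus step. At \<open>z = t = 1\<close> they would sum to 2;
  the constraint keeps away from this point by forcing \<open>z * t \<le> 1 / 2\<close>.\<close>

lemma sqrt_contraction:
  fixes z t :: real
  assumes "0 \<le> z" "0 \<le> t" "z\<^sup>2 + t\<^sup>2 \<le> 1"
  shows "sqrt (z * (2 - t)) + sqrt (t * (2 - z)) \<le> 2 * sqrt (15 / 16)"
proof -
  define a b where "a = z * (2 - t)" and "b = t * (2 - z)"
  have "z\<^sup>2 \<le> 1\<^sup>2" "t\<^sup>2 \<le> 1\<^sup>2"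
    using assms(3) zero_le_power2[of z] zero_le_power2[of t] unfolding power_one by linarith+
  then have le1: "z \<le> 1" "t \<le> 1"
    by (auto intro: power2_le_imp_le)
  then have nn: "0 \<le> a" "0 \<le> b"
    using assms(1,2) by (auto simp: a_def b_def)
  define p e where "p = z * t" and "e = (1 - z) * (1 - t)"
  have p: "0 \<le> p" "p \<le> 1 / 2" and e: "0 \<le> e"
    using assms le1 sum_squares_bound[of z t] by (auto simp: p_def e_def)
  have ab: "a + b = 2 - 2 * e" "a * b = p * (2 - p + 2 * e)"
    by (simp_all add: a_def b_def p_def e_def algebra_simps)
  \<comment> \<open>The slack \<open>e\<close> cancels in the square of
    \<open>sqrt a + sqrt b\<close>: \<open>a + b\<close> loses \<open>2 * e\<close>, twice this
    bound gains \<open>2 * e\<close>, and \<open>2 + 7 / 4 = 15 / 4\<close> remains.\<close>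
  have "sqrt (a * b) \<le> 7 / 8 + e"
  proof (rule real_le_lsqrt)
    have "p * (2 - p) \<le> 3 / 4"
    proof -
      have "0 \<le> (1 - 2 * p) * (3 - 2 * p)" using p by simp
      then show ?thesis by (simp add: algebra_simps)
    qed
    moreover have "p * e \<le> 1 / 2 * e" using p e by (intro mult_right_mono) auto
    ultimately show "a * b \<le> (7 / 8 + e)\<^sup>2"
      unfolding ab(2) using e by (simp add: power2_eq_square algebra_simps add_increasing)
  qed (use e in auto)
  then have "(sqrt a + sqrt b)\<^sup>2 \<le> 15 / 4"
    using nn ab(1) by (simp add: power2_sum real_sqrt_mult)
  then have "sqrt a + sqrt b \<le> sqrt (15 / 4)"
    by (rule real_le_rsqrt)
  also have "sqrt (15 / 4) = 2 * sqrt (15 / 16)"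
    by (simp add: real_sqrt_divide)
  finally show ?thesis by (simp add: a_def b_def)
qed

text \<open>Rests on \<open>(15 / 16) ^ 16 \<le> 1 / 2\<close>. Written as a power of 2, the bound
  on the average potential is the square of the threshold later imposed on \<open>Z\<close>.\<close>

lemma power_15_16_bound: "sqrt (15 / 16) ^ n \<le> (2::real) powr (- (real n / 32))"
proof -
  have "sqrt (15 / 16) ^ (2 * 16) = (15 / 16 :: real) ^ 16"
    unfolding power_mult by simp
  also have "\<dots> \<le> 1 / 2" by (simp add: power_divide)
  finally have "sqrt (15 / 16) ^ 32 \<le> (1 / 2 :: real)" by simp
  then have "root 32 (sqrt (15 / 16) ^ 32) \<le> root 32 (1 / 2)"
    by simp
  then have "sqrt (15 / 16) \<le> root 32 (1 / 2)"
    using real_root_power_cancel[of 32 "sqrt (15 / 16)"] by simp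
  then have "sqrt (15 / 16) \<le> (1 / 2) powr (1 / 32)"
    by (simp add: root_powr_inverse)
  then have "sqrt (15 / 16) ^ n \<le> ((1 / 2) powr (1 / 32)) ^ n"
    by (intro power_mono) auto
  also have "\<dots> = 2 powr (- (real n / 32))"
    by (simp add: powr_powr powr_minus_divide powr_divide flip: powr_realpow)
  finally show ?thesis .
qed

text \<open>\<open>Z\<close>, \<open>T\<close> and \<open>I\<close> stand for the Bhattacharyya parameter, the total variation distance and the
  mutual information of the split channels; node \<open>l\<close> of level \<open>i\<close> has the children \<open>2 * l\<close> (minus)
  and \<open>2 * l + 1\<close> (plus).\<close>

locale polarization_process =
  fixes Z T I :: "nat \<Rightarrow> nat \<Rightarrow> real"
  assumes Z_nonneg: "l < 2 ^ i \<Longrightarrow> 0 \<le> Z i l"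
    and T_nonneg: "l < 2 ^ i \<Longrightarrow> 0 \<le> T i l"
    and Z_T: "l < 2 ^ i \<Longrightarrow> (Z i l)\<^sup>2 + (T i l)\<^sup>2 \<le> 1"
    and Z_plus: "l < 2 ^ i \<Longrightarrow> Z (Suc i) (2 * l + 1) = (Z i l)\<^sup>2"
    and Z_minus: "l < 2 ^ i \<Longrightarrow> Z (Suc i) (2 * l) \<le> 2 * Z i l - (Z i l)\<^sup>2"
    and T_plus: "l < 2 ^ i \<Longrightarrow> T (Suc i) (2 * l + 1) \<le> 2 * T i l - (T i l)\<^sup>2"
    and T_minus: "l < 2 ^ i \<Longrightarrow> T (Suc i) (2 * l) = (T i l)\<^sup>2"
    and I_le_1: "l < 2 ^ i \<Longrightarrow> I i l \<le> 1"
    and I_le_T: "l < 2 ^ i \<Longrightarrow> I i l \<le> T i l / ln 2"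
    and I_chain: "l < 2 ^ i \<Longrightarrow> I (Suc i) (2 * l) + I (Suc i) (2 * l + 1) = 2 * I i l"
begin

lemma sum_I: "(\<Sum>l<2 ^ i. I i l) = 2 ^ i * I 0 0"
proof (induction i)
  case (Suc i)
  have "(\<Sum>l<2 ^ Suc i. I (Suc i) l) = (\<Sum>l<2 ^ i. 2 * I i l)"
    unfolding sum_lessThan_power_Suc by (intro sum.cong) (use I_chain in auto)
  then show ?case
    by (simp add: Suc.IH flip: sum_distrib_left)
qed simp

text \<open>The factor \<open>Z\<close> contracts along plus steps and the factor \<open>T\<close> along minus steps, so the average
  of the potential contracts whatever the behaviour of the other factor.\<close>

lemma sum_potential: "(\<Sum>l<2 ^ i. sqrt (Z i l * T i l)) \<le> 2 ^ i * sqrt (15 / 16) ^ i"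
proof (induction i)
  case 0
  have "Z 0 0 * T 0 0 \<le> 1"
    using Z_T[of 0 0] sum_squares_bound[of "Z 0 0" "T 0 0"] Z_nonneg[of 0 0] T_nonneg[of 0 0]
      mult_nonneg_nonneg[of "Z 0 0" "T 0 0"] by simp
  then show ?case by simp
next
  case (Suc i)
  have "(\<Sum>l<2 ^ Suc i. sqrt (Z (Suc i) l * T (Suc i) l))
    \<le> (\<Sum>l<2 ^ i. 2 * sqrt (15 / 16) * sqrt (Z i l * T i l))"
    unfolding sum_lessThan_power_Suc
  proof (intro sum_mono)
    fix l assume "l \<in> {..<(2::nat) ^ i}"
    then have l: "l < 2 ^ i" by simp
    define z t where "z = Z i l" and "t = T i l"
    have zt: "0 \<le> z" "0 \<le> t" "z\<^sup>2 + t\<^sup>2 \<le> 1"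
      using Z_nonneg[OF l] T_nonneg[OF l] Z_T[OF l] by (auto simp: z_def t_def)
    have "sqrt (Z (Suc i) (2 * l) * T (Suc i) (2 * l)) \<le> sqrt ((2 * z - z\<^sup>2) * t\<^sup>2)"
      unfolding T_minus[OF l] t_def z_def using Z_minus[OF l]
      by (intro real_sqrt_le_mono mult_right_mono) auto
    also have "\<dots> = sqrt (z * t) * sqrt (t * (2 - z))"
      unfolding real_sqrt_mult[symmetric] by (simp add: power2_eq_square algebra_simps)
    finally have 1: "sqrt (Z (Suc i) (2 * l) * T (Suc i) (2 * l)) \<le> sqrt (z * t) * sqrt (t * (2 - z))" .
    have "sqrt (Z (Suc i) (2 * l + 1) * T (Suc i) (2 * l + 1)) \<le> sqrt (z\<^sup>2 * (2 * t - t\<^sup>2))"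
      unfolding Z_plus[OF l] t_def z_def using T_plus[OF l]
      by (intro real_sqrt_le_mono mult_left_mono) auto
    also have "\<dots> = sqrt (z * t) * sqrt (z * (2 - t))"
      unfolding real_sqrt_mult[symmetric] by (simp add: power2_eq_square algebra_simps)
    finally have 2: "sqrt (Z (Suc i) (2 * l + 1) * T (Suc i) (2 * l + 1)) \<le> sqrt (z * t) * sqrt (z * (2 - t))" .
    have "sqrt (z * t) * (sqrt (z * (2 - t)) + sqrt (t * (2 - z))) \<le> sqrt (z * t) * (2 * sqrt (15 / 16))"
      using zt by (intro mult_left_mono sqrt_contraction) auto
    with 1 2 show "sqrt (Z (Suc i) (2 * l) * T (Suc i) (2 * l)) +
       sqrt (Z (Suc i) (2 * l + 1) * T (Suc i) (2 * l + 1)) \<le> 2 * sqrt (15 / 16) * sqrt (Z i l * T i l)"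
      by (simp add: distrib_left z_def t_def mult_ac)
  qed
  also have "\<dots> = 2 * sqrt (15 / 16) * (\<Sum>l<2 ^ i. sqrt (Z i l * T i l))"
    by (simp only: sum_distrib_left)
  also have "\<dots> \<le> 2 * sqrt (15 / 16) * (2 ^ i * sqrt (15 / 16) ^ i)"
    by (intro mult_left_mono Suc.IH) auto
  finally show ?case by (simp add: mult_ac)
qed

text \<open>Markov's inequality for the potential, whose average is at most the square of
  \<open>\<tau> n\<close>: \<open>Z\<close> and \<open>T\<close> both exceed \<open>\<tau> n\<close>
  on at most a fraction \<open>\<tau> n\<close> of the indices. Where \<open>T\<close> is small,
  \<open>I\<close> is at most \<open>\<tau> n / ln 2\<close>. The remaining information sits on
  indices with small \<open>Z\<close>, at most 1 on each.\<close>

lemma card_small_Z: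
  defines "\<tau> \<equiv> \<lambda>n. 2 powr (- (real n / 64))"
  shows "2 ^ n * (I 0 0 - (1 + 1 / ln 2) * \<tau> n) \<le> real (card {l. l < 2 ^ n \<and> Z n l \<le> \<tau> n})"
proof -
  let ?G = "{l. l < 2 ^ n \<and> Z n l \<le> \<tau> n}"
  have tau: "0 < \<tau> n" by (simp add: \<tau>_def)
  have "2 ^ n * I 0 0 = (\<Sum>l<2 ^ n. I n l)"
    by (simp add: sum_I)
  also have "\<dots> \<le> (\<Sum>l<2 ^ n. of_bool (l \<in> ?G) + \<tau> n / ln 2 + sqrt (Z n l * T n l) / \<tau> n)"
  proof (intro sum_mono)
    fix l assume "l \<in> {..<(2::nat) ^ n}"
    then have l: "l < 2 ^ n" by simp
    note nn = Z_nonneg[OF l] T_nonneg[OF l]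
    consider "l \<in> ?G" | "T n l \<le> \<tau> n" | "\<tau> n < Z n l" "\<tau> n < T n l"
      using l by force
    then show "I n l \<le> of_bool (l \<in> ?G) + \<tau> n / ln 2 + sqrt (Z n l * T n l) / \<tau> n"
    proof cases
      case 1
      then show ?thesis using I_le_1[OF l] nn tau by (simp add: add_increasing2)
    next
      case 2
      then have "T n l / ln 2 \<le> \<tau> n / ln 2" by (intro divide_right_mono) auto
      then have "I n l \<le> \<tau> n / ln 2" using I_le_T[OF l] by linarith
      moreover have "0 \<le> sqrt (Z n l * T n l) / \<tau> n" using nn tau by simp
      ultimately show ?thesis by (simp add: add_increasing)
    next
      case 3
      then have "\<tau> n * \<tau> n \<le> Z n l * T n l" using tau by (intro mult_mono) auto
      then have "\<tau> n \<le> sqrt (Z n l * T n l)" by (intro real_le_rsqrt) (simp add: power2_eq_square)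
      then have "1 \<le> sqrt (Z n l * T n l) / \<tau> n" using tau by simp
      moreover have "0 \<le> \<tau> n / ln 2" using tau by simp
      ultimately show ?thesis using I_le_1[OF l] by simp
    qed
  qed
  also have "\<dots> = real (card ?G) + 2 ^ n * (\<tau> n / ln 2) + (\<Sum>l<2 ^ n. sqrt (Z n l * T n l)) / \<tau> n"
  proof -
    have "{..<2 ^ n} \<inter> Collect (\<lambda>l. l \<in> ?G) = ?G" by auto
    then show ?thesis
      by (simp add: sum.distrib sum_of_bool_eq flip: sum_divide_distrib del: mem_Collect_eq)
  qed
  also have "(\<Sum>l<2 ^ n. sqrt (Z n l * T n l)) / \<tau> n \<le> 2 ^ n * (\<tau> n * \<tau> n) / \<tau> n"
  proof (intro divide_right_mono)
    have "(\<Sum>l<2 ^ n. sqrt (Z n l * T n l)) \<le> 2 ^ n * 2 powr (- (real n / 32))"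
      using sum_potential[of n] power_15_16_bound[of n]
      by (meson mult_left_mono order_trans zero_le_numeral zero_le_power)
    also have "2 powr (- (real n / 32)) = \<tau> n * \<tau> n"
      by (simp add: \<tau>_def flip: powr_add)
    finally show "(\<Sum>l<2 ^ n. sqrt (Z n l * T n l)) \<le> 2 ^ n * (\<tau> n * \<tau> n)" .
  qed (use tau in simp)
  finally show ?thesis using tau by (simp add: algebra_simps)
qed

text \<open>The digits of \<open>r\<close> are the steps below node \<open>l\<close>. In the
  exponent a plus step doubles and a minus step costs at most 1. Reserving \<open>j\<close> in
  advance pays for all minus steps, because the factor \<open>2 ^ ones r\<close> multiplies the
  reserve as well.\<close>

lemma Z_descendant:
  assumes "l < 2 ^ n" "Z n l \<le> 2 powr (- X)" "r < 2 ^ j" "real j \<le> X"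
  shows "Z (n + j) (l * 2 ^ j + r) \<le> 2 powr (- (2 ^ ones r * (X - real j)))"
  using assms(3,4)
proof (induction j arbitrary: r)
  case 0
  then show ?case using assms(2) by simp
next
  case (Suc j)
  define r' where "r' = r div 2"
  have r': "r' < 2 ^ j" using Suc.prems by (simp add: r'_def less_mult_imp_div_less mult.commute)
  define v where "v = l * 2 ^ j + r'"
  have v: "v < 2 ^ (n + j)"
  proof -
    have "v < (l + 1) * 2 ^ j" using r' by (simp add: v_def)
    also have "\<dots> \<le> 2 ^ n * 2 ^ j" using assms(1) by (intro mult_right_mono) auto
    finally show ?thesis by (simp add: power_add)
  qed
  define a where "a = 2 ^ ones r' * (X - real j)"
  have IH: "Z (n + j) v \<le> 2 powr (- a)"
    using Suc.IH[OF r'] Suc.prems by (simp add: v_def a_def)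
  have pos: "(1::real) \<le> 2 ^ ones r'" by simp
  have a1: "2 ^ ones r' * (X - real (Suc j)) \<le> a - 1"
    using pos by (simp add: a_def algebra_simps)
  show ?case
  proof (cases "even r")
    case True
    then have r: "r = 2 * r'" by (simp add: r'_def)
    have "Z (Suc (n + j)) (2 * v) \<le> 2 * Z (n + j) v"
      using Z_minus[OF v] by (smt (verit) zero_le_power2)
    also have "\<dots> \<le> 2 * 2 powr (- a)" using IH by simp
    also have "\<dots> = 2 powr (- (a - 1))"
      by (simp add: powr_diff powr_minus field_simps)
    also have "\<dots> \<le> 2 powr (- (2 ^ ones r' * (X - real (Suc j))))"
      using a1 by simp
    moreover have "n + Suc j = Suc (n + j)" "l * 2 ^ Suc j + r = 2 * v" "ones r = ones r'"
      unfolding r by (simp_all add: v_def)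
    ultimately show ?thesis by (simp only:)
  next
    case False
    then have r: "r = Suc (2 * r')" by (simp add: r'_def)
    have "Z (Suc (n + j)) (2 * v + 1) \<le> (2 powr (- a))\<^sup>2"
      unfolding Z_plus[OF v] using IH Z_nonneg[OF v] by (intro power_mono) auto
    also have "\<dots> = 2 powr (- (2 * a))"
      by (simp add: power2_eq_square flip: powr_add)
    also have "\<dots> \<le> 2 powr (- (2 ^ ones r * (X - real (Suc j))))"
      using a1 unfolding r by simp
    moreover have "n + Suc j = Suc (n + j)" "l * 2 ^ Suc j + r = 2 * v + 1"
      unfolding r by (simp_all add: v_def)
    ultimately show ?thesis by (simp only:)
  qed
qed

theorem polarization_rate:
  assumes "0 < \<epsilon>"
  shows "\<forall>\<^sub>F i in sequentially. 2 ^ i * (I 0 0 - \<epsilon>)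
    \<le> real (card {l. l < 2 ^ i \<and> Z i l \<le> 2 powr (- ((2 ^ i) powr (1 / 1024)))})"
proof -
  define \<kappa> :: real where "\<kappa> = 5 / 8 * sqrt 2"
  have \<kappa>: "0 < \<kappa>" "\<kappa> < 1"
  proof -
    have "\<kappa>\<^sup>2 < 1\<^sup>2" by (simp add: \<kappa>_def power_mult_distrib power_divide)
    then show "\<kappa> < 1" by (rule power2_less_imp_less) simp
  qed (simp add: \<kappa>_def)
  have "(\<lambda>i. \<kappa> ^ (i div 128)) \<longlonglongrightarrow> 0"
  proof (rule filterlim_compose[OF LIMSEQ_power_zero])
    show "filterlim (\<lambda>i::nat. i div 128) sequentially sequentially"
      unfolding filterlim_at_top
    proof
      fix N :: nat
      show "\<forall>\<^sub>F i in sequentially. N \<le> i div 128"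
        using eventually_ge_at_top[of "N * 128"] by eventually_elim (simp add: less_eq_div_iff_mult_less_eq)
    qed
  qed (use \<kappa> in simp)
  moreover have "(\<lambda>i. (1 + 1 / ln 2) * ((1 / 2) powr (1 / 128)) ^ i) \<longlonglongrightarrow> (1 + 1 / ln 2) * (0::real)"
    by (intro tendsto_intros LIMSEQ_power_zero) (use powr_less_mono2[of "1 / 128" "1 / 2" 1] in simp)
  ultimately have "(\<lambda>i. \<kappa> ^ (i div 128) + (1 + 1 / ln 2) * ((1 / 2) powr (1 / 128)) ^ i)
    \<longlonglongrightarrow> 0 + (1 + 1 / ln 2) * (0::real)"
    by (rule tendsto_add)
  \<comment> \<open>The first term is the fraction of paths with too few plus steps. The second
    dominates the loss of \<open>card_small_Z\<close> at level \<open>i - i div 128\<close>.\<close>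
  then have "\<forall>\<^sub>F i in sequentially. \<kappa> ^ (i div 128) + (1 + 1 / ln 2) * ((1 / 2) powr (1 / 128)) ^ i < \<epsilon>"
    using assms by (intro order_tendstoD(2)[where a = \<epsilon>]) auto
  moreover have "\<forall>\<^sub>F i in sequentially. (256::nat) \<le> i"
    by (rule eventually_ge_at_top)
  ultimately show ?thesis
  proof eventually_elim
    case (elim i)
    \<comment> \<open>With \<open>n\<close> about \<open>127 * i / 128\<close>, the exponent
      \<open>n / 64\<close> exceeds the at most \<open>j\<close> lost units by 1 once
      \<open>256 \<le> i\<close>. A quarter of \<open>j\<close> is about \<open>i / 512\<close>;
      halving this to \<open>i / 1024\<close> absorbs the rounding in \<open>i div 128\<close>,
      again for \<open>256 \<le> i\<close>.\<close>
    define j n where "j = i div 128" and "n = i - j"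
    have nj: "n + j = i" by (simp add: n_def j_def)
    have j: "real i / 128 - 1 \<le> real j" "real j \<le> real i / 128" and n: "real n = real i - real j"
      by (auto simp: j_def n_def of_nat_diff)
    have i256: "256 \<le> real i" using elim(2) by simp
    define X where "X = real n / 64"
    have X: "real j \<le> X" "1 \<le> X - real j"
      unfolding X_def n using j i256 by (simp_all add: field_simps)
    define G where "G = {l. l < 2 ^ n \<and> Z n l \<le> 2 powr (- X)}"
    define B where "B = {r. r < 2 ^ j \<and> 4 * ones r < j}"
    define H where "H = {r. r < 2 ^ j \<and> \<not> 4 * ones r < j}"
    let ?A = "{l. l < 2 ^ i \<and> Z i l \<le> 2 powr (- ((2 ^ i) powr (1 / 1024)))}"
    have "(\<lambda>(l, r). l * 2 ^ j + r) ` (G \<times> H) \<subseteq> ?A"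
    proof clarify
      fix l r assume l: "l \<in> G" and r: "r \<in> H"
      have "l * 2 ^ j + r < (l + 1) * 2 ^ j" using r by (simp add: H_def)
      also have "\<dots> \<le> 2 ^ n * 2 ^ j" using l by (intro mult_right_mono) (auto simp: G_def)
      finally have lt: "l * 2 ^ j + r < 2 ^ i" by (simp add: nj flip: power_add)
      have "real i / 1024 \<le> real (ones r)"
        using r j(1) elim by (simp add: H_def not_less)
      then have "(2 ^ i) powr (1 / 1024) \<le> (2::real) ^ ones r"
        by (simp add: powr_powr flip: powr_realpow)
      also have "\<dots> \<le> 2 ^ ones r * (X - real j)" using X(2) by simp
      finally have "2 powr (- (2 ^ ones r * (X - real j))) \<le> (2::real) powr (- ((2 ^ i) powr (1 / 1024)))"
        by simp
      moreover have "Z i (l * 2 ^ j + r) \<le> 2 powr (- (2 ^ ones r * (X - real j)))"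
        using Z_descendant[of l n X r j] l r X by (simp add: G_def H_def nj)
      ultimately show "l * 2 ^ j + r < 2 ^ i \<and> Z i (l * 2 ^ j + r) \<le> 2 powr (- ((2 ^ i) powr (1 / 1024)))"
        using lt by (meson order_trans)
    qed
    moreover have "inj_on (\<lambda>(l, r). l * 2 ^ j + r) (G \<times> H)"
    proof (rule inj_onI, clarify)
      fix l r l' r' assume "r \<in> H" "r' \<in> H" and eq: "l * 2 ^ j + r = l' * 2 ^ j + r'"
      then have "r < 2 ^ j" "r' < 2 ^ j"
        by (auto simp: H_def)
      then have "(l * 2 ^ j + r) div 2 ^ j = l" "(l' * 2 ^ j + r') div 2 ^ j = l'" by simp_all
      with eq show "l = l' \<and> r = r'" by simp
    qed
    ultimately have "card (G \<times> H) \<le> card ?A"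
      by (intro card_inj_on_le[where f = "\<lambda>(l, r). l * 2 ^ j + r"]) auto
    then have "real (card G) * real (card H) \<le> real (card ?A)"
      by (simp add: card_cartesian_product flip: of_nat_mult)
    moreover have "real (card G) * (2 ^ j - 2 ^ j * \<kappa> ^ j) \<le> real (card G) * real (card H)"
    proof (intro mult_left_mono)
      have "card B + card H = card {..<(2::nat) ^ j}"
        unfolding B_def H_def
        by (subst card_Un_disjoint[symmetric]) (auto intro!: arg_cong[where f = card] simp del: card_lessThan)
      then have "real (card B) + real (card H) = 2 ^ j"
        by (simp flip: of_nat_add)
      then show "2 ^ j - 2 ^ j * \<kappa> ^ j \<le> real (card H)"
        using card_few_ones[of j] by (simp add: B_def \<kappa>_def)
    qed simp
    moreover have "2 ^ j * (2 ^ n * (I 0 0 - (1 + 1 / ln 2) * 2 powr (- X))) - 2 ^ n * (2 ^ j * \<kappa> ^ j)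
        \<le> real (card G) * (2 ^ j - 2 ^ j * \<kappa> ^ j)"
    proof -
      have "card G \<le> card {..<(2::nat) ^ n}" by (intro card_mono) (auto simp: G_def)
      then have "real (card G) \<le> 2 ^ n" by simp
      then have "real (card G) * (2 ^ j * \<kappa> ^ j) \<le> 2 ^ n * (2 ^ j * \<kappa> ^ j)"
        using \<kappa> by (intro mult_right_mono) auto
      moreover have "2 ^ j * (2 ^ n * (I 0 0 - (1 + 1 / ln 2) * 2 powr (- X))) \<le> 2 ^ j * real (card G)"
        using card_small_Z[of n] by (simp add: G_def X_def)
      ultimately show ?thesis by (simp add: algebra_simps)
    qed
    moreover have "2 ^ j * (2 ^ n * (I 0 0 - (1 + 1 / ln 2) * 2 powr (- X))) - 2 ^ n * (2 ^ j * \<kappa> ^ j)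
      = 2 ^ i * (I 0 0 - (1 + 1 / ln 2) * 2 powr (- X) - \<kappa> ^ j)"
      by (simp add: algebra_simps flip: nj power_add) (simp add: power_add)
    moreover have "2 ^ i * (I 0 0 - \<epsilon>) \<le> 2 ^ i * (I 0 0 - (1 + 1 / ln 2) * 2 powr (- X) - \<kappa> ^ j)"
    proof (intro mult_left_mono)
      have "2 powr (- X) \<le> 2 powr (- (real i / 128))"
        using j n by (simp add: X_def)
      also have "\<dots> = ((1 / 2) powr (1 / 128)) ^ i"
        by (simp add: powr_powr powr_minus_divide powr_divide flip: powr_realpow)
      finally have "(1 + 1 / ln 2) * 2 powr (- X) \<le> (1 + 1 / ln 2) * ((1 / 2) powr (1 / 128)) ^ i"
        by (intro mult_left_mono) auto
      then show "I 0 0 - \<epsilon> \<le> I 0 0 - (1 + 1 / ln 2) * 2 powr (- X) - \<kappa> ^ j"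
        using elim(1) by (simp add: j_def)
    qed simp
    ultimately show ?case by linarith
  qed
qed

end

text \<open>Bit sums and products stay in the form \<open>+\<close> and \<open>*\<close>, so that
  the ring laws remain applicable.\<close>

declare add_bit_eq_xor [simp del] mult_bit_eq_and [simp del]

section \<open>Blocks of symbols and sums over them\<close>

lemma finite_blocks [simp]: "finite Y \<Longrightarrow> finite (blocks Y n)"
  using finite_lists_length_eq[of Y n] by (simp add: blocks_def)

lemma finite_bit_blocks [simp]: "finite (bit_blocks n)"
  by (rule finite_blocks) (metis UNIV_bit finite.emptyI finite.insertI)

lemma card_bit_blocks: "card (bit_blocks n) = 2 ^ n"
proof -
  have "finite (UNIV :: bit set)" "card (UNIV :: bit set) = 2"
    by (simp_all add: UNIV_bit)
  then show ?thesis
    using card_lists_length_eq[of "UNIV :: bit set" n] by (simp add: blocks_def)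
qed

lemma bit_blocks_iff [simp]: "w \<in> bit_blocks n \<longleftrightarrow> length w = n"
  by (simp add: blocks_def)

lemma bij_betw_append_blocks:
  "bij_betw (\<lambda>(a, b). a @ b) (blocks Y m \<times> blocks Y n) (blocks Y (m + n))"
  by (rule bij_betw_byWitness[where f' = "\<lambda>w. (take m w, drop m w)"])
     (auto simp: blocks_def dest: in_set_takeD in_set_dropD)

lemma bij_betw_snoc_blocks:
  "bij_betw (\<lambda>(a, x). a @ [x]) (blocks Y n \<times> Y) (blocks Y (Suc n))"
proof (rule bij_betw_byWitness[where f' = "\<lambda>w. (butlast w, last w)"])
  have "w \<noteq> []" if "w \<in> blocks Y (Suc n)" for w
    using that by (auto simp: blocks_def)
  then show "\<forall>w\<in>blocks Y (Suc n). (\<lambda>(a, x). a @ [x]) (butlast w, last w) = w"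
    "(\<lambda>w. (butlast w, last w)) ` blocks Y (Suc n) \<subseteq> blocks Y n \<times> Y"
    by (auto simp: blocks_def in_set_butlastD dest: in_set_butlastD last_in_set)
qed (auto simp: blocks_def)

lemma bij_betw_Cons_blocks:
  "bij_betw (\<lambda>(x, a). x # a) (Y \<times> blocks Y n) (blocks Y (Suc n))"
  by (rule bij_betw_byWitness[where f' = "\<lambda>w. (hd w, tl w)"])
     (auto simp: blocks_def length_Suc_conv)

lemma sum_blocks_append:
  "(\<Sum>w\<in>blocks Y (m + n). f w) = (\<Sum>a\<in>blocks Y m. \<Sum>b\<in>blocks Y n. f (a @ b))"
  using sum.reindex_bij_betw[OF bij_betw_append_blocks, of f Y m n]
  by (simp add: sum.cartesian_product')

lemma sum_blocks_Suc:
  "(\<Sum>w\<in>blocks Y (Suc n). f w) = (\<Sum>x\<in>Y. \<Sum>a\<in>blocks Y n. f (x # a))"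
  using sum.reindex_bij_betw[OF bij_betw_Cons_blocks, of f Y n]
  by (simp add: sum.cartesian_product')

subsection \<open>Recursive structure of the polar transform\<close>

lemma bit_reverse_less: "bit_reverse i r < 2 ^ i"
proof (induction i arbitrary: r)
  case (Suc i)
  show ?case using Suc[of "r div 2"] by (cases "even r") (simp_all add: mod_2_eq_odd)
qed simp

text \<open>The recursion of \<open>bit_reverse\<close> peels off the lowest digit; the proof that
  it is an involution has to peel off the highest one as well.\<close>

lemma bit_reverse_top:
  "k < 2 ^ i \<Longrightarrow> a < 2 \<Longrightarrow> bit_reverse (Suc i) (a * 2 ^ i + k) = 2 * bit_reverse i k + a"
proof (induction i arbitrary: k)
  case (Suc i)
  have "bit_reverse (Suc (Suc i)) (a * 2 ^ Suc i + k)
      = 2 ^ Suc i * (k mod 2) + bit_reverse (Suc i) (a * 2 ^ i + k div 2)"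
  proof -
    have "(a * 2 ^ Suc i + k) div 2 = a * 2 ^ i + k div 2"
      by (simp add: mult.left_commute[of _ 2])
    moreover have "(a * 2 ^ Suc i + k) mod 2 = k mod 2"
      by (simp add: mult.left_commute[of _ 2])
    ultimately show ?thesis by (simp only: bit_reverse.simps(2)[of "Suc i"])
  qed
  also have "bit_reverse (Suc i) (a * 2 ^ i + k div 2) = 2 * bit_reverse i (k div 2) + a"
    using Suc.prems by (intro Suc.IH) auto
  finally show ?case by simp
qed simp

lemma bit_reverse_bit_reverse: "r < 2 ^ i \<Longrightarrow> bit_reverse i (bit_reverse i r) = r"
proof (induction i arbitrary: r)
  case (Suc i)
  have "bit_reverse (Suc i) (bit_reverse (Suc i) r)
      = bit_reverse (Suc i) (r mod 2 * 2 ^ i + bit_reverse i (r div 2))"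
    by (simp add: mult.commute)
  also have "\<dots> = 2 * bit_reverse i (bit_reverse i (r div 2)) + r mod 2"
    by (intro bit_reverse_top) (auto simp: bit_reverse_less)
  also have "bit_reverse i (bit_reverse i (r div 2)) = r div 2"
    using Suc.prems by (intro Suc.IH) auto
  finally show ?case by simp
qed simp

lemma dim_polar_kernel [simp]: "dim_row polar_kernel = 2" "dim_col polar_kernel = 2"
  by (simp_all add: polar_kernel_def mat_of_rows_list_def)

lemma polar_kernel_entries [simp]:
  "polar_kernel $$ (0, 0) = 1" "polar_kernel $$ (0, Suc 0) = 0"
  "polar_kernel $$ (Suc 0, 0) = 1" "polar_kernel $$ (Suc 0, Suc 0) = 1"
  by (simp_all add: polar_kernel_def mat_of_rows_list_def)

lemma dim_kronecker_power [simp]: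
  "dim_row (kronecker_power A i) = dim_row A ^ i" "dim_col (kronecker_power A i) = dim_col A ^ i"
  by (induction i) (simp_all add: kronecker_def)

lemma dim_polar_mat [simp]: "dim_row (polar_mat i) = 2 ^ i" "dim_col (polar_mat i) = 2 ^ i"
  by (simp_all add: polar_mat_def bit_reversal_mat_def)

lemma polar_mat_entry:
  assumes "r < 2 ^ i" "c < 2 ^ i"
  shows "polar_mat i $$ (r, c) = kronecker_power polar_kernel i $$ (bit_reverse i r, c)"
proof -
  have "polar_mat i $$ (r, c) = row (bit_reversal_mat i) r \<bullet> col (kronecker_power polar_kernel i) c"
    using assms by (simp add: polar_mat_def bit_reversal_mat_def)
  also have "\<dots> = (\<Sum>k<2 ^ i. of_bool (r = bit_reverse i k) * kronecker_power polar_kernel i $$ (k, c))"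
    unfolding scalar_prod_def using assms
    by (intro sum.cong) (auto simp: bit_reversal_mat_def)
  also have "\<dots> = (\<Sum>k<2 ^ i. if k = bit_reverse i r then kronecker_power polar_kernel i $$ (k, c) else 0)"
    using assms by (intro sum.cong) (auto simp: bit_reverse_bit_reverse)
  finally show ?thesis by (simp add: bit_reverse_less)
qed

lemma polar_mat_0_entry: "polar_mat 0 $$ (0, 0) = 1"
  by (simp add: polar_mat_entry)

text \<open>Bit reversal turns the lowest digit of the row index into the highest one, which is the
  digit read by the outer Kronecker factor. Hence rows \<open>2 * r\<close> and
  \<open>2 * r + 1\<close> are the two children of row \<open>r\<close>.\<close>

lemma polar_mat_Suc_entry:
  assumes "r < 2 ^ i" "a < 2" "c < 2 ^ Suc i"
  shows "polar_mat (Suc i) $$ (2 * r + a, c)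
     = polar_kernel $$ (a, c div 2 ^ i) * polar_mat i $$ (r, c mod 2 ^ i)"
proof -
  have "polar_mat (Suc i) $$ (2 * r + a, c)
      = kronecker_power polar_kernel (Suc i) $$ (bit_reverse (Suc i) (2 * r + a), c)"
    using assms by (intro polar_mat_entry) simp_all
  also have "bit_reverse (Suc i) (2 * r + a) = a * 2 ^ i + bit_reverse i r"
    using assms(2) by simp
  finally have *: "polar_mat (Suc i) $$ (2 * r + a, c)
      = kronecker_power polar_kernel (Suc i) $$ (a * 2 ^ i + bit_reverse i r, c)" .
  have "a * 2 ^ i + bit_reverse i r < 2 * 2 ^ i"
    using assms(2) bit_reverse_less[of i r] by (auto simp: less_2_cases_iff)
  moreover have "(a * 2 ^ i + bit_reverse i r) div 2 ^ i = a" "(a * 2 ^ i + bit_reverse i r) mod 2 ^ i = bit_reverse i r"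
    using bit_reverse_less[of i r] by simp_all
  ultimately show ?thesis
    unfolding * using assms by (simp add: polar_mat_entry kronecker_def del: div_mult_self1 div_mult_self2 mod_mult_self1 mod_mult_self2)
qed

lemma length_row_times [simp]: "length (row_times v G) = dim_col G"
  by (simp add: row_times_def)

lemma row_times_nth:
  assumes "c < dim_col G" "length v = dim_row G"
  shows "row_times v G ! c = (\<Sum>r<dim_row G. v ! r * G $$ (r, c))"
  using assms unfolding row_times_def scalar_prod_def
  by (auto simp: vec_of_list_index intro!: sum.cong)

text \<open>The change of variables under which the transform of double length acts on the two
  halves separately: \<open>b\<close> holds the odd positions, \<open>a\<close> the sums of
  neighbours.\<close>

fun interleave :: "bit list \<Rightarrow> bit list \<Rightarrow> bit list" where
  "interleave (a # as) (b # bs) = (a + b) # b # interleave as bs"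
| "interleave _ _ = []"

lemma length_interleave [simp]:
  "length a = length b \<Longrightarrow> length (interleave a b) = 2 * length b"
  by (induction a b rule: interleave.induct) auto

lemma interleave_append:
  "length a = length b \<Longrightarrow> interleave (a @ a') (b @ b') = interleave a b @ interleave a' b'"
  by (induction a b rule: interleave.induct) auto

lemma bit_add_self [simp]: "a + a = (0 :: bit)"
  by (cases a) auto

lemma bit_add_self2 [simp]: "a + b + b = a" "b + (b + a) = (a :: bit)" "b + (a + b) = a"
  by (cases a; cases b; simp)+

lemma interleave_snoc:
  "length a = length b \<Longrightarrow> interleave (a @ [u + x]) (b @ [x]) = interleave a b @ [u, x]"
  by (simp add: interleave_append)

lemma nth_interleave:
  assumes "length a = length b" "k < length b"
  shows "interleave a b ! (2 * k) = a ! k + b ! k" "interleave a b ! (2 * k + 1) = b ! k"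
  using assms
proof (induction a b arbitrary: k rule: interleave.induct)
  case (1 a as b bs)
  { case 1 then show ?case using "1.IH" by (cases k) auto }
  { case 2 then show ?case using "1.IH" by (cases k) auto }
qed auto

lemma inj_on_interleave: "inj_on (\<lambda>(a, b). interleave a b) (bit_blocks n \<times> bit_blocks n)"
proof (rule inj_onI, clarify)
  fix a b a' b' :: "bit list"
  assume "a \<in> bit_blocks n" "b \<in> bit_blocks n" "a' \<in> bit_blocks n" "b' \<in> bit_blocks n"
    and eq: "interleave a b = interleave a' b'"
  then have len: "length a = n" "length b = n" "length a' = n" "length b' = n" by auto
  have "b ! k = b' ! k" if "k < n" for k
    using nth_interleave(2)[of a b k] nth_interleave(2)[of a' b' k] len that eq by simp
  then have "b = b'" using len by (intro nth_equalityI) auto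
  moreover have "a ! k = a' ! k" if "k < n" for k
    using nth_interleave(1)[of a b k] nth_interleave(1)[of a' b' k] len that eq \<open>b = b'\<close> by simp
  then have "a = a'" using len by (intro nth_equalityI) auto
  ultimately show "a = a' \<and> b = b'" by simp
qed

lemma bij_betw_interleave:
  "bij_betw (\<lambda>(a, b). interleave a b) (bit_blocks n \<times> bit_blocks n) (bit_blocks (2 * n))"
  unfolding bij_betw_def
proof
  show "(\<lambda>(a, b). interleave a b) ` (bit_blocks n \<times> bit_blocks n) = bit_blocks (2 * n)"
  \<comment> \<open>Surjectivity by counting: \<open>2 ^ n * 2 ^ n\<close> pairs for
    \<open>2 ^ (2 * n)\<close> words.\<close>
  proof (rule card_subset_eq)
    show "card ((\<lambda>(a, b). interleave a b) ` (bit_blocks n \<times> bit_blocks n)) = card (bit_blocks (2 * n))"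
      by (simp add: card_image[OF inj_on_interleave] card_cartesian_product card_bit_blocks
          power_add[symmetric] mult_2)
  qed auto
qed (rule inj_on_interleave)

lemma sum_interleave:
  "(\<Sum>w\<in>bit_blocks (2 * n). f w) = (\<Sum>a\<in>bit_blocks n. \<Sum>b\<in>bit_blocks n. f (interleave a b))"
  using sum.reindex_bij_betw[OF bij_betw_interleave, of f n]
  by (simp add: sum.cartesian_product')

text \<open>In the left half, column 0 of the kernel adds \<open>a ! r + b ! r\<close> and
  \<open>b ! r\<close>, so \<open>b\<close> cancels modulo 2; in the right half, column 1 keeps only
  \<open>b\<close>.\<close>

lemma row_times_interleave:
  assumes "length a = 2 ^ i" "length b = 2 ^ i"
  shows "row_times (interleave a b) (polar_mat (Suc i)) = row_times a (polar_mat i) @ row_times b (polar_mat i)"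
proof (rule nth_equalityI)
  fix c assume "c < length (row_times (interleave a b) (polar_mat (Suc i)))"
  then have c: "c < 2 ^ Suc i" by simp
  have "row_times (interleave a b) (polar_mat (Suc i)) ! c
      = (\<Sum>r<2 * 2 ^ i. interleave a b ! r * polar_mat (Suc i) $$ (r, c))"
    using assms c by (subst row_times_nth) auto
  also have "\<dots> = (\<Sum>r<2 ^ i. interleave a b ! (2 * r) * polar_mat (Suc i) $$ (2 * r + 0, c)
      + interleave a b ! (2 * r + 1) * polar_mat (Suc i) $$ (2 * r + 1, c))"
    unfolding sum_lessThan_double by simp
  also have "\<dots> = (\<Sum>r<2 ^ i. ((a ! r + b ! r) * polar_kernel $$ (0, c div 2 ^ i)
      + b ! r * polar_kernel $$ (1, c div 2 ^ i)) * polar_mat i $$ (r, c mod 2 ^ i))"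
  proof (intro sum.cong refl)
    fix r assume "r \<in> {..<(2::nat) ^ i}"
    then have r: "r < 2 ^ i" by simp
    show "interleave a b ! (2 * r) * polar_mat (Suc i) $$ (2 * r + 0, c)
        + interleave a b ! (2 * r + 1) * polar_mat (Suc i) $$ (2 * r + 1, c)
      = ((a ! r + b ! r) * polar_kernel $$ (0, c div 2 ^ i)
        + b ! r * polar_kernel $$ (1, c div 2 ^ i)) * polar_mat i $$ (r, c mod 2 ^ i)"
      using polar_mat_Suc_entry[OF r _ c, of 0] polar_mat_Suc_entry[OF r _ c, of 1]
        nth_interleave[of a b r] assms r
      by (simp add: distrib_right mult.assoc)
  qed
  also have "\<dots> = (row_times a (polar_mat i) @ row_times b (polar_mat i)) ! c"
  proof (cases "c < 2 ^ i")
    case True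
    then show ?thesis using assms by (simp add: nth_append row_times_nth)
  next
    case False
    then have "c div 2 ^ i = 1" "c mod 2 ^ i = c - 2 ^ i"
      using c by (auto simp: div_nat_eqI mod_if le_mod_geq)
    then show ?thesis using assms c False by (simp add: nth_append row_times_nth)
  qed
  finally show "row_times (interleave a b) (polar_mat (Suc i)) ! c
    = (row_times a (polar_mat i) @ row_times b (polar_mat i)) ! c" .
qed simp

section \<open>Split channels of one level in terms of the level above\<close>

lemma prod_lessThan_add:
  fixes f :: "nat \<Rightarrow> 'a::comm_monoid_mult"
  shows "(\<Prod>j<m + n. f j) = (\<Prod>j<m. f j) * (\<Prod>j<n. f (m + j))"
  by (induction n) (simp_all add: mult.assoc)

lemma vec_channel_append:
  assumes "length y = length x" "length y' = length x'"
  shows "vec_channel p (y @ y') (x @ x') = vec_channel p y x * vec_channel p y' x'"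
  using assms by (simp add: vec_channel_def prod_lessThan_add nth_append)

lemma polar_channel_interleave:
  assumes "length y = 2 ^ i" "length y' = 2 ^ i" "length a = 2 ^ i" "length b = 2 ^ i"
  shows "polar_channel p (Suc i) (y @ y') (interleave a b) = polar_channel p i y a * polar_channel p i y' b"
  using assms by (simp add: polar_channel_def row_times_interleave vec_channel_append)

text \<open>The unnormalized likelihood of a prefix. It does not distinguish the current bit from
  the past, so one product rule serves the minus and the plus step.\<close>

definition prefix_channel :: "'y channel \<Rightarrow> nat \<Rightarrow> 'y list \<Rightarrow> bit list \<Rightarrow> real" where
  "prefix_channel p i y h = (\<Sum>c\<in>bit_blocks (2 ^ i - length h). polar_channel p i y (h @ c))"

lemma split_channel_prefix:
  "split_channel p i y w x = prefix_channel p i y (w @ [x]) / 2 ^ (2 ^ i - 1)"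
  by (simp add: split_channel_def prefix_channel_def)

lemma prefix_channel_step:
  assumes "length h < 2 ^ i"
  shows "prefix_channel p i y h = (\<Sum>x\<in>UNIV. prefix_channel p i y (h @ [x]))"
proof -
  have "2 ^ i - length h = Suc (2 ^ i - Suc (length h))" using assms by simp
  then show ?thesis by (simp add: prefix_channel_def sum_blocks_Suc)
qed

lemma prefix_channel_interleave:
  assumes "length y = 2 ^ i" "length y' = 2 ^ i" "length a = length b" "length b \<le> 2 ^ i"
  shows "prefix_channel p (Suc i) (y @ y') (interleave a b) = prefix_channel p i y a * prefix_channel p i y' b"
proof -
  have len: "2 ^ Suc i - length (interleave a b) = 2 * (2 ^ i - length b)"
    using assms by simp
  have "prefix_channel p (Suc i) (y @ y') (interleave a b)
    = (\<Sum>c\<in>bit_blocks (2 ^ i - length b). \<Sum>d\<in>bit_blocks (2 ^ i - length b).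
        polar_channel p (Suc i) (y @ y') (interleave (a @ c) (b @ d)))"
    unfolding prefix_channel_def len sum_interleave
    using assms(3) by (simp add: interleave_append)
  also have "\<dots> = (\<Sum>c\<in>bit_blocks (2 ^ i - length b). \<Sum>d\<in>bit_blocks (2 ^ i - length b).
        polar_channel p i y (a @ c) * polar_channel p i y' (b @ d))"
    using assms by (intro sum.cong refl polar_channel_interleave) auto
  also have "\<dots> = prefix_channel p i y a * prefix_channel p i y' b"
    using assms(3) by (simp add: prefix_channel_def sum_product)
  finally show ?thesis .
qed

text \<open>The exponent for level \<open>i + 1\<close> is twice that for level \<open>i\<close>
  plus 1; the surplus is the factor \<open>1 / 2\<close> in \<open>minus_channel\<close> and
  \<open>plus_channel\<close>.\<close>

lemma split_channel_scaling:
  fixes a b :: real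
  shows "a * b / 2 ^ (2 ^ Suc i - 1) = (a / 2 ^ (2 ^ i - 1)) * (b / 2 ^ (2 ^ i - 1)) / 2"
proof -
  have "2 ^ Suc i - 1 = Suc ((2 ^ i - 1) + (2 ^ i - 1 :: nat))"
    using not0_implies_Suc[of "2 ^ i"] by auto
  then show ?thesis by (simp only: power_Suc power_add) simp
qed

lemma split_channel_minus:
  assumes "length y = 2 ^ i" "length y' = 2 ^ i" "length a = length b" "length b < 2 ^ i"
  shows "split_channel p (Suc i) (y @ y') (interleave a b) u
    = minus_channel (\<lambda>(y, w). split_channel p i y w) ((y, a), (y', b)) u"
proof -
  \<comment> \<open>The bit \<open>u\<close> is at an even position and forms only half of a pair;
    summing out its partner \<open>x\<close> completes the prefix.\<close>
  have "prefix_channel p (Suc i) (y @ y') (interleave a b @ [u])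
    = (\<Sum>x\<in>UNIV. prefix_channel p (Suc i) (y @ y') (interleave (a @ [u + x]) (b @ [x])))"
    using assms by (subst prefix_channel_step) (auto simp: interleave_snoc)
  also have "\<dots> = (\<Sum>x\<in>UNIV. prefix_channel p i y (a @ [u + x]) * prefix_channel p i y' (b @ [x]))"
    using assms by (intro sum.cong refl prefix_channel_interleave) auto
  finally show ?thesis
    unfolding split_channel_prefix minus_channel_def prod.case
    by (simp only: sum_divide_distrib split_channel_scaling)
qed

lemma split_channel_plus:
  assumes "length y = 2 ^ i" "length y' = 2 ^ i" "length a = length b" "length b < 2 ^ i"
  shows "split_channel p (Suc i) (y @ y') (interleave a b @ [u]) x
    = plus_channel (\<lambda>(y, w). split_channel p i y w) ((y, a), (y', b), u) x"
proof -
  have "prefix_channel p (Suc i) (y @ y') ((interleave a b @ [u]) @ [x])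
    = prefix_channel p (Suc i) (y @ y') (interleave (a @ [u + x]) (b @ [x]))"
    using assms(3) by (simp add: interleave_snoc)
  also have "\<dots> = prefix_channel p i y (a @ [u + x]) * prefix_channel p i y' (b @ [x])"
    using assms by (intro prefix_channel_interleave) auto
  finally show ?thesis
    unfolding split_channel_prefix plus_channel_def prod.case
    by (simp only: split_channel_scaling)
qed

definition split_outputs :: "'y set \<Rightarrow> nat \<Rightarrow> nat \<Rightarrow> ('y list \<times> bit list) set" where
  "split_outputs Y i l = blocks Y (2 ^ i) \<times> bit_blocks l"

definition split_law :: "'y channel \<Rightarrow> nat \<Rightarrow> ('y list \<times> bit list) channel" where
  "split_law p i = (\<lambda>(y, w). split_channel p i y w)"

lemma bij_betw_split_minus:
  "bij_betw (\<lambda>((y, a), (y', b)). (y @ y', interleave a b))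
     (split_outputs Y i l \<times> split_outputs Y i l) (split_outputs Y (Suc i) (2 * l))"
proof -
  have "bij_betw (\<lambda>((y, a), (y', b)). ((y, y'), (a, b)))
     (split_outputs Y i l \<times> split_outputs Y i l)
     ((blocks Y (2 ^ i) \<times> blocks Y (2 ^ i)) \<times> (bit_blocks l \<times> bit_blocks l))"
    by (rule bij_betw_byWitness[where f' = "\<lambda>((y, y'), (a, b)). ((y, a), (y', b))"])
       (auto simp: split_outputs_def)
  from bij_betw_trans[OF this bij_betw_map_prod[OF bij_betw_append_blocks bij_betw_interleave]]
  show ?thesis
    by (simp add: split_outputs_def mult_2 o_def case_prod_beta' map_prod_def)
qed

lemma bij_betw_split_plus:
  "bij_betw (\<lambda>((y, a), (y', b), u). (y @ y', interleave a b @ [u]))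
     (split_outputs Y i l \<times> split_outputs Y i l \<times> UNIV) (split_outputs Y (Suc i) (2 * l + 1))"
proof -
  have "bij_betw (\<lambda>(z, z', u). ((z, z'), u)) (split_outputs Y i l \<times> split_outputs Y i l \<times> UNIV)
      ((split_outputs Y i l \<times> split_outputs Y i l) \<times> (UNIV :: bit set))"
    by (rule bij_betw_byWitness[where f' = "\<lambda>((z, z'), u). (z, z', u)"]) auto
  from bij_betw_trans[OF this bij_betw_map_prod[OF bij_betw_split_minus bij_betw_id]]
  have A: "bij_betw (\<lambda>((y, a), (y', b), u). ((y @ y', interleave a b), u))
      (split_outputs Y i l \<times> split_outputs Y i l \<times> UNIV) (split_outputs Y (Suc i) (2 * l) \<times> (UNIV :: bit set))"
    by (simp add: o_def case_prod_beta' map_prod_def)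
  have B: "bij_betw (\<lambda>((y, w), u). (y, (w, u))) (split_outputs Y (Suc i) (2 * l) \<times> (UNIV :: bit set))
      (blocks Y (2 ^ Suc i) \<times> (bit_blocks (2 * l) \<times> UNIV))"
    by (rule bij_betw_byWitness[where f' = "\<lambda>(y, w, u). ((y, w), u)"]) (auto simp: split_outputs_def)
  from bij_betw_trans[OF A B]
  have "bij_betw (\<lambda>((y, a), (y', b), u). (y @ y', (interleave a b, u)))
      (split_outputs Y i l \<times> split_outputs Y i l \<times> UNIV) (blocks Y (2 ^ Suc i) \<times> (bit_blocks (2 * l) \<times> (UNIV :: bit set)))"
    by (simp add: o_def case_prod_beta')
  from bij_betw_trans[OF this bij_betw_map_prod[OF bij_betw_id bij_betw_snoc_blocks]]
  show ?thesis
    by (simp add: split_outputs_def o_def case_prod_beta' map_prod_def)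
qed

lemma split_law_minus:
  assumes "z \<in> split_outputs Y i l \<times> split_outputs Y i l" "l < 2 ^ i"
  shows "split_law p (Suc i) ((\<lambda>((y, a), (y', b)). (y @ y', interleave a b)) z) = minus_channel (split_law p i) z"
  using assms by (auto simp: split_outputs_def split_law_def blocks_def split_channel_minus)

lemma split_law_plus:
  assumes "z \<in> split_outputs Y i l \<times> split_outputs Y i l \<times> UNIV" "l < 2 ^ i"
  shows "split_law p (Suc i) ((\<lambda>((y, a), (y', b), u). (y @ y', interleave a b @ [u])) z) = plus_channel (split_law p i) z"
  using assms by (auto simp: split_outputs_def split_law_def blocks_def split_channel_plus)

lemma bij_betw_split_0: "bij_betw (\<lambda>y. ([y], [])) Y (split_outputs Y 0 0)"
  by (rule bij_betw_byWitness[where f' = "\<lambda>(y, w). hd y"])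
     (auto simp: split_outputs_def blocks_def length_Suc_conv)

lemma split_law_0: "split_law p 0 ([y], []) = p y"
proof
  fix x
  have "row_times [x] (polar_mat 0) = [x]"
    by (rule nth_equalityI) (simp_all add: row_times_nth polar_mat_0_entry)
  moreover have "bit_blocks 0 = {[]}" by (auto simp: blocks_def)
  ultimately show "split_law p 0 ([y], []) x = p y x"
    by (simp add: split_law_def split_channel_def polar_channel_def vec_channel_def)
qed

text \<open>Everything here depends on an output only through its two likelihoods, so renaming
  outputs changes nothing. This transfers the one-step results for abstract channels to split
  channels.\<close>

lemma channel_parameters_bij_betw:
  assumes f: "bij_betw f Y Y'" and W: "\<And>z. z \<in> Y \<Longrightarrow> W' (f z) = W z"
  shows "bhattacharyya Y' W' = bhattacharyya Y W" "tv_dist Y' W' = tv_dist Y W"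
    "uniform_info Y' W' = uniform_info Y W" "is_channel Y' W' \<longleftrightarrow> is_channel Y W"
proof -
  have *: "(\<Sum>z\<in>Y'. g (W' z)) = (\<Sum>z\<in>Y. g (W z))" for g :: "(bit \<Rightarrow> real) \<Rightarrow> real"
    using sum.reindex_bij_betw[OF f, of "\<lambda>z. g (W' z)"] W by simp
  show "bhattacharyya Y' W' = bhattacharyya Y W"
    unfolding bhattacharyya_def using *[of "\<lambda>w. sqrt (w 0 * w 1)"] .
  show "tv_dist Y' W' = tv_dist Y W"
    unfolding tv_dist_def using *[of "\<lambda>w. \<bar>w 0 - w 1\<bar>"] by simp
  show "uniform_info Y' W' = uniform_info Y W"
    unfolding uniform_info_def using *[of "\<lambda>w. info_density (w 0) (w 1) + info_density (w 1) (w 0)"] by simp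
  have "(\<forall>z\<in>Y'. 0 \<le> W' z x) \<longleftrightarrow> (\<forall>z\<in>Y. 0 \<le> W z x)" for x
    unfolding bij_betw_imp_surj_on[OF f, symmetric] using W by simp
  then show "is_channel Y' W' \<longleftrightarrow> is_channel Y W"
    unfolding is_channel_def using bij_betw_finite[OF f] *[of "\<lambda>w. w _"] by simp
qed

lemma channel_parameters_minus:
  assumes "l < 2 ^ i"
  shows "bhattacharyya (split_outputs Y (Suc i) (2 * l)) (split_law p (Suc i)) = bhattacharyya (split_outputs Y i l \<times> split_outputs Y i l) (minus_channel (split_law p i))"
    "tv_dist (split_outputs Y (Suc i) (2 * l)) (split_law p (Suc i)) = tv_dist (split_outputs Y i l \<times> split_outputs Y i l) (minus_channel (split_law p i))"
    "uniform_info (split_outputs Y (Suc i) (2 * l)) (split_law p (Suc i)) = uniform_info (split_outputs Y i l \<times> split_outputs Y i l) (minus_channel (split_law p i))"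
    "is_channel (split_outputs Y (Suc i) (2 * l)) (split_law p (Suc i)) \<longleftrightarrow> is_channel (split_outputs Y i l \<times> split_outputs Y i l) (minus_channel (split_law p i))"
  by (rule channel_parameters_bij_betw[OF bij_betw_split_minus], erule split_law_minus[OF _ assms])+

lemma channel_parameters_plus:
  assumes "l < 2 ^ i"
  shows "bhattacharyya (split_outputs Y (Suc i) (2 * l + 1)) (split_law p (Suc i)) = bhattacharyya (split_outputs Y i l \<times> split_outputs Y i l \<times> UNIV) (plus_channel (split_law p i))"
    "tv_dist (split_outputs Y (Suc i) (2 * l + 1)) (split_law p (Suc i)) = tv_dist (split_outputs Y i l \<times> split_outputs Y i l \<times> UNIV) (plus_channel (split_law p i))"
    "uniform_info (split_outputs Y (Suc i) (2 * l + 1)) (split_law p (Suc i)) = uniform_info (split_outputs Y i l \<times> split_outputs Y i l \<times> UNIV) (plus_channel (split_law p i))"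
    "is_channel (split_outputs Y (Suc i) (2 * l + 1)) (split_law p (Suc i)) \<longleftrightarrow> is_channel (split_outputs Y i l \<times> split_outputs Y i l \<times> UNIV) (plus_channel (split_law p i))"
  by (rule channel_parameters_bij_betw[OF bij_betw_split_plus], erule split_law_plus[OF _ assms])+

lemma channel_parameters_0:
  "uniform_info (split_outputs Y 0 0) (split_law p 0) = uniform_info Y p"
  "is_channel (split_outputs Y 0 0) (split_law p 0) \<longleftrightarrow> is_channel Y p"
  by (rule channel_parameters_bij_betw[OF bij_betw_split_0], rule split_law_0)+

lemma is_channel_split:
  assumes "is_channel Y p" "l < 2 ^ i"
  shows "is_channel (split_outputs Y i l) (split_law p i)"
  using assms(2)
proof (induction i arbitrary: l)
  case 0
  then show ?case using channel_parameters_0(2) assms(1) by auto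
next
  case (Suc i)
  define k where "k = l div 2"
  have k: "k < 2 ^ i" using Suc.prems by (simp add: k_def less_mult_imp_div_less mult.commute)
  show ?case
  proof (cases "even l")
    case True
    then have "l = 2 * k" by (simp add: k_def)
    then show ?thesis
      using channel_parameters_minus(4)[OF k, of Y p] is_channel_minus[OF Suc.IH[OF k]]
      by (simp only:)
  next
    case False
    then have "l = 2 * k + 1" by (simp add: k_def)
    then show ?thesis
      using channel_parameters_plus(4)[OF k, of Y p] is_channel_plus[OF Suc.IH[OF k]]
      by (simp only:)
  qed
qed

lemma polarization_process_split:
  assumes "is_channel Y p"
  shows "polarization_process (\<lambda>i l. bhattacharyya (split_outputs Y i l) (split_law p i))
     (\<lambda>i l. tv_dist (split_outputs Y i l) (split_law p i))
     (\<lambda>i l. uniform_info (split_outputs Y i l) (split_law p i))"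
proof
  fix i l :: nat assume l: "l < 2 ^ i"
  let ?Y = "split_outputs Y i l" and ?W = "split_law p i"
  note c = is_channel_split[OF assms l]
  note minus = channel_parameters_minus[OF l, of Y p]
  note plus = channel_parameters_plus[OF l, of Y p]
  show "0 \<le> bhattacharyya ?Y ?W" "0 \<le> tv_dist ?Y ?W"
    "(bhattacharyya ?Y ?W)\<^sup>2 + (tv_dist ?Y ?W)\<^sup>2 \<le> 1" "uniform_info ?Y ?W \<le> 1"
    "uniform_info ?Y ?W \<le> tv_dist ?Y ?W / ln 2"
    using bhattacharyya_nonneg tv_dist_nonneg bhattacharyya_tv_dist uniform_info_le_1
      uniform_info_le_tv_dist c by blast+
  show "bhattacharyya (split_outputs Y (Suc i) (2 * l + 1)) (split_law p (Suc i)) = (bhattacharyya ?Y ?W)\<^sup>2"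
    unfolding plus by (rule bhattacharyya_plus[OF c])
  show "bhattacharyya (split_outputs Y (Suc i) (2 * l)) (split_law p (Suc i))
      \<le> 2 * bhattacharyya ?Y ?W - (bhattacharyya ?Y ?W)\<^sup>2"
    unfolding minus by (rule bhattacharyya_minus[OF c])
  show "tv_dist (split_outputs Y (Suc i) (2 * l + 1)) (split_law p (Suc i))
      \<le> 2 * tv_dist ?Y ?W - (tv_dist ?Y ?W)\<^sup>2"
    unfolding plus by (rule tv_dist_plus[OF c])
  show "tv_dist (split_outputs Y (Suc i) (2 * l)) (split_law p (Suc i)) = (tv_dist ?Y ?W)\<^sup>2"
    unfolding minus by (rule tv_dist_minus[OF c])
  show "uniform_info (split_outputs Y (Suc i) (2 * l)) (split_law p (Suc i))
      + uniform_info (split_outputs Y (Suc i) (2 * l + 1)) (split_law p (Suc i)) = 2 * uniform_info ?Y ?W"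
    unfolding plus minus by (rule uniform_info_chain[OF c])
qed

lemma channel_polarization:
  assumes "is_channel Y p" "0 < \<epsilon>"
  shows "\<forall>\<^sub>F i in sequentially. 2 ^ i * (uniform_info Y p - \<epsilon>)
    \<le> real (card {l. l < 2 ^ i \<and> bhattacharyya (split_outputs Y i l) (split_law p i) \<le> 2 powr (- ((2 ^ i) powr (1 / 1024)))})"
proof -
  show ?thesis
    using polarization_process.polarization_rate[OF polarization_process_split[OF assms(1)] assms(2)]
    unfolding channel_parameters_0 .
qed

subsection \<open>Degradation\<close>

lemma sum_sqrt_mult_le:
  assumes "\<And>z. z \<in> A \<Longrightarrow> 0 \<le> f z" "\<And>z. z \<in> A \<Longrightarrow> 0 \<le> g z"
  shows "(\<Sum>z\<in>A. sqrt (f z * g z)) \<le> sqrt ((\<Sum>z\<in>A. f z) * (\<Sum>z\<in>A. g z))"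
proof (rule real_le_rsqrt)
  have "(\<Sum>z\<in>A. sqrt (f z * g z))\<^sup>2 \<le> (\<Sum>z\<in>A. (sqrt (f z))\<^sup>2) * (\<Sum>z\<in>A. (sqrt (g z))\<^sup>2)"
    using Cauchy_Schwarz_ineq_sum[of "\<lambda>z. sqrt (f z)" "\<lambda>z. sqrt (g z)" A] by (simp add: real_sqrt_mult)
  also have "\<dots> = (\<Sum>z\<in>A. f z) * (\<Sum>z\<in>A. g z)"
    using assms by simp
  finally show "(\<Sum>z\<in>A. sqrt (f z * g z))\<^sup>2 \<le> (\<Sum>z\<in>A. f z) * (\<Sum>z\<in>A. g z)" .
qed

lemma sum_blocks_prod:
  fixes f :: "nat \<Rightarrow> 'a \<Rightarrow> 'b::comm_semiring_1"
  shows "(\<Sum>y\<in>blocks Y n. \<Prod>j<n. f j (y ! j)) = (\<Prod>j<n. \<Sum>a\<in>Y. f j a)"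
proof (induction n)
  case 0
  have "blocks Y 0 = {[]}" by (auto simp: blocks_def)
  then show ?case by simp
next
  case (Suc n)
  have "(\<Sum>y\<in>blocks Y (Suc n). \<Prod>j<Suc n. f j (y ! j))
      = (\<Sum>y\<in>blocks Y n. \<Sum>a\<in>Y. \<Prod>j<Suc n. f j ((y @ [a]) ! j))"
    using sum.reindex_bij_betw[OF bij_betw_snoc_blocks, of "\<lambda>y. \<Prod>j<Suc n. f j (y ! j)" Y n]
    by (simp add: sum.cartesian_product')
  also have "\<dots> = (\<Sum>y\<in>blocks Y n. \<Sum>a\<in>Y. (\<Prod>j<n. f j (y ! j)) * f n a)"
  proof (intro sum.cong refl)
    fix y a assume "y \<in> blocks Y n"
    then have "length y = n" by (simp add: blocks_def)
    then show "(\<Prod>j<Suc n. f j ((y @ [a]) ! j)) = (\<Prod>j<n. f j (y ! j)) * f n a"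
      by (simp add: nth_append)
  qed
  also have "\<dots> = (\<Prod>j<Suc n. \<Sum>a\<in>Y. f j a)"
    by (simp add: Suc.IH flip: sum_product)
  finally show ?case .
qed

lemma sum_vec_channel:
  assumes "is_channel Y p" "length x = n"
  shows "(\<Sum>y\<in>blocks Y n. vec_channel p y x) = 1"
  using sum_blocks_prod[of "\<lambda>j a. p a (x ! j)" n Y] assms by (simp add: vec_channel_def is_channelD(3))

lemma nth_blocks: "y \<in> blocks Y n \<Longrightarrow> j < n \<Longrightarrow> y ! j \<in> Y"
  by (auto simp: blocks_def)

lemma vec_channel_nonneg:
  assumes "is_channel Y p" "y \<in> blocks Y n" "length x = n"
  shows "0 \<le> vec_channel p y x"
  using assms(2,3) by (auto simp: vec_channel_def intro!: prod_nonneg is_channelD(2)[OF assms(1)] nth_blocks)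

text \<open>The degradation of \<open>p1\<close> extends to each split channel: the product kernel
  \<open>V\<close> acts on the output block and leaves the past bits alone. Such a kernel mixes
  likelihoods, and by Cauchy-Schwarz mixing can only increase the parameter.\<close>

lemma bhattacharyya_degraded:
  assumes ch: "is_channel Y1 p1" and deg: "degraded Y1 p1 Y2 p2" and l: "l < 2 ^ i"
  shows "bhattacharyya (split_outputs Y1 i l) (split_law p1 i) \<le> bhattacharyya (split_outputs Y2 i l) (split_law p2 i)"
proof -
  obtain D where D: "\<And>y1 y2. y1 \<in> Y1 \<Longrightarrow> y2 \<in> Y2 \<Longrightarrow> 0 \<le> D y2 y1" "\<And>y1. y1 \<in> Y1 \<Longrightarrow> (\<Sum>y2\<in>Y2. D y2 y1) = 1"
    "\<And>x y2. y2 \<in> Y2 \<Longrightarrow> p2 y2 x = (\<Sum>y1\<in>Y1. p1 y1 x * D y2 y1)"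
    using deg unfolding degraded_def by blast
  define n :: nat where "n = 2 ^ i"
  define V where "V y2 y1 = (\<Prod>j<n. D (y2 ! j) (y1 ! j))" for y2 y1
  have V: "0 \<le> V y2 y1" if "y1 \<in> blocks Y1 n" "y2 \<in> blocks Y2 n" for y1 y2
    using that unfolding V_def by (intro prod_nonneg D(1)) (auto intro: nth_blocks)
  have sum_V: "(\<Sum>y2\<in>blocks Y2 n. V y2 y1) = 1" if "y1 \<in> blocks Y1 n" for y1
    unfolding V_def using sum_blocks_prod[of "\<lambda>j a. D a (y1 ! j)" n Y2] that by (simp add: D(2) nth_blocks)
  have vec: "vec_channel p2 y2 x = (\<Sum>y1\<in>blocks Y1 n. vec_channel p1 y1 x * V y2 y1)"
    if "y2 \<in> blocks Y2 n" "length x = n" for y2 x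
    using sum_blocks_prod[of "\<lambda>j a. p1 a (x ! j) * D (y2 ! j) a" n Y1] that
    by (simp add: vec_channel_def V_def D(3) nth_blocks prod.distrib)
  have split: "split_law p2 i (y2, w) x = (\<Sum>y1\<in>blocks Y1 n. split_law p1 i (y1, w) x * V y2 y1)"
    if "y2 \<in> blocks Y2 n" for y2 w x
    using that unfolding split_law_def split_channel_def polar_channel_def prod.case
    by (simp add: vec n_def[symmetric] sum_divide_distrib sum_distrib_right sum.swap[of _ "blocks Y1 n"])
  note nn = is_channelD(2)[OF is_channel_split[OF ch l], unfolded split_outputs_def n_def[symmetric]]
  have "(\<Sum>y1\<in>blocks Y1 n. sqrt (split_law p1 i (y1, w) 0 * split_law p1 i (y1, w) 1))
    \<le> (\<Sum>y2\<in>blocks Y2 n. sqrt (split_law p2 i (y2, w) 0 * split_law p2 i (y2, w) 1))"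
    if w: "w \<in> bit_blocks l" for w
  proof -
    let ?s = "\<lambda>y1. split_law p1 i (y1, w)"
    have "(\<Sum>y1\<in>blocks Y1 n. sqrt (?s y1 0 * ?s y1 1))
      = (\<Sum>y1\<in>blocks Y1 n. sqrt (?s y1 0 * ?s y1 1) * (\<Sum>y2\<in>blocks Y2 n. V y2 y1))"
      by (simp add: sum_V)
    also have "\<dots> = (\<Sum>y2\<in>blocks Y2 n. \<Sum>y1\<in>blocks Y1 n. sqrt (?s y1 0 * ?s y1 1) * V y2 y1)"
      by (simp add: sum_distrib_left sum.swap[of _ "blocks Y1 n"])
    also have "\<dots> = (\<Sum>y2\<in>blocks Y2 n. \<Sum>y1\<in>blocks Y1 n. sqrt ((?s y1 0 * V y2 y1) * (?s y1 1 * V y2 y1)))"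
    proof (intro sum.cong refl)
      fix y1 y2 assume "y1 \<in> blocks Y1 n" "y2 \<in> blocks Y2 n"
      then have "sqrt (V y2 y1 * V y2 y1) = V y2 y1" using V by simp
      then show "sqrt (?s y1 0 * ?s y1 1) * V y2 y1 = sqrt ((?s y1 0 * V y2 y1) * (?s y1 1 * V y2 y1))"
        by (simp add: real_sqrt_mult mult_ac)
    qed
    also have "\<dots> \<le> (\<Sum>y2\<in>blocks Y2 n. sqrt (split_law p2 i (y2, w) 0 * split_law p2 i (y2, w) 1))"
      using w by (intro sum_mono) (auto simp: split intro!: sum_sqrt_mult_le mult_nonneg_nonneg nn V)
    finally show ?thesis .
  qed
  then show ?thesis
    unfolding bhattacharyya_def split_outputs_def n_def[symmetric] sum.cartesian_product'
    by (subst (1 2) sum.swap) (intro sum_mono)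
qed

subsection \<open>Error probability of a split channel\<close>

text \<open>The event ignores the future bits, so these can be summed out. This yields the split
  law, already normalized by \<open>2 ^ (2 ^ i - 1)\<close>; the factor \<open>1 / 2\<close> left
  over is the probability of the current bit.\<close>

lemma split_error_prob_eq:
  assumes "l < 2 ^ i"
  shows "split_error_prob Y p i l =
    (\<Sum>z\<in>split_outputs Y i l. \<Sum>x\<in>UNIV. split_law p i z x * of_bool (split_law p i z x \<le> split_law p i z (x + 1))) / 2"
proof -
  define k :: nat where "k = 2 ^ i - l - 1"
  have n: "2 ^ i = l + Suc k" using assms by (simp add: k_def)
  have "split_error_prob Y p i l = (\<Sum>a\<in>bit_blocks l. \<Sum>x\<in>UNIV. \<Sum>c\<in>bit_blocks k. \<Sum>y\<in>blocks Y (2 ^ i).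
      1 / 2 ^ (2 ^ i) * polar_channel p i y (a @ x # c) *
      of_bool (split_channel p i y a x \<le> split_channel p i y a (x + 1)))"
    unfolding split_error_prob_def n sum_blocks_append sum_blocks_Suc
    by (intro sum.cong refl) (auto simp: nth_append)
  also have "\<dots> = (\<Sum>y\<in>blocks Y (2 ^ i). \<Sum>a\<in>bit_blocks l. \<Sum>x\<in>UNIV. \<Sum>c\<in>bit_blocks k.
      1 / 2 ^ (2 ^ i) * polar_channel p i y (a @ x # c) *
      of_bool (split_channel p i y a x \<le> split_channel p i y a (x + 1)))"
    by (simp only: sum.swap[of _ "blocks Y (2 ^ i)"])
  also have "\<dots> = (\<Sum>y\<in>blocks Y (2 ^ i). \<Sum>a\<in>bit_blocks l. \<Sum>x\<in>UNIV.
      split_channel p i y a x * of_bool (split_channel p i y a x \<le> split_channel p i y a (x + 1)) / 2)"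
  proof (intro sum.cong refl)
    fix y a x assume "a \<in> bit_blocks l"
    then have "split_channel p i y a x / 2 = (\<Sum>c\<in>bit_blocks k. polar_channel p i y (a @ x # c)) / (2 * 2 ^ (2 ^ i - 1))"
      by (simp add: split_channel_def k_def)
    also have "2 * 2 ^ (2 ^ i - 1) = (2 :: real) ^ 2 ^ i"
      by (subst power_Suc[symmetric]) simp
    finally have *: "split_channel p i y a x / 2 = (\<Sum>c\<in>bit_blocks k. 1 / 2 ^ (2 ^ i) * polar_channel p i y (a @ x # c))"
      by (simp add: sum_divide_distrib)
    show "(\<Sum>c\<in>bit_blocks k. 1 / 2 ^ (2 ^ i) * polar_channel p i y (a @ x # c) *
        of_bool (split_channel p i y a x \<le> split_channel p i y a (x + 1)))
      = split_channel p i y a x * of_bool (split_channel p i y a x \<le> split_channel p i y a (x + 1)) / 2"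
      unfolding sum_distrib_right[symmetric] *[symmetric] by simp
  qed
  finally show ?thesis
    by (simp only: split_outputs_def sum.cartesian_product' split_law_def sum_divide_distrib prod.case)
qed

text \<open>On the event the likelihood of the actual input is the smaller one, hence at most the
  geometric mean of the two.\<close>

lemma split_error_prob_le:
  assumes "is_channel Y p" "l < 2 ^ i"
  shows "split_error_prob Y p i l \<le> bhattacharyya (split_outputs Y i l) (split_law p i)"
proof -
  have "a * of_bool (a \<le> b) \<le> sqrt (a * b)" if "0 \<le> a" "0 \<le> b" for a b :: real
    using that real_le_rsqrt[of a "a * b"] mult_left_mono[of a b a] by (auto simp: power2_eq_square)
  note * = this
  have "split_error_prob Y p i l \<le> (\<Sum>z\<in>split_outputs Y i l. \<Sum>x\<in>(UNIV :: bit set). sqrt (split_law p i z 0 * split_law p i z 1)) / 2"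
    unfolding split_error_prob_eq[OF assms(2)]
  proof (intro divide_right_mono sum_mono)
    fix z and x :: bit assume "z \<in> split_outputs Y i l"
    then have "0 \<le> split_law p i z x" for x by (rule is_channelD(2)[OF is_channel_split[OF assms]])
    then show "split_law p i z x * of_bool (split_law p i z x \<le> split_law p i z (x + 1)) \<le> sqrt (split_law p i z 0 * split_law p i z 1)"
      using *[of "split_law p i z x" "split_law p i z (x + 1)"] by (cases x) (auto simp: mult.commute)
  qed simp
  moreover have "card (UNIV :: bit set) = 2" by (simp add: UNIV_bit)
  ultimately show ?thesis by (simp add: bhattacharyya_def flip: sum_distrib_left)
qed

subsection \<open>Symmetric channels\<close>

text \<open>Bounding the mutual information by the divergence from the output law of the uniform input,
  which by symmetry does not depend on the input distribution.\<close>

lemma capacity_le_uniform_info: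
  assumes ch: "is_channel Y p" and sym: "symmetric_channel Y p"
  shows "capacity Y p \<le> uniform_info Y p"
  unfolding capacity_def
proof (rule cSUP_least)
  show "{q. 0 \<le> q 0 \<and> 0 \<le> q 1 \<and> q 0 + q 1 = (1::real)} \<noteq> ({} :: (bit \<Rightarrow> real) set)"
    by (auto intro!: exI[of _ "\<lambda>_. 1 / 2"])
next
  fix q :: "bit \<Rightarrow> real" assume "q \<in> {q. 0 \<le> q 0 \<and> 0 \<le> q 1 \<and> q 0 + q 1 = 1}"
  then have q: "0 \<le> q 0" "0 \<le> q 1" "q 0 + q 1 = 1" by auto
  note c = is_channelD[OF ch]
  obtain T where T: "bij_betw T Y Y" "\<And>y. y \<in> Y \<Longrightarrow> T (T y) = y" "\<And>y. y \<in> Y \<Longrightarrow> p y 0 = p (T y) 1"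
    using sym unfolding symmetric_channel_def by blast
  have TY: "T y \<in> Y" if "y \<in> Y" for y using T(1) that by (rule bij_betwE[rule_format])
  have T': "p (T y) 0 = p y 1" if "y \<in> Y" for y using T(3)[OF TY[OF that]] T(2)[OF that] by simp
  define D where "D x = (\<Sum>y\<in>Y. info_density (p y x) (p y (x + 1)))" for x
  \<comment> \<open>The permutation \<open>T\<close> exchanges the two conditional laws, so both
    divergences agree with their mean.\<close>
  have "D 0 = (\<Sum>y\<in>Y. info_density (p (T y) 0) (p (T y) 1))"
    unfolding D_def using sum.reindex_bij_betw[OF T(1), of "\<lambda>y. info_density (p y 0) (p y 1)"] by simp
  also have "\<dots> = D 1"
    unfolding D_def using T(3) T' by (intro sum.cong) auto
  finally have D01: "D 0 = D 1" .
  then have D: "D x = uniform_info Y p" for x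
    by (cases x) (simp_all add: uniform_info_def sum.distrib D_def)
  define r where "r y = q 0 * p y 0 + q 1 * p y 1" for y
  have r: "(\<Sum>x\<in>{0, 1}. q x * p y x) = r y" for y by (simp add: r_def)
  \<comment> \<open>The correction term comes from \<open>ln x \<le> x - 1\<close> for the ratio of
    the uniform-input output law to \<open>r\<close>. Over all outputs it sums to 0, since both are
    probability distributions.\<close>
  have step: "(\<Sum>x\<in>{0, 1}. q x * p y x * log 2 (p y x / r y))
      \<le> (\<Sum>x\<in>{0, 1}. q x * info_density (p y x) (p y (x + 1))) + ((p y 0 + p y 1) / 2 - r y) / ln 2" if y: "y \<in> Y" for y
  proof (cases "r y = 0")
    case True
    then have "q 0 * p y 0 = 0" "q 1 * p y 1 = 0"
      using q c(2)[OF y] by (auto simp: r_def add_nonneg_eq_0_iff)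
    then have "q x * p y x = 0" for x by (cases x) auto
    then have "q x * p y x * u = 0" "q x * info_density (p y x) v = 0" for x u v
      by (simp_all only: info_density_def mult.assoc[symmetric] mult_zero_left)
    then have "(\<Sum>x\<in>{0, 1}. q x * p y x * log 2 (p y x / r y)) = 0"
      "(\<Sum>x\<in>{0, 1}. q x * info_density (p y x) (p y (x + 1))) = 0"
      by (simp_all only: sum.neutral_const)
    then show ?thesis using True c(2)[OF y, of 0] c(2)[OF y, of 1] by simp
  next
    case False
    let ?u = "(p y 0 + p y 1) / 2"
    have r0: "0 < r y" using False q c(2)[OF y] by (auto simp: r_def less_le)
    have u0: "0 < ?u"
    proof (rule ccontr)
      assume "\<not> 0 < ?u"
      then have "p y 0 + p y 1 \<le> 0" by simp
      then have sum0: "p y 0 + p y 1 = 0" using c(2)[OF y] by (intro antisym add_nonneg_nonneg)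
      then have "p y 0 = 0" "p y 1 = 0" using c(2)[OF y] by (simp_all add: add_nonneg_eq_0_iff)
      then show False using False by (simp add: r_def)
    qed
    have "q x * p y x * log 2 (p y x / r y) = q x * info_density (p y x) (p y (x + 1)) + q x * p y x * log 2 (?u / r y)" for x
    proof (cases "p y x = 0")
      case False
      then have px: "0 < p y x" using c(2)[OF y, of x] by simp
      have u: "2 * p y x / (p y x + p y (x + 1)) = p y x / ?u" by (cases x) (simp_all add: add.commute)
      have "log 2 (p y x / r y) = log 2 (p y x / ?u) + log 2 (?u / r y)"
      proof -
        have "p y x / r y = p y x / ?u * (?u / r y)" using u0 by simp
        moreover have "0 < p y x / ?u" "0 < ?u / r y" using px r0 u0 by simp_all
        ultimately show ?thesis by (simp only: log_mult_pos)
      qed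
      then show ?thesis by (simp add: info_density_def u distrib_left)
    qed (simp add: info_density_def)
    note * = this
    have "(\<Sum>x\<in>{0, 1}. q x * p y x * log 2 (p y x / r y))
      = (\<Sum>x\<in>{0, 1}. q x * info_density (p y x) (p y (x + 1))) + r y * log 2 (?u / r y)"
      unfolding * by (simp add: sum.distrib r_def algebra_simps)
    also have "r y * log 2 (?u / r y) \<le> (?u - r y) / ln 2"
    proof -
      have "ln (?u / r y) \<le> ?u / r y - 1" using r0 u0 by (intro ln_le_minus_one) simp
      then have "r y * ln (?u / r y) \<le> ?u - r y"
        using mult_left_mono[of "ln (?u / r y)" "?u / r y - 1" "r y"] r0 by (simp add: right_diff_distrib)
      then show ?thesis by (simp add: log_def divide_right_mono)
    qed
    finally show ?thesis by simp
  qed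
  have "mutual_info Y p q = (\<Sum>y\<in>Y. \<Sum>x\<in>{0, 1}. q x * p y x * log 2 (p y x / r y))"
    unfolding mutual_info_def r by (rule sum.swap)
  also have "\<dots> \<le> (\<Sum>y\<in>Y. (\<Sum>x\<in>{0, 1}. q x * info_density (p y x) (p y (x + 1))) + ((p y 0 + p y 1) / 2 - r y) / ln 2)"
    by (intro sum_mono step)
  also have "\<dots> = (q 0 * D 0 + q 1 * D 1) + ((1 + 1) / 2 - (q 0 * 1 + q 1 * 1)) / ln 2"
    unfolding sum.distrib sum_divide_distrib[symmetric] sum_subtractf r_def
    by (simp add: D_def sum.distrib sum_distrib_left[symmetric] c(3))
  also have "\<dots> = uniform_info Y p"
    unfolding D using q(3) by (simp flip: distrib_right)
  finally show "mutual_info Y p q \<le> uniform_info Y p" .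
qed

section \<open>Translations of inputs and outputs by a codeword\<close>

definition xor_list :: "bit list \<Rightarrow> bit list \<Rightarrow> bit list" where
  "xor_list a b = map2 (+) a b"

lemma length_xor_list [simp]: "length (xor_list a b) = min (length a) (length b)"
  by (simp add: xor_list_def)

lemma nth_xor_list [simp]: "k < length a \<Longrightarrow> k < length b \<Longrightarrow> xor_list a b ! k = a ! k + b ! k"
  by (simp add: xor_list_def)

lemma take_xor_list: "take k (xor_list a b) = xor_list (take k a) (take k b)"
  by (simp add: xor_list_def take_map take_zip)

lemma xor_list_cancel: "length a = length b \<Longrightarrow> xor_list (xor_list a b) b = a" "length a = length b \<Longrightarrow> xor_list b (xor_list b a) = a"
  by (auto intro!: nth_equalityI)

lemma xor_list_split:
  assumes "l < length a" "length h = l" "length c = length a - l - 1"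
  shows "xor_list a (h @ x # c) = xor_list (take l a) h @ (a ! l + x) # xor_list (drop (Suc l) a) c"
proof -
  have "xor_list (take l a @ a ! l # drop (Suc l) a) (h @ x # c)
      = xor_list (take l a) h @ (a ! l + x) # xor_list (drop (Suc l) a) c"
    using assms by (simp add: xor_list_def)
  then show ?thesis by (simp only: id_take_nth_drop[OF assms(1), symmetric])
qed

lemma row_times_xor:
  assumes "length a = dim_row G" "length b = dim_row G"
  shows "row_times (xor_list a b) G = xor_list (row_times a G) (row_times b G)"
  using assms by (intro nth_equalityI) (auto simp: row_times_nth distrib_right sum.distrib)

text \<open>The action on output blocks that matches adding \<open>x\<close> to the channel
  input.\<close>

definition flip_list :: "('y \<Rightarrow> 'y) \<Rightarrow> bit list \<Rightarrow> 'y list \<Rightarrow> 'y list" where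
  "flip_list T x y = map2 (\<lambda>b a. if b = 1 then T a else a) x y"

text \<open>Adding \<open>a\<close> to the input and flipping the output along the codeword of
  \<open>a\<close> preserves the transition probabilities and, with prefixes shifted alike, the
  split likelihoods. So the conditional error probability is constant on orbits; all inputs form one
  orbit, hence it equals its average.\<close>

lemma split_error_given_input:
  fixes p :: "'y channel"
  assumes ch: "is_channel Y p" and sym: "symmetric_channel Y p" and l: "l < 2 ^ i" and w: "length w = 2 ^ i"
  shows "(\<Sum>y\<in>blocks Y (2 ^ i). polar_channel p i y w *
      of_bool (split_channel p i y (take l w) (w ! l) \<le> split_channel p i y (take l w) (w ! l + 1)))
    = split_error_prob Y p i l"
proof -
  define n :: nat where "n = 2 ^ i"
  obtain T where T: "bij_betw T Y Y" "\<And>y. y \<in> Y \<Longrightarrow> T (T y) = y" "\<And>y. y \<in> Y \<Longrightarrow> p y 0 = p (T y) 1"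
    using sym unfolding symmetric_channel_def by blast
  have TY: "T y \<in> Y" if "y \<in> Y" for y using T(1) that by (rule bij_betwE[rule_format])
  have T': "p (T y) 0 = p y 1" if "y \<in> Y" for y using T(3)[OF TY[OF that]] T(2)[OF that] by simp
  have flip_nth: "flip_list T x y ! k = (if x ! k = 1 then T (y ! k) else y ! k)" if "length x = n" "y \<in> blocks Y n" "k < n" for x y k
    using that by (auto simp: flip_list_def blocks_def)
  have flip_length: "length (flip_list T x y) = n" if "length x = n" "y \<in> blocks Y n" for x y
    using that by (auto simp: flip_list_def blocks_def)
  have flip_blocks: "flip_list T x y \<in> blocks Y n" if "length x = n" "y \<in> blocks Y n" for x y
    using that flip_nth[OF that] flip_length[OF that] TY nth_blocks[of y Y n]
    by (auto simp: blocks_def[of Y n] in_set_conv_nth)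
  have flip_flip: "flip_list T x (flip_list T x y) = y" if "length x = n" "y \<in> blocks Y n" for x y
  proof (rule nth_equalityI)
    show "length (flip_list T x (flip_list T x y)) = length y"
      using that by (simp add: flip_length flip_blocks) (simp add: blocks_def)
    fix k assume "k < length (flip_list T x (flip_list T x y))"
    then have "k < n" using that by (simp add: flip_length flip_blocks)
    then show "flip_list T x (flip_list T x y) ! k = y ! k"
      using that by (simp add: flip_nth flip_blocks T(2) nth_blocks)
  qed
  have bij: "bij_betw (flip_list T x) (blocks Y n) (blocks Y n)" if "length x = n" for x
    by (rule bij_betw_byWitness[where f' = "flip_list T x"]) (auto simp: flip_flip flip_blocks that)
  have vec: "vec_channel p (flip_list T x y) (xor_list x v) = vec_channel p y v"
    if "length x = n" "length v = n" "y \<in> blocks Y n" for x v y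
  proof -
    have "p (flip_list T x y ! k) (xor_list x v ! k) = p (y ! k) (v ! k)" if k: "k < n" for k
    proof -
      have y: "y ! k \<in> Y" using \<open>y \<in> blocks Y n\<close> k by (rule nth_blocks)
      show ?thesis
        using \<open>length x = n\<close> \<open>length v = n\<close> \<open>y \<in> blocks Y n\<close> k T(3)[OF y] T'[OF y]
        by (cases "x ! k"; cases "v ! k") (simp_all add: flip_nth)
    qed
    then show ?thesis using that by (simp add: vec_channel_def)
  qed
  have polar: "polar_channel p i (flip_list T (row_times a (polar_mat i)) y) (xor_list a v) = polar_channel p i y v"
    if "length a = n" "length v = n" "y \<in> blocks Y n" for a v y
    using that by (simp add: polar_channel_def row_times_xor n_def[symmetric] vec)
  have split: "split_channel p i (flip_list T (row_times a (polar_mat i)) y) (xor_list (take l a) h) (a ! l + x)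
      = split_channel p i y h x" if a: "length a = n" and h: "length h = l" and y: "y \<in> blocks Y n" for a h x y
  proof -
    have ln: "l < n" using l by (simp add: n_def)
    define k where "k = n - l - 1"
    \<comment> \<open>The future part of \<open>a\<close> merely permutes the completions
      \<open>c\<close> that are summed over.\<close>
    have "bij_betw (xor_list (drop (Suc l) a)) (bit_blocks k) (bit_blocks k)"
      by (rule bij_betw_byWitness[where f' = "xor_list (drop (Suc l) a)"])
        (auto simp: xor_list_cancel a k_def)
    then have "(\<Sum>c\<in>bit_blocks k. polar_channel p i (flip_list T (row_times a (polar_mat i)) y) (xor_list (take l a) h @ (a ! l + x) # c))
      = (\<Sum>c\<in>bit_blocks k. polar_channel p i (flip_list T (row_times a (polar_mat i)) y)
          (xor_list (take l a) h @ (a ! l + x) # xor_list (drop (Suc l) a) c))"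
      by (rule sum.reindex_bij_betw[symmetric])
    also have "\<dots> = (\<Sum>c\<in>bit_blocks k. polar_channel p i y (h @ x # c))"
    proof (intro sum.cong refl)
      fix c assume "c \<in> bit_blocks k"
      then have c: "length c = k" by simp
      show "polar_channel p i (flip_list T (row_times a (polar_mat i)) y)
          (xor_list (take l a) h @ (a ! l + x) # xor_list (drop (Suc l) a) c) = polar_channel p i y (h @ x # c)"
        using polar[of a "h @ x # c" y] xor_list_split[of l a h c x] a h y c ln by (simp add: k_def)
    qed
    finally show ?thesis
      using a h ln by (simp add: split_channel_def n_def[symmetric] k_def)
  qed
  define err where "err v = (\<Sum>y\<in>blocks Y n. polar_channel p i y v *
      of_bool (split_channel p i y (take l v) (v ! l) \<le> split_channel p i y (take l v) (v ! l + 1)))" for v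
  have err: "err (xor_list a v) = err v" if a: "length a = n" and v: "length v = n" for a v
  proof -
    let ?f = "flip_list T (row_times a (polar_mat i))"
    have "err (xor_list a v) = (\<Sum>y\<in>blocks Y n. polar_channel p i (?f y) (xor_list a v) *
      of_bool (split_channel p i (?f y) (take l (xor_list a v)) (xor_list a v ! l)
        \<le> split_channel p i (?f y) (take l (xor_list a v)) (xor_list a v ! l + 1)))"
      unfolding err_def by (rule sum.reindex_bij_betw[symmetric], rule bij) (simp add: n_def)
    also have "\<dots> = err v"
      unfolding err_def
    proof (intro sum.cong refl)
      fix y assume y: "y \<in> blocks Y n"
      have ln: "l < n" using l by (simp add: n_def)
      have 1: "xor_list a v ! l = a ! l + v ! l" using a v ln by simp
      have 2: "length (take l v) = l" using v ln by simp
      show "polar_channel p i (?f y) (xor_list a v) *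
          of_bool (split_channel p i (?f y) (take l (xor_list a v)) (xor_list a v ! l)
            \<le> split_channel p i (?f y) (take l (xor_list a v)) (xor_list a v ! l + 1))
        = polar_channel p i y v *
          of_bool (split_channel p i y (take l v) (v ! l) \<le> split_channel p i y (take l v) (v ! l + 1))"
        unfolding take_xor_list 1 add.assoc polar[OF a v y] split[OF a 2 y] ..
    qed
    finally show ?thesis .
  qed
  \<comment> \<open>Adding \<open>xor_list v w\<close> carries \<open>w\<close> to \<open>v\<close>,
    so the action is transitive.\<close>
  have const: "err v = err w" if v: "length v = n" for v
    using err[of "xor_list v w" w] v w by (simp add: xor_list_cancel n_def)
  have "split_error_prob Y p i l = (\<Sum>v\<in>bit_blocks n. 1 / 2 ^ n * err v)"
    unfolding split_error_prob_def err_def n_def[symmetric] by (simp add: sum_distrib_left mult.assoc)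
  also have "\<dots> = (\<Sum>v\<in>bit_blocks n. 1 / 2 ^ n * err w)"
    by (intro sum.cong refl arg_cong2[where f = times] const) simp
  also have "\<dots> = err w"
    by (simp add: card_bit_blocks)
  finally show ?thesis by (simp add: err_def n_def)
qed

subsection \<open>MDS codes\<close>

interpretation word_space: vector_space "\<lambda>(a :: 'f::field) (c :: nat \<Rightarrow> 'f) j. a * c j"
  by unfold_locales (auto simp: fun_eq_iff algebra_simps)

text \<open>Distinct codewords agreeing on \<open>t\<close> coordinates would be at distance at most
  \<open>S - t\<close>, below the minimum distance.\<close>

lemma mds_code_unique:
  assumes C: "mds_code S t C" and T: "T \<subseteq> {1..S}" "card T = t"
    and c: "c \<in> C" "c' \<in> C" "\<And>r. r \<in> T \<Longrightarrow> c r = c' r"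
  shows "c = c'"
proof (rule ccontr)
  assume "c \<noteq> c'"
  then have "min_dist S C \<le> hamming_dist S c c'"
    unfolding min_dist_def using c by (intro cInf_lower) auto
  also have "\<dots> \<le> card ({1..S} - T)"
    unfolding hamming_dist_def using c(3) by (intro card_mono) auto
  also have "\<dots> = S - t"
    using T finite_subset[OF T(1)] by (simp add: card_Diff_subset)
  finally show False using C by (simp add: mds_code_def)
qed

text \<open>Evaluation at the coordinates in \<open>T\<close> is an injection from the code, which has \<open>q ^ t\<close> words,
  to the \<open>q ^ t\<close> tuples of symbols.\<close>

lemma mds_code_exists:
  fixes C :: "(nat \<Rightarrow> 'f::field) set"
  assumes C: "mds_code S t C" and t: "1 \<le> t" and T: "T \<subseteq> {1..S}" "card T = t"
    and fin: "finite (UNIV :: 'f set)"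
  shows "\<exists>c\<in>C. \<forall>r\<in>T. c r = g r"
proof -
  have sub: "word_space.subspace C" and dim: "word_space.dim C = t"
    using C by (simp_all add: mds_code_def linear_code_def)
  obtain B where B: "B \<subseteq> C" "word_space.independent B" "card B = t"
    using word_space.basis_exists[of C] dim by metis
  \<comment> \<open>An infinite \<open>B\<close> would have the default cardinality 0, which
    \<open>1 \<le> t\<close> excludes.\<close>
  have finB: "finite B" using B(3) t by (metis card.infinite not_one_le_zero)
  have finT: "finite T" using T(1) by (rule finite_subset) simp
  define F where "F h = (\<Sum>b\<in>B. (\<lambda>j. h b * b j))" for h :: "(nat \<Rightarrow> 'f) \<Rightarrow> 'f"
  have F: "F h \<in> C" for h
    unfolding F_def using B(1) by (intro word_space.subspace_sum[OF sub] word_space.subspace_scale[OF sub]) auto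
  define E where "E h = restrict (F h) T" for h
  let ?D = "B \<rightarrow>\<^sub>E (UNIV :: 'f set)"
  have "inj_on E ?D"
  proof (rule inj_onI)
    fix h h' assume h: "h \<in> ?D" "h' \<in> ?D" and eq: "E h = E h'"
    have "F h r = F h' r" if "r \<in> T" for r
      using fun_cong[OF eq, of r] that by (simp add: E_def)
    then have "F h = F h'" by (rule mds_code_unique[OF C T F F])
    then have "(\<Sum>b\<in>B. (\<lambda>j. (h b - h' b) * b j)) = 0"
      by (simp add: F_def word_space.scale_left_diff_distrib sum_subtractf)
    then have "h b - h' b = 0" if "b \<in> B" for b
      using word_space.independentD[OF B(2) finB order_refl, of "\<lambda>b. h b - h' b"] that by simp
    then show "h = h'" using h by (intro PiE_ext) auto
  qed
  then have "card (E ` ?D) = card (UNIV :: 'f set) ^ t"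
    using finB B(3) by (simp add: card_image card_PiE)
  moreover have "card (T \<rightarrow>\<^sub>E (UNIV :: 'f set)) = card (UNIV :: 'f set) ^ t"
    using finT T(2) by (simp add: card_PiE)
  moreover have "E ` ?D \<subseteq> T \<rightarrow>\<^sub>E UNIV" by (auto simp: E_def)
  moreover have "finite (T \<rightarrow>\<^sub>E (UNIV :: 'f set))" using finT fin by (intro finite_PiE) auto
  ultimately have "E ` ?D = T \<rightarrow>\<^sub>E UNIV" by (intro card_subset_eq) auto
  moreover have "restrict g T \<in> T \<rightarrow>\<^sub>E UNIV" by auto
  ultimately obtain h where "E h = restrict g T" by (metis imageE)
  then have "\<forall>r\<in>T. F h r = g r" by (metis E_def restrict_apply')
  then show ?thesis using F by blast
qed

section \<open>Bit vectors as sequences of code symbols\<close>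

lemma concat_chunks:
  "length w = k * m \<Longrightarrow> concat (map (\<lambda>j. take m (drop (j * m) w)) [0..<k]) = w"
proof (induction k arbitrary: w)
  case (Suc k)
  let ?w = "take (k * m) w"
  have "take m (drop (j * m) ?w) = take m (drop (j * m) w)" if "j < k" for j
  proof -
    have "m + j * m \<le> k * m" using that mult_le_mono1[of "Suc j" k m] by simp
    then show ?thesis by (simp add: drop_take min_def)
  qed
  then have "concat (map (\<lambda>j. take m (drop (j * m) w)) [0..<k]) = concat (map (\<lambda>j. take m (drop (j * m) ?w)) [0..<k])"
    by (intro arg_cong[where f = concat] map_cong) auto
  also have "\<dots> = ?w" using Suc.prems by (intro Suc.IH) simp
  finally show ?case using Suc.prems by simp
qed simp

lemma chunk_concat:
  assumes "\<And>j. j < k \<Longrightarrow> length (f j) = m" "j < k"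
  shows "take m (drop (j * m) (concat (map f [0..<k]))) = f j"
proof -
  have len: "length (concat (map f [0..<l])) = l * m" if "l \<le> k" for l
    using that assms(1) by (induction l) auto
  have "[0..<k] = [0..<j] @ j # [Suc j..<k]"
    using assms(2) upt_add_eq_append[of 0 j "k - j"] by (simp add: upt_conv_Cons)
  then show ?thesis
    using len[of j] assms by simp
qed

locale mds_symbols =
  fixes m :: nat and \<phi> :: "bit list \<Rightarrow> 'f::field" and S t :: nat and C :: "(nat \<Rightarrow> 'f) set"
  assumes symbols_bij: "bij_betw \<phi> (bit_blocks m) UNIV"
    and code_mds: "mds_code S t C" and dim_pos: "1 \<le> t"
begin

lemma finite_symbols: "finite (UNIV :: 'f set)"
  using symbols_bij bij_betw_finite by fastforce

lemma ex1_codeword: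
  assumes "T \<subseteq> {1..S}" "card T = t"
  shows "\<exists>!c. c \<in> C \<and> (\<forall>r\<in>T. c r = g r)"
  using mds_code_exists[OF code_mds dim_pos assms finite_symbols, of g] mds_code_unique[OF code_mds assms]
  by (metis (full_types))

lemma mds_complete_symbols:
  fixes L :: nat and v :: "nat \<Rightarrow> bit list"
  assumes T: "T \<subseteq> {1..S}" "card T = t" and L: "m dvd L" "1 \<le> m"
  defines "cw \<equiv> \<lambda>j. THE c. c \<in> C \<and> (\<forall>r\<in>T. c r = symbol m \<phi> (v r) j)"
  shows "length (mds_complete m \<phi> C T L v s) = L"
    "\<And>j. j < L div m \<Longrightarrow> symbol m \<phi> (mds_complete m \<phi> C T L v s) j = cw j s"
proof -
  let ?f = "\<lambda>j. inv_into (bit_blocks m) \<phi> (cw j s)"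
  have len: "length (?f j) = m" for j
    using inv_into_into[of "cw j s" \<phi> "bit_blocks m"] symbols_bij by (simp add: bij_betw_def)
  have eq: "mds_complete m \<phi> C T L v s = concat (map ?f [0..<L div m])"
    by (simp add: mds_complete_def cw_def)
  have "length (concat (map ?f [0..<k])) = k * m" for k
    using len by (induction k) auto
  then show "length (mds_complete m \<phi> C T L v s) = L"
    using L unfolding eq by simp
  show "symbol m \<phi> (mds_complete m \<phi> C T L v s) j = cw j s" if "j < L div m" for j
    unfolding symbol_def eq chunk_concat[OF len that]
    using symbols_bij by (intro f_inv_into_f) (simp add: bij_betw_def)
qed

text \<open>The decoder's use of the code: in a layer whose symbol columns are codewords, any
  \<open>t\<close> correct vectors give back every other one. Values of \<open>v\<close> outside
  \<open>T\<close> are not consulted, so vectors that are not yet decoded do no harm.\<close>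

lemma mds_complete_eq:
  assumes T: "T \<subseteq> {1..S}" "card T = t" and L: "m dvd L"
    and V: "\<And>j. j < L div m \<Longrightarrow> \<exists>c\<in>C. \<forall>r\<in>{1..S}. c r = symbol m \<phi> (V r) j"
    and v: "\<And>r. r \<in> T \<Longrightarrow> v r = V r" and s: "s \<in> {1..S}" "length (V s) = L"
  shows "mds_complete m \<phi> C T L v s = V s"
proof -
  have "inv_into (bit_blocks m) \<phi> ((THE c. c \<in> C \<and> (\<forall>r\<in>T. c r = symbol m \<phi> (v r) j)) s)
      = take m (drop (j * m) (V s))" if j: "j < L div m" for j
  proof -
    obtain c where c: "c \<in> C" "\<And>r. r \<in> {1..S} \<Longrightarrow> c r = symbol m \<phi> (V r) j"
      using V[OF j] by blast
    then have "c \<in> C \<and> (\<forall>r\<in>T. c r = symbol m \<phi> (v r) j)"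
      using T(1) v by auto
    then have "(THE c. c \<in> C \<and> (\<forall>r\<in>T. c r = symbol m \<phi> (v r) j)) = c"
      by (rule the1_equality[OF ex1_codeword[OF T]])
    moreover have "j * m + m \<le> L"
    proof -
      have "Suc j * m \<le> L div m * m" using j by (intro mult_le_mono1) simp
      then show ?thesis using L by simp
    qed
    then have "take m (drop (j * m) (V s)) \<in> bit_blocks m" using s(2) by simp
    ultimately show ?thesis
      using c(2)[OF s(1)] symbols_bij by (simp add: symbol_def bij_betw_def inv_into_f_f)
  qed
  then have "mds_complete m \<phi> C T L v s = concat (map (\<lambda>j. take m (drop (j * m) (V s))) [0..<L div m])"
    unfolding mds_complete_def by (intro arg_cong[where f = concat] map_cong) auto
  also have "\<dots> = V s" using s(2) L by (intro concat_chunks) simp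
  finally show ?thesis .
qed

end

subsection \<open>The parallel scheme\<close>

lemma bij_betw_rank:
  fixes I :: "nat set"
  assumes "finite I"
  shows "bij_betw (\<lambda>l. card {k\<in>I. k < l}) I {..<card I}"
  unfolding bij_betw_def
proof
  have mono: "card {k\<in>I. k < l} < card {k\<in>I. k < l'}" if "l \<in> I" "l < l'" for l l'
    using that assms by (intro psubset_card_mono) auto
  show inj: "inj_on (\<lambda>l. card {k\<in>I. k < l}) I"
  proof (rule inj_onI, rule ccontr)
    fix l l' assume l: "l \<in> I" "l' \<in> I" and eq: "card {k\<in>I. k < l} = card {k\<in>I. k < l'}" and "l \<noteq> l'"
    then consider "l < l'" | "l' < l" by linarith
    then show False using mono[OF l(1), of l'] mono[OF l(2), of l] unfolding eq by cases simp_all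
  qed
  have "card {k\<in>I. k < l} < card I" if "l \<in> I" for l
    using that assms by (intro psubset_card_mono) auto
  then show "(\<lambda>l. card {k\<in>I. k < l}) ` I = {..<card I}"
    by (intro card_subset_eq) (auto simp: card_image[OF inj])
qed

text \<open>A submatrix numbers its rows by rank. Undoing this lets products with disjoint row sets
  be added as parts of one sum over the rows of \<open>G\<close>.\<close>

lemma row_times_submatrix:
  assumes I: "I \<subseteq> {..<dim_row G}" and v: "length v = card I" and j: "j < dim_col G"
  shows "row_times v (submatrix G I UNIV) ! j = (\<Sum>l\<in>I. v ! card {k\<in>I. k < l} * G $$ (l, j))"
proof -
  have fin: "finite I" using I by (rule finite_subset) simp
  have "{r. r < dim_row G \<and> r \<in> I} = I" using I by auto
  then have dim: "dim_row (submatrix G I UNIV) = card I" "dim_col (submatrix G I UNIV) = dim_col G"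
    by (simp_all add: dim_submatrix)
  have "row_times v (submatrix G I UNIV) ! j = (\<Sum>r<card I. v ! r * submatrix G I UNIV $$ (r, j))"
    using row_times_nth[of j "submatrix G I UNIV" v] v j dim by simp
  also have "\<dots> = (\<Sum>l\<in>I. v ! card {k\<in>I. k < l} * submatrix G I UNIV $$ (card {k\<in>I. k < l}, j))"
    by (rule sum.reindex_bij_betw[OF bij_betw_rank[OF fin], symmetric])
  also have "\<dots> = (\<Sum>l\<in>I. v ! card {k\<in>I. k < l} * G $$ (l, j))"
  proof (intro sum.cong refl)
    fix l assume "l \<in> I"
    then show "v ! card {k\<in>I. k < l} * submatrix G I UNIV $$ (card {k\<in>I. k < l}, j) = v ! card {k\<in>I. k < l} * G $$ (l, j)"
      using submatrix_index_card[of l G j I UNIV] I j by auto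
  qed
  finally show ?thesis .
qed

lemma nths_eqI:
  assumes I: "I \<subseteq> {..<length w}" and v: "length v = card I"
    and eq: "\<And>l. l \<in> I \<Longrightarrow> w ! l = v ! card {k\<in>I. k < l}"
  shows "nths w I = v"
proof -
  have set: "{r. r < length w \<and> r \<in> I} = I" using I by auto
  show ?thesis
  proof (rule nth_equalityI)
    show "length (nths w I) = length v" by (simp add: length_nths set v)
    fix k assume "k < length (nths w I)"
    then have k: "k < card I" by (simp add: length_nths set)
    then have "nths w I ! k = w ! pick I k" by (intro nth_nths) (simp add: set)
    also have "\<dots> = v ! k" using eq[of "pick I k"] k card_pick[of k I] pick_in_set[of k I] by simp
    finally show "nths w I ! k = v ! k" .
  qed
qed

lemma sc_decode_eq_take:
  assumes "\<And>l. l < length w \<Longrightarrow> l \<in> I \<Longrightarrow> d y (take l w) = w ! l"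
    and "\<And>l. l < length w \<Longrightarrow> l \<notin> I \<Longrightarrow> f l = w ! l"
    and "l \<le> length w"
  shows "sc_decode d I f y l = take l w"
  using assms(3) by (induction l) (simp_all add: Let_def assms(1,2) take_Suc_conv_app_nth)

text \<open>Marginalization: with \<open>g\<close> absorbed into factor \<open>s\<close>, the sum
  becomes a product of sums, and all but one of them are 1.\<close>

lemma sum_PiE_single_coordinate:
  fixes f :: "'i \<Rightarrow> 'a \<Rightarrow> 'b::comm_semiring_1"
  assumes I: "finite I" "s \<in> I" and fin: "\<And>r. r \<in> I \<Longrightarrow> finite (B r)"
    and one: "\<And>r. r \<in> I \<Longrightarrow> (\<Sum>a\<in>B r. f r a) = 1"
  shows "(\<Sum>y\<in>PiE I B. (\<Prod>r\<in>I. f r (y r)) * g (y s)) = (\<Sum>a\<in>B s. f s a * g a)"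
proof -
  let ?h = "\<lambda>r a. f r a * (if r = s then g a else 1)"
  have "(\<Sum>y\<in>PiE I B. (\<Prod>r\<in>I. f r (y r)) * g (y s)) = (\<Sum>y\<in>PiE I B. \<Prod>r\<in>I. ?h r (y r))"
    using I by (simp add: prod.distrib prod.delta)
  also have "\<dots> = (\<Prod>r\<in>I. \<Sum>a\<in>B r. ?h r a)"
    using I fin by (intro prod_sum_PiE[symmetric]) auto
  also have "\<dots> = (\<Prod>r\<in>I. if r = s then \<Sum>a\<in>B s. f s a * g a else 1)"
    by (intro prod.cong refl) (auto simp: one)
  also have "\<dots> = (\<Sum>a\<in>B s. f s a * g a)"
    using I by (simp add: prod.delta)
  finally show ?thesis .
qed

locale parallel_polar_scheme =
  fixes S m i :: nat and \<phi> :: "bit list \<Rightarrow> 'f::field" and C :: "nat \<Rightarrow> (nat \<Rightarrow> 'f) set"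
    and A :: "nat \<Rightarrow> nat set" and b :: "bit list"
  assumes S: "1 \<le> S" and m: "1 \<le> m" and bij: "bij_betw \<phi> (bit_blocks m) UNIV"
    and mds: "\<And>t. t \<in> {1..S - 1} \<Longrightarrow> mds_code S t (C t)"
    and nested: "nested_sets S (2 ^ i) A"
    and m_dvd: "\<And>s. s \<in> {1..S} \<Longrightarrow> m dvd card (A s)"
begin

lemma A_mono:
  assumes "1 \<le> s" "s \<le> s'" "s' \<le> Suc S"
  shows "A s' \<subseteq> A s"
  using assms(2,3)
proof (induction s' rule: dec_induct)
  case (step s')
  then have "A (Suc s') \<subseteq> A s'" using nested assms(1) by (auto simp: nested_sets_def)
  then show ?case using step by auto
qed simp

lemma A_bounded: "1 \<le> s \<Longrightarrow> s \<le> Suc S \<Longrightarrow> A s \<subseteq> {..<2 ^ i}"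
  using A_mono[of 1 s] nested by (auto simp: nested_sets_def)

lemma finite_A: "1 \<le> s \<Longrightarrow> s \<le> Suc S \<Longrightarrow> finite (A s)"
  by (rule finite_subset[OF A_bounded]) auto

lemma A_last: "A (Suc S) = {}"
  using nested by (simp add: nested_sets_def)

lemma layer_subset: "t \<in> {1..S} \<Longrightarrow> layer A t \<subseteq> {..<2 ^ i}"
  using A_bounded[of t] by (auto simp: layer_def)

lemma card_layer: "t \<in> {1..S} \<Longrightarrow> card (layer A t) = layer_size A t"
  using A_mono[of t "Suc t"] finite_A[of "Suc t"] unfolding layer_def layer_size_def
  by (intro card_Diff_subset) auto

lemma layer_disjoint:
  assumes "t \<in> {1..S}" "t' \<in> {1..S}" "l \<in> layer A t" "l \<in> layer A t'"
  shows "t = t'"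
proof (rule ccontr)
  assume "t \<noteq> t'"
  then consider "Suc t \<le> t'" | "Suc t' \<le> t" by linarith
  then show False
    using assms A_mono[of "Suc t" t'] A_mono[of "Suc t'" t] by cases (auto simp: layer_def)
qed

text \<open>For an unfrozen index that stage \<open>s'\<close> does not decode itself, this finds
  the earlier layer from which its value is supplied.\<close>

lemma ex_layer:
  assumes "1 \<le> s" "s \<le> s'" "s' \<le> Suc S" "l \<in> A s" "l \<notin> A s'"
  shows "\<exists>t. s \<le> t \<and> t < s' \<and> l \<in> layer A t"
  using assms(2-)
proof (induction s' rule: dec_induct)
  case (step s')
  then show ?case by (cases "l \<in> A s'") (auto simp: layer_def intro: less_SucI)
qed (use assms in auto)

lemma UN_layers: "(\<Union>t\<in>{1..S}. layer A t) = A 1"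
proof
  show "(\<Union>t\<in>{1..S}. layer A t) \<subseteq> A 1" using A_mono[of 1] by (fastforce simp: layer_def)
  show "A 1 \<subseteq> (\<Union>t\<in>{1..S}. layer A t)"
  proof
    fix l assume "l \<in> A 1"
    then obtain t where "1 \<le> t" "t < Suc S" "l \<in> layer A t"
      using ex_layer[of 1 "Suc S" l] A_last by auto
    then show "l \<in> (\<Union>t\<in>{1..S}. layer A t)" by auto
  qed
qed

lemma m_dvd_layer_size: "t \<in> {1..S} \<Longrightarrow> m dvd layer_size A t"
  using m_dvd[of t] m_dvd[of "Suc t"] A_last by (cases "t = S") (auto simp: layer_size_def intro: dvd_diff_nat)

text \<open>The full polar input of one codeword, assembled by the function that also supplies
  values to the decoder. Encoder and decoder thus agree on bit positions by construction.\<close>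

definition word :: "(nat \<Rightarrow> bit list) \<Rightarrow> bit list" where
  "word v = map (supplied_value S A b v) [0..<2 ^ i]"

lemma length_word [simp]: "length (word v) = 2 ^ i"
  by (simp add: word_def)

lemma supplied_value_frozen: "l \<notin> A 1 \<Longrightarrow> supplied_value S A b v l = b ! card {j. j < l \<and> j \<notin> A 1}"
  by (simp add: supplied_value_def)

lemma supplied_value_layer:
  assumes "t \<in> {1..S}" "l \<in> layer A t"
  shows "supplied_value S A b v l = v t ! card {j\<in>layer A t. j < l}"
proof -
  have "l \<in> A 1" using assms UN_layers by blast
  moreover have "(THE t. t \<in> {1..S} \<and> l \<in> layer A t) = t"
    using assms layer_disjoint by (intro the_equality) auto
  ultimately show ?thesis by (simp add: supplied_value_def Let_def)
qed

lemma nths_word: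
  assumes t: "t \<in> {1..S}" and v: "length (v t) = layer_size A t"
  shows "nths (word v) (layer A t) = v t"
proof (rule nths_eqI)
  show "layer A t \<subseteq> {..<length (word v)}" using layer_subset[OF t] by simp
  show "length (v t) = card (layer A t)" using v card_layer[OF t] by simp
  fix l assume "l \<in> layer A t"
  then show "word v ! l = v t ! card {k \<in> layer A t. k < l}"
    using supplied_value_layer[OF t] layer_subset[OF t] by (auto simp: word_def)
qed

lemma row_times_word:
  assumes v: "\<And>t. t \<in> {1..S} \<Longrightarrow> length (v t) = layer_size A t" and b: "length b = 2 ^ i - card (A 1)"
    and j: "j < 2 ^ i"
  shows "row_times (word v) (polar_mat i) ! j
    = (\<Sum>t=1..S. row_times (v t) (submatrix (polar_mat i) (layer A t) UNIV) ! j)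
      + row_times b (submatrix (polar_mat i) ({..<2 ^ i} - A 1) UNIV) ! j"
proof -
  let ?g = "\<lambda>l. word v ! l * polar_mat i $$ (l, j)"
  let ?I = "{..<2 ^ i} - A 1"
  have A1: "A 1 \<subseteq> {..<2 ^ i}" "finite (A 1)" using A_bounded[of 1] finite_A[of 1] by auto
  have "row_times (v t) (submatrix (polar_mat i) (layer A t) UNIV) ! j = (\<Sum>l\<in>layer A t. ?g l)"
    if t: "t \<in> {1..S}" for t
  proof -
    have "row_times (v t) (submatrix (polar_mat i) (layer A t) UNIV) ! j
        = (\<Sum>l\<in>layer A t. v t ! card {k\<in>layer A t. k < l} * polar_mat i $$ (l, j))"
      using layer_subset[OF t] v[OF t] card_layer[OF t] j by (intro row_times_submatrix) auto
    also have "\<dots> = (\<Sum>l\<in>layer A t. ?g l)"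
      using supplied_value_layer[OF t] layer_subset[OF t]
      by (intro sum.cong refl) (auto simp: word_def subset_iff)
    finally show ?thesis .
  qed
  then have "(\<Sum>t=1..S. row_times (v t) (submatrix (polar_mat i) (layer A t) UNIV) ! j)
      = (\<Sum>t\<in>{1..S}. \<Sum>l\<in>layer A t. ?g l)"
    by (intro sum.cong) auto
  also have "\<dots> = (\<Sum>l\<in>(\<Union>t\<in>{1..S}. layer A t). ?g l)"
  proof (rule sum.UNION_disjoint[symmetric])
    show "\<forall>t\<in>{1..S}. finite (layer A t)" using finite_A by (auto simp: layer_def)
    show "\<forall>t\<in>{1..S}. \<forall>t'\<in>{1..S}. t \<noteq> t' \<longrightarrow> layer A t \<inter> layer A t' = {}" using layer_disjoint by blast
  qed simp
  finally have layers: "(\<Sum>t=1..S. row_times (v t) (submatrix (polar_mat i) (layer A t) UNIV) ! j) = (\<Sum>l\<in>A 1. ?g l)"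
    unfolding UN_layers .
  have "row_times b (submatrix (polar_mat i) ?I UNIV) ! j
      = (\<Sum>l\<in>?I. b ! card {k\<in>?I. k < l} * polar_mat i $$ (l, j))"
    using A1 b j by (intro row_times_submatrix) (auto simp: card_Diff_subset)
  also have "\<dots> = (\<Sum>l\<in>?I. ?g l)"
  proof (intro sum.cong refl)
    fix l assume l: "l \<in> ?I"
    then have "{k\<in>?I. k < l} = {k. k < l \<and> k \<notin> A 1}" by auto
    then show "b ! card {k\<in>?I. k < l} * polar_mat i $$ (l, j) = ?g l"
      using l supplied_value_frozen by (simp add: word_def)
  qed
  finally have frozen: "row_times b (submatrix (polar_mat i) ?I UNIV) ! j = (\<Sum>l\<in>?I. ?g l)" .
  have "row_times (word v) (polar_mat i) ! j = (\<Sum>l<2 ^ i. ?g l)"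
    using j by (simp add: row_times_nth)
  also have "\<dots> = (\<Sum>l\<in>?I. ?g l) + (\<Sum>l\<in>A 1. ?g l)"
    using A1 by (intro sum.subset_diff) auto
  finally show ?thesis unfolding layers frozen by (simp add: add.commute)
qed

text \<open>The codeword property is stated for \<open>t < S\<close> only: in layer \<open>S\<close>
  all \<open>S\<close> vectors carry information and no code relates them.\<close>

lemma layer_vector_props:
  assumes u: "u \<in> messages S A" and t: "t \<in> {1..S}"
  shows length_layer_vector: "r \<in> {1..S} \<Longrightarrow> length (layer_vector m \<phi> C A u r t) = layer_size A t"
    and symbols_layer_vector: "t < S \<Longrightarrow> j < layer_size A t div m \<Longrightarrow>
      \<exists>c\<in>C t. \<forall>r\<in>{1..S}. c r = symbol m \<phi> (layer_vector m \<phi> C A u r t) j"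
proof -
  let ?L = "layer_size A t"
  have info: "length (u (r, t)) = ?L" if "r \<in> {1..t}" for r
    using u t that unfolding messages_def by (auto simp: info_indices_def dest!: PiE_mem[where x = "(r, t)"])
  show "length (layer_vector m \<phi> C A u r t) = ?L" if r: "r \<in> {1..S}" for r
  proof (cases "r \<le> t")
    case True
    then show ?thesis using info r by (simp add: layer_vector_def)
  next
    case False
    then have "t < S" using r by simp
    then interpret mds_symbols m \<phi> S t "C t" using bij mds t by unfold_locales auto
    show ?thesis
      using False mds_complete_symbols(1)[of "{1..t}" ?L] t m_dvd_layer_size[OF t] m by (simp add: layer_vector_def)
  qed
  assume tS: "t < S" and j: "j < ?L div m"
  then interpret mds_symbols m \<phi> S t "C t" using bij mds t by unfold_locales auto
  define c where "c = (THE c. c \<in> C t \<and> (\<forall>r\<in>{1..t}. c r = symbol m \<phi> (u (r, t)) j))"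
  have T: "{1..t} \<subseteq> {1..S}" "card {1..t} = t" using t by auto
  have c: "c \<in> C t \<and> (\<forall>r\<in>{1..t}. c r = symbol m \<phi> (u (r, t)) j)"
    unfolding c_def by (rule theI'[OF ex1_codeword[OF T]])
  have "c r = symbol m \<phi> (layer_vector m \<phi> C A u r t) j" if r: "r \<in> {1..S}" for r
  proof (cases "r \<le> t")
    case True
    then show ?thesis using c r by (simp add: layer_vector_def)
  next
    case False
    then show ?thesis
      using mds_complete_symbols(2)[OF T m_dvd_layer_size[OF t] m j] by (simp add: layer_vector_def c_def)
  qed
  then show "\<exists>c\<in>C t. \<forall>r\<in>{1..S}. c r = symbol m \<phi> (layer_vector m \<phi> C A u r t) j"
    using c by blast
qed

lemma polar_encode_eq:
  assumes u: "u \<in> messages S A" and r: "r \<in> {1..S}" and b: "length b = 2 ^ i - card (A 1)"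
  shows "polar_encode S m \<phi> C i A b u r = row_times (word (layer_vector m \<phi> C A u r)) (polar_mat i)"
proof (rule nth_equalityI)
  fix j assume "j < length (polar_encode S m \<phi> C i A b u r)"
  then have "j < 2 ^ i" by (simp add: polar_encode_def)
  then show "polar_encode S m \<phi> C i A b u r ! j = row_times (word (layer_vector m \<phi> C A u r)) (polar_mat i) ! j"
    using row_times_word[OF length_layer_vector[OF u _ r] b, of j] by (simp add: polar_encode_def)
qed (simp add: polar_encode_def)

text \<open>The event \<open>E_l\<close> for the true past of \<open>w\<close> instead of the
  decoder's own decisions. Ties belong to it, which covers every tie-breaking rule.\<close>

definition bad_event :: "'y channel \<Rightarrow> 'y list \<Rightarrow> bit list \<Rightarrow> nat \<Rightarrow> bool" where
  "bad_event p y w l \<longleftrightarrow> split_channel p i y (take l w) (w ! l) \<le> split_channel p i y (take l w) (w ! l + 1)"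

lemma sc_rule_correct:
  assumes d: "sc_rule Y p i d" and y: "y \<in> blocks Y (2 ^ i)" and l: "l < 2 ^ i" "length w = 2 ^ i"
    and good: "\<not> bad_event p y w l"
  shows "d y (take l w) = w ! l"
proof (rule ccontr)
  assume ne: "d y (take l w) \<noteq> w ! l"
  have "d y (take l w) = w ! l + 1"
    using ne by (cases "d y (take l w)"; cases "w ! l") auto
  moreover have "is_arg_max (\<lambda>x. split_channel p i y (take l w) x) (\<lambda>_. True) (d y (take l w))"
    using d y l by (simp add: sc_rule_def)
  ultimately show False using good by (auto simp: is_arg_max_def bad_event_def not_le)
qed

context
  fixes Y :: "nat \<Rightarrow> 'y set" and P :: "nat \<Rightarrow> 'y channel" and d :: "nat \<Rightarrow> 'y list \<Rightarrow> bit list \<Rightarrow> bit"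
    and \<pi> :: "nat \<Rightarrow> nat"
  assumes d: "\<And>s. s \<in> {1..S} \<Longrightarrow> sc_rule (Y s) (P s) i (d s)" and perm: "\<pi> permutes {1..S}"
begin

text \<open>Stage \<open>s + 1\<close> itself decodes the positions in \<open>A (s + 1)\<close>.
  Every other unfrozen position lies in a layer \<open>t \<le> s\<close>, whose vectors with indices
  \<open>\<pi> 1\<close>, ..., \<open>\<pi> t\<close> are already correct and determine the rest
  through the code. So all supplied values are right, and each decision is made with the true
  past.\<close>

lemma decode_stages_correct:
  assumes u: "u \<in> messages S A" and y: "\<And>s. s \<in> {1..S} \<Longrightarrow> y s \<in> blocks (Y s) (2 ^ i)"
    and good: "\<And>s l. s \<in> {1..S} \<Longrightarrow> l \<in> A s \<Longrightarrow> \<not> bad_event (P s) (y s) (word (layer_vector m \<phi> C A u (\<pi> s))) l"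
  shows "s \<le> S \<Longrightarrow> s' \<in> {1..s} \<Longrightarrow> t \<in> {1..S} \<Longrightarrow>
    decode_stages S m \<phi> C i A b d \<pi> y s (\<pi> s') t = layer_vector m \<phi> C A u (\<pi> s') t"
proof (induction s arbitrary: s' t)
  case (Suc s)
  let ?r = "\<pi> (Suc s)"
  let ?v = "\<lambda>r. layer_vector m \<phi> C A u r"
  let ?V = "decode_stages S m \<phi> C i A b d \<pi> y s"
  let ?known = "\<lambda>t. mds_complete m \<phi> (C t) (\<pi> ` {1..t}) (layer_size A t) (\<lambda>r. ?V r t) ?r"
  have sS: "Suc s \<in> {1..S}" using Suc.prems by simp
  have r: "?r \<in> {1..S}" using permutes_in_image[OF perm] sS by blast
  have known: "?known t = ?v ?r t" if t: "t \<in> {1..s}" for t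
  proof -
    have tS: "t \<in> {1..S}" "t < S" using t sS by auto
    then interpret mds_symbols m \<phi> S t "C t" using bij mds by unfold_locales auto
    show ?thesis
    proof (rule mds_complete_eq)
      have "{1..t} \<subseteq> {1..S}" using tS by auto
      then show "\<pi> ` {1..t} \<subseteq> {1..S}" using permutes_image[OF perm] by blast
      show "card (\<pi> ` {1..t}) = t" using permutes_inj[OF perm] by (simp add: card_image inj_on_subset[OF _ subset_UNIV])
      show "m dvd layer_size A t" by (rule m_dvd_layer_size[OF tS(1)])
      show "\<exists>c\<in>C t. \<forall>r\<in>{1..S}. c r = symbol m \<phi> (?v r t) j" if "j < layer_size A t div m" for j
        by (rule symbols_layer_vector[OF u tS that])
      show "?V r' t = ?v r' t" if "r' \<in> \<pi> ` {1..t}" for r'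
        using that t tS(1) Suc.IH Suc.prems(1) by auto
      show "?r \<in> {1..S}" "length (?v ?r t) = layer_size A t"
        using r length_layer_vector[OF u tS(1)] by auto
    qed
  qed
  let ?w = "word (?v ?r)"
  have "sc_decode (d (Suc s)) (A (Suc s)) (supplied_value S A b ?known) (y (Suc s)) (2 ^ i) = take (2 ^ i) ?w"
  proof (rule sc_decode_eq_take)
    fix l assume "l < length ?w" "l \<in> A (Suc s)"
    then show "d (Suc s) (y (Suc s)) (take l ?w) = ?w ! l"
      using sc_rule_correct[OF d[OF sS] y[OF sS]] good[OF sS] by simp
  next
    fix l assume l: "l < length ?w" "l \<notin> A (Suc s)"
    have "supplied_value S A b ?known l = supplied_value S A b (?v ?r) l"
    proof (cases "l \<in> A 1")
      case True
      then obtain t where t: "1 \<le> t" "t < Suc s" "l \<in> layer A t"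
        using ex_layer[of 1 "Suc s" l] l(2) sS by auto
      then have "t \<in> {1..S}" "t \<in> {1..s}" using sS by auto
      then show ?thesis using supplied_value_layer[OF _ t(3)] known by simp
    qed (simp add: supplied_value_frozen)
    then show "supplied_value S A b ?known l = ?w ! l" using l(1) by (simp add: word_def)
  qed simp
  then have step: "decode_stages S m \<phi> C i A b d \<pi> y (Suc s) = ?V(?r := \<lambda>t. nths ?w (layer A t))"
    by (simp add: Let_def)
  show ?case
  proof (cases "s' = Suc s")
    case True
    then show ?thesis
      unfolding step using nths_word[OF Suc.prems(3)] length_layer_vector[OF u Suc.prems(3) r] by simp
  next
    case False
    \<comment> \<open>A later stage writes only at its own codeword index, so by injectivity of
      \<open>\<pi>\<close> earlier results survive.\<close>
    then have "\<pi> s' \<noteq> ?r" using permutes_inj[OF perm] by (auto dest: injD)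
    moreover have "s' \<in> {1..s}" using False Suc.prems by auto
    ultimately show ?thesis unfolding step using Suc.IH Suc.prems by simp
  qed
qed simp

lemma polar_decode_correct:
  assumes u: "u \<in> messages S A" and y: "\<And>s. s \<in> {1..S} \<Longrightarrow> y s \<in> blocks (Y s) (2 ^ i)"
    and good: "\<And>s l. s \<in> {1..S} \<Longrightarrow> l \<in> A s \<Longrightarrow> \<not> bad_event (P s) (y s) (word (layer_vector m \<phi> C A u (\<pi> s))) l"
  shows "polar_decode S m \<phi> C i A b d \<pi> y = u"
proof
  fix z :: "nat \<times> nat"
  obtain s t where z: "z = (s, t)" by (cases z)
  show "polar_decode S m \<phi> C i A b d \<pi> y z = u z"
  proof (cases "z \<in> info_indices S")
    case True
    then have st: "1 \<le> s" "s \<le> t" "t \<le> S" by (auto simp: z info_indices_def)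
    \<comment> \<open>Results are indexed by codeword but stages by channel; surjectivity of
      \<open>\<pi>\<close> yields the stage that decoded codeword \<open>s\<close>.\<close>
    then have "s \<in> \<pi> ` {1..S}" using permutes_image[OF perm] by auto
    then obtain s' where s': "s = \<pi> s'" "s' \<in> {1..S}" by blast
    have "decode_stages S m \<phi> C i A b d \<pi> y S s t = layer_vector m \<phi> C A u s t"
      unfolding s'(1) using s' st by (intro decode_stages_correct u y good) auto
    then show ?thesis using True st(2) by (simp add: polar_decode_def z layer_vector_def)
  next
    case False
    then have "u z = undefined" using u unfolding messages_def by (intro PiE_arb)
    then show ?thesis using False by (simp add: polar_decode_def)
  qed
qed

lemma finite_messages: "finite (messages S A)" and messages_nonempty: "messages S A \<noteq> {}"
proof -
  have "info_indices S \<subseteq> {1..S} \<times> {1..S}" by (auto simp: info_indices_def)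
  then have "finite (info_indices S)" by (rule finite_subset) simp
  then show "finite (messages S A)" unfolding messages_def by (intro finite_PiE) auto
  have "replicate k 0 \<in> bit_blocks k" for k by simp
  then have "bit_blocks k \<noteq> {}" for k by blast
  then show "messages S A \<noteq> {}" unfolding messages_def PiE_eq_empty_iff by (auto split: prod.splits)
qed

lemma scheme_error_prob_le:
  assumes b: "length b = 2 ^ i - card (A 1)"
    and P: "\<And>s. s \<in> {1..S} \<Longrightarrow> is_channel (Y s) (P s) \<and> symmetric_channel (Y s) (P s)"
  shows "scheme_error_prob S Y P m \<phi> C i A b d \<pi> \<le> (\<Sum>s=1..S. \<Sum>l\<in>A s. split_error_prob (Y s) (P s) i l)"
proof -
  let ?E = "\<Sum>s=1..S. \<Sum>l\<in>A s. split_error_prob (Y s) (P s) i l"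
  let ?Ys = "\<Pi>\<^sub>E s\<in>{1..S}. blocks (Y s) (2 ^ i)"
  have per_message: "(\<Sum>y\<in>?Ys. (\<Prod>s=1..S. vec_channel (P s) (y s) (polar_encode S m \<phi> C i A b u (\<pi> s))) *
      of_bool (polar_decode S m \<phi> C i A b d \<pi> y \<noteq> u)) \<le> ?E" if u: "u \<in> messages S A" for u
  proof -
    define w where "w s = word (layer_vector m \<phi> C A u (\<pi> s))" for s
    have enc: "vec_channel (P s) (y s) (polar_encode S m \<phi> C i A b u (\<pi> s)) = polar_channel (P s) i (y s) (w s)"
      if "s \<in> {1..S}" for s and y :: "nat \<Rightarrow> 'y list"
      using polar_encode_eq[OF u _ b, of "\<pi> s"] permutes_in_image[OF perm] that by (simp add: polar_channel_def w_def)
    have pos: "0 \<le> polar_channel (P s) i (y s) (w s)" if "s \<in> {1..S}" "y \<in> ?Ys" for s y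
      unfolding polar_channel_def using that P by (intro vec_channel_nonneg[of "Y s" _ _ "2 ^ i"]) auto
    have one: "(\<Sum>y\<in>blocks (Y s) (2 ^ i). polar_channel (P s) i y (w s)) = 1" if "s \<in> {1..S}" for s
      unfolding polar_channel_def using that P by (intro sum_vec_channel) auto
    let ?p = "\<lambda>y. \<Prod>s=1..S. polar_channel (P s) i (y s) (w s)"
    have "(\<Sum>y\<in>?Ys. (\<Prod>s=1..S. vec_channel (P s) (y s) (polar_encode S m \<phi> C i A b u (\<pi> s))) *
        of_bool (polar_decode S m \<phi> C i A b d \<pi> y \<noteq> u))
      = (\<Sum>y\<in>?Ys. ?p y * of_bool (polar_decode S m \<phi> C i A b d \<pi> y \<noteq> u))"
      by (intro sum.cong refl arg_cong2[where f = times] prod.cong enc)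
    \<comment> \<open>Without any bad event decoding succeeds, so the error indicator is at most the
      number of bad events.\<close>
    also have "\<dots> \<le> (\<Sum>y\<in>?Ys. ?p y * (\<Sum>s=1..S. \<Sum>l\<in>A s. of_bool (bad_event (P s) (y s) (w s) l)))"
    proof (intro sum_mono mult_left_mono)
      fix y assume y: "y \<in> ?Ys"
      show "of_bool (polar_decode S m \<phi> C i A b d \<pi> y \<noteq> u)
          \<le> (\<Sum>s=1..S. \<Sum>l\<in>A s. of_bool (bad_event (P s) (y s) (w s) l) :: real)"
      proof (cases "\<exists>s\<in>{1..S}. \<exists>l\<in>A s. bad_event (P s) (y s) (w s) l")
        case True
        then obtain s l where sl: "s \<in> {1..S}" "l \<in> A s" "bad_event (P s) (y s) (w s) l" by blast
        have "(1::real) \<le> (\<Sum>l\<in>A s. of_bool (bad_event (P s) (y s) (w s) l))"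
          using member_le_sum[of l "A s" "\<lambda>l. of_bool (bad_event (P s) (y s) (w s) l) :: real"] sl finite_A[of s] by simp
        also have "\<dots> \<le> (\<Sum>s=1..S. \<Sum>l\<in>A s. of_bool (bad_event (P s) (y s) (w s) l))"
          using sl(1) by (intro member_le_sum[of s "{1..S}" "\<lambda>s. \<Sum>l\<in>A s. of_bool (bad_event (P s) (y s) (w s) l)"])
            (auto intro: sum_nonneg)
        finally show ?thesis by (rule order_trans[rotated]) simp
      next
        case False
        then have "polar_decode S m \<phi> C i A b d \<pi> y = u"
          using y by (intro polar_decode_correct u) (auto simp: w_def)
        then show ?thesis by (simp add: sum_nonneg)
      qed
      show "0 \<le> ?p y" using y pos by (intro prod_nonneg) auto
    qed
    also have "\<dots> = (\<Sum>s=1..S. \<Sum>l\<in>A s. \<Sum>y\<in>?Ys. ?p y * of_bool (bad_event (P s) (y s) (w s) l))"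
      by (simp only: sum_distrib_left sum.swap[of _ ?Ys])
    also have "\<dots> = ?E"
    proof (intro sum.cong refl)
      fix s l assume s: "s \<in> {1..S}" and "l \<in> A s"
      then have l: "l < 2 ^ i" using A_bounded[of s] by auto
      \<comment> \<open>The event concerns the output of channel \<open>s\<close> alone; the other
        channels sum out to 1.\<close>
      have "(\<Sum>y\<in>?Ys. ?p y * of_bool (bad_event (P s) (y s) (w s) l))
        = (\<Sum>y\<in>blocks (Y s) (2 ^ i). polar_channel (P s) i y (w s) * of_bool (bad_event (P s) y (w s) l))"
        using s P one by (intro sum_PiE_single_coordinate[of "{1..S}" s "\<lambda>s. blocks (Y s) (2 ^ i)"
            "\<lambda>s y. polar_channel (P s) i y (w s)" "\<lambda>y. of_bool (bad_event (P s) y (w s) l)"])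
          (auto simp: is_channel_def)
      also have "\<dots> = split_error_prob (Y s) (P s) i l"
        unfolding bad_event_def using P[OF s] l by (intro split_error_given_input) (auto simp: w_def)
      finally show "(\<Sum>y\<in>?Ys. ?p y * of_bool (bad_event (P s) (y s) (w s) l)) = split_error_prob (Y s) (P s) i l" .
    qed
    finally show ?thesis .
  qed
  have "scheme_error_prob S Y P m \<phi> C i A b d \<pi> \<le> (\<Sum>u\<in>messages S A. ?E) / real (card (messages S A))"
    unfolding scheme_error_prob_def block_error_prob_def
    by (intro divide_right_mono sum_mono per_message) auto
  also have "\<dots> = ?E"
    using finite_messages messages_nonempty by (simp add: card_gt_0_iff)
  finally show ?thesis .
qed

end

text \<open>Codeword \<open>s\<close> carries information in the layers \<open>s\<close> to
  \<open>S\<close>, whose sizes telescope to \<open>card (A s)\<close>.\<close>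

lemma code_rate_messages: "code_rate (2 ^ i) (messages S A) = (\<Sum>s=1..S. real (card (A s))) / 2 ^ i"
proof -
  have info: "info_indices S = Sigma {1..S} (\<lambda>s. {s..S})" by (auto simp: info_indices_def)
  have tele: "(\<Sum>t=s..S. layer_size A t) = card (A s)" if s: "s \<in> {1..S}" for s
  proof -
    \<comment> \<open>The inequality is carried through the induction because
      \<open>layer_size\<close> is a truncated subtraction.\<close>
    have "(\<Sum>t=s..<s + k. layer_size A t) = card (A s) - card (A (s + k)) \<and> card (A (s + k)) \<le> card (A s)"
      if "s + k \<le> Suc S" for k
      using that
    proof (induction k)
      case (Suc k)
      have "card (A (Suc (s + k))) \<le> card (A (s + k))"
        using Suc.prems s by (intro card_mono finite_A A_mono) auto
      then show ?case using Suc by (simp add: layer_size_def)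
    qed simp
    from this[of "Suc S - s"] show ?thesis
      using s A_last by (simp add: atLeastLessThanSuc_atLeastAtMost)
  qed
  have "card (messages S A) = (\<Prod>(s, t)\<in>info_indices S. 2 ^ layer_size A t)"
    unfolding messages_def by (subst card_PiE) (auto simp: info card_bit_blocks intro!: prod.cong)
  also have "\<dots> = 2 ^ (\<Sum>(s, t)\<in>info_indices S. layer_size A t)"
    by (simp add: power_sum case_prod_beta')
  also have "(\<Sum>(s, t)\<in>info_indices S. layer_size A t) = (\<Sum>s=1..S. \<Sum>t=s..S. layer_size A t)"
    unfolding info by (rule sum.Sigma[symmetric]) auto
  also have "\<dots> = (\<Sum>s=1..S. card (A s))"
    by (intro sum.cong refl tele)
  finally have "card (messages S A) = 2 ^ (\<Sum>s=1..S. card (A s))" .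
  then have "log 2 (real (card (messages S A))) = real (\<Sum>s=1..S. card (A s))"
    by (simp add: log_nat_power)
  then show ?thesis by (simp add: code_rate_def)
qed

end

section \<open>Choice of the index sets and the limit\<close>

lemma nested_subsets:
  fixes H :: "nat \<Rightarrow> 'a set" and K :: "nat \<Rightarrow> nat"
  assumes fin: "\<And>n. finite (H n)" and H: "\<And>n. H n \<subseteq> H (Suc n)" and K: "\<And>n. K n \<le> K (Suc n)" "\<And>n. K n \<le> card (H n)"
  obtains B where "\<And>n. B n \<subseteq> H n" "\<And>n. card (B n) = K n" "\<And>n. B n \<subseteq> B (Suc n)"
proof -
  have "\<exists>B. \<forall>n. (B n \<subseteq> H n \<and> card (B n) = K n) \<and> B n \<subseteq> B (Suc n)"
  proof (rule dependent_nat_choice)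
    show "\<exists>B. B \<subseteq> H 0 \<and> card B = K 0"
      using obtain_subset_with_card_n[OF K(2)[of 0]] by metis
  next
    fix B n assume B: "B \<subseteq> H n \<and> card B = K n"
    then have "B \<subseteq> H (Suc n)" using H by blast
    then obtain B' where "B \<subseteq> B'" "B' \<subseteq> H (Suc n)" "card B' = K (Suc n)"
      using exists_subset_between[of B "K (Suc n)" "H (Suc n)"] B K fin by metis
    then show "\<exists>B'. (B' \<subseteq> H (Suc n) \<and> card B' = K (Suc n)) \<and> B \<subseteq> B'" by blast
  qed
  then show ?thesis using that by blast
qed

text \<open>Shrinking each good set separately could destroy the nesting. The chain is therefore
  built from the smallest set upwards, each set being extended inside the next good set to the
  largest admissible size.\<close>

lemma nested_sets_of_multiples:
  fixes G :: "nat \<Rightarrow> nat set"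
  assumes G: "\<And>s. s \<in> {1..S} \<Longrightarrow> G s \<subseteq> {..<n}"
    "\<And>s s'. s \<in> {1..S} \<Longrightarrow> s' \<in> {1..S} \<Longrightarrow> s < s' \<Longrightarrow> G s' \<subseteq> G s"
    and S: "1 \<le> S"
  obtains A where "nested_sets S n A" "\<And>s. s \<in> {1..S} \<Longrightarrow> A s \<subseteq> G s"
    "\<And>s. s \<in> {1..S} \<Longrightarrow> card (A s) = m * (card (G s) div m)"
proof -
  \<comment> \<open>The sets of the scheme decrease with the channel number, hence the reversal
    \<open>S - j\<close>; \<open>max 1\<close> continues the chain constantly beyond its last
    set.\<close>
  define H where "H j = G (max 1 (S - j))" for j
  have in_S: "max 1 (S - j) \<in> {1..S}" for j using S by auto
  have fin: "finite (H j)" for j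
    unfolding H_def using G(1)[OF in_S] by (rule finite_subset) simp
  have H: "H j \<subseteq> H (Suc j)" for j
    unfolding H_def using G(2)[OF in_S in_S, of "Suc j" j] by (cases "max 1 (S - Suc j) = max 1 (S - j)") auto
  obtain B where B: "\<And>j. B j \<subseteq> H j" "\<And>j. card (B j) = m * (card (H j) div m)" "\<And>j. B j \<subseteq> B (Suc j)"
  proof (rule nested_subsets[of H "\<lambda>j. m * (card (H j) div m)"])
    show "m * (card (H j) div m) \<le> m * (card (H (Suc j)) div m)" for j
      using card_mono[OF fin H, of j] by (intro mult_left_mono div_le_mono) auto
  qed (use fin H in auto)
  define A where "A s = (if s \<le> S then B (S - s) else {})" for s
  have H_eq: "H (S - s) = G s" if "s \<in> {1..S}" for s using that by (simp add: H_def)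
  have sub: "A s \<subseteq> G s" if "s \<in> {1..S}" for s using B(1)[of "S - s"] H_eq[OF that] that by (simp add: A_def)
  show ?thesis
  proof (rule that)
    have "A (Suc s) \<subseteq> A s" if "s \<in> {1..S}" for s
      using B(3)[of "S - Suc s"] that by (cases "s = S") (auto simp: A_def Suc_diff_Suc)
    moreover have "A 1 \<subseteq> {..<n}" using sub[of 1] G(1)[of 1] S by auto
    ultimately show "nested_sets S n A" by (simp add: nested_sets_def A_def)
    show "card (A s) = m * (card (G s) div m)" if "s \<in> {1..S}" for s
      using B(2)[of "S - s"] H_eq[OF that] that by (simp add: A_def)
  qed (rule sub)
qed

lemma power2_at_top: "filterlim (\<lambda>i. (2::real) ^ i) at_top sequentially"
  by real_asymp

text \<open>In terms of the block length \<open>x = 2 ^ i\<close>, a stretched exponential beats the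
  linear number of decoded indices.\<close>

lemma polar_error_bound_tendsto:
  "(\<lambda>i. c * (2 ^ i * 2 powr (- ((2 ^ i) powr (1 / 1024))))) \<longlonglongrightarrow> (0 :: real)"
proof -
  have "((\<lambda>x::real. c * (x * 2 powr (- (x powr (1 / 1024))))) \<longlongrightarrow> 0) at_top"
    by real_asymp
  from filterlim_compose[OF this power2_at_top] show ?thesis .
qed

theorem theorem2:
  fixes S m :: nat
    and Y :: "nat \<Rightarrow> 'y set"
    and P :: "nat \<Rightarrow> 'y channel"
    and C :: "nat \<Rightarrow> (nat \<Rightarrow> 'f::field) set"
    and \<phi> :: "bit list \<Rightarrow> 'f"
    and R :: real
  assumes "1 \<le> S"
    and "\<forall>s\<in>{1..S}. is_channel (Y s) (P s) \<and> symmetric_channel (Y s) (P s)"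
    and "\<forall>s\<in>{1..S}. \<forall>s'\<in>{1..S}. s < s' \<longrightarrow> capacity (Y s') (P s') \<le> capacity (Y s) (P s)"
    and "\<forall>s\<in>{1..S}. \<forall>s'\<in>{1..S}. s < s' \<longrightarrow> degraded (Y s) (P s) (Y s') (P s')"
    and "1 \<le> m" and "S \<le> 2 ^ m - 1"
    and "card (UNIV :: 'f set) = 2 ^ m"
    and "bij_betw \<phi> (bit_blocks m) UNIV"
    and "\<forall>t\<in>{1..S - 1}. mds_code S t (C t)"
    and "R < (\<Sum>s=1..S. capacity (Y s) (P s))"
  shows "\<exists>(\<beta>::real) (Rs :: nat \<Rightarrow> real) (A :: nat \<Rightarrow> nat \<Rightarrow> nat set).
    0 < \<beta> \<and> \<beta> < 1 / 2 \<and>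
    (\<forall>s\<in>{1..S}. Rs s < capacity (Y s) (P s)) \<and>
    R \<le> (\<Sum>s=1..S. Rs s) \<and>
    (\<forall>\<^sub>F i in sequentially.
       nested_sets S (2 ^ i) (A i) \<and>
       (\<forall>s\<in>{1..S}.
          m dvd card (A i s) \<and>
          2 ^ i * Rs s \<le> real (card (A i s)) \<and>
          (\<forall>l\<in>A i s. split_error_prob (Y s) (P s) i l \<le> 2 powr (- ((2 ^ i) powr \<beta>)))) \<and>
       code_rate (2 ^ i) (messages S (A i)) = (\<Sum>s=1..S. real (card (A i s))) / 2 ^ i \<and>
       R \<le> code_rate (2 ^ i) (messages S (A i))) \<and>
    (\<forall>(b :: nat \<Rightarrow> bit list) (d :: nat \<Rightarrow> nat \<Rightarrow> 'y list \<Rightarrow> bit list \<Rightarrow> bit).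
       (\<forall>i. length (b i) = 2 ^ i - card (A i 1)) \<longrightarrow>
       (\<forall>i. \<forall>s\<in>{1..S}. sc_rule (Y s) (P s) i (d i s)) \<longrightarrow>
       (\<forall>\<pi>. \<pi> permutes {1..S} \<longrightarrow>
          (\<lambda>i. scheme_error_prob S Y P m \<phi> C i (A i) (b i) (d i) \<pi>) \<longlonglongrightarrow> 0))"
proof -
  have ch: "is_channel (Y s) (P s)" "symmetric_channel (Y s) (P s)" if "s \<in> {1..S}" for s
    using assms(2) that by auto
  define \<beta> :: real where "\<beta> = 1 / 1024"
  \<comment> \<open>The gap to the sum capacity is shared equally among the channels. Half of
    \<open>\<delta>\<close> pays for incomplete polarization, half for rounding down to a multiple
    of \<open>m\<close>.\<close>
  define \<delta> where "\<delta> = ((\<Sum>s=1..S. capacity (Y s) (P s)) - R) / real S"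
  have \<delta>: "0 < \<delta>" using assms(1,10) by (simp add: \<delta>_def)
  define Rs where "Rs s = capacity (Y s) (P s) - \<delta>" for s
  have sum_Rs: "(\<Sum>s=1..S. Rs s) = R"
    using assms(1) by (simp add: Rs_def sum_subtractf \<delta>_def)
  define thr :: "nat \<Rightarrow> real" where "thr i = 2 powr (- ((2 ^ i) powr \<beta>))" for i
  define Z where "Z s i l = bhattacharyya (split_outputs (Y s) i l) (split_law (P s) i)" for s i l
  define G where "G i s = {l. l < 2 ^ i \<and> Z s i l \<le> thr i}" for i s
  have G_nested: "G i s' \<subseteq> G i s" if s: "s \<in> {1..S}" "s' \<in> {1..S}" "s < s'" for i s s'
    using bhattacharyya_degraded[OF ch(1)[OF s(1)], of "Y s'" "P s'"] assms(4) s
    unfolding G_def Z_def by (auto intro: order_trans)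
  \<comment> \<open>The sets are chosen at every level \<open>i\<close>, so nesting, divisibility
    and the error threshold hold throughout; only the sizes need large \<open>i\<close>.\<close>
  have "\<exists>A. nested_sets S (2 ^ i) A \<and> (\<forall>s\<in>{1..S}. A s \<subseteq> G i s \<and> card (A s) = m * (card (G i s) div m))" for i
  proof -
    obtain A where "nested_sets S (2 ^ i) A" "\<And>s. s \<in> {1..S} \<Longrightarrow> A s \<subseteq> G i s"
      "\<And>s. s \<in> {1..S} \<Longrightarrow> card (A s) = m * (card (G i s) div m)"
      by (rule nested_sets_of_multiples[of S "G i" "2 ^ i" m]) (use G_nested assms(1) in \<open>auto simp: G_def\<close>)
    then show ?thesis by blast
  qed
  then obtain A where A: "\<And>i. nested_sets S (2 ^ i) (A i)" "\<And>i s. s \<in> {1..S} \<Longrightarrow> A i s \<subseteq> G i s"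
    "\<And>i s. s \<in> {1..S} \<Longrightarrow> card (A i s) = m * (card (G i s) div m)"
    by metis
  have scheme: "parallel_polar_scheme S m i \<phi> C (A i)" for i
    using assms(1,5,8,9) A(1,3) by unfold_locales auto
  have err: "split_error_prob (Y s) (P s) i l \<le> thr i" if s: "s \<in> {1..S}" and l: "l \<in> A i s" for s i l
  proof -
    have "l < 2 ^ i" "Z s i l \<le> thr i" using A(2)[OF s, of i] l by (auto simp: G_def)
    then show ?thesis using split_error_prob_le[OF ch(1)[OF s], of l i] by (simp add: Z_def)
  qed
  have size: "\<forall>\<^sub>F i in sequentially. 2 ^ i * Rs s \<le> real (card (A i s))" if s: "s \<in> {1..S}" for s
  proof -
    \<comment> \<open>From here on the rounding, which discards fewer than \<open>m\<close> indices,
      costs at most \<open>2 ^ i * (\<delta> / 2)\<close>.\<close>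
    have "\<forall>\<^sub>F i in sequentially. real m * 2 / \<delta> \<le> 2 ^ i"
      using power2_at_top by (auto simp: filterlim_at_top)
    moreover have "\<forall>\<^sub>F i in sequentially. 2 ^ i * (uniform_info (Y s) (P s) - \<delta> / 2) \<le> real (card (G i s))"
      using channel_polarization[OF ch(1)[OF s], of "\<delta> / 2"] \<delta> by (simp add: G_def Z_def thr_def \<beta>_def)
    ultimately show ?thesis
    proof eventually_elim
      case (elim i)
      have "real m \<le> 2 ^ i * (\<delta> / 2)" using elim(1) \<delta> by (simp add: field_simps)
      moreover have "card (G i s) \<le> card (A i s) + m"
        using mod_less_divisor[of m "card (G i s)"] mult_div_mod_eq[of m "card (G i s)"] assms(5)
        unfolding A(3)[OF s] by linarith
      then have "real (card (G i s)) \<le> real (card (A i s)) + real m" by linarith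
      moreover have "2 ^ i * (capacity (Y s) (P s) - \<delta> / 2) \<le> 2 ^ i * (uniform_info (Y s) (P s) - \<delta> / 2)"
        using capacity_le_uniform_info[OF ch[OF s]] by (intro mult_left_mono) auto
      ultimately have "2 ^ i * (capacity (Y s) (P s) - \<delta> / 2) - 2 ^ i * (\<delta> / 2) \<le> real (card (A i s))"
        using elim(2) by linarith
      then show ?case by (simp add: Rs_def algebra_simps)
    qed
  qed
  show ?thesis
  proof (intro exI[of _ \<beta>] exI[of _ Rs] exI[of _ A] conjI allI impI)
    show "0 < \<beta>" "\<beta> < 1 / 2" by (simp_all add: \<beta>_def)
    show "\<forall>s\<in>{1..S}. Rs s < capacity (Y s) (P s)" using \<delta> by (simp add: Rs_def)
    show "R \<le> (\<Sum>s=1..S. Rs s)" using sum_Rs by simp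
    have "\<forall>\<^sub>F i in sequentially. \<forall>s\<in>{1..S}. 2 ^ i * Rs s \<le> real (card (A i s))"
      using size by (intro eventually_ball_finite) auto
    then show "\<forall>\<^sub>F i in sequentially.
       nested_sets S (2 ^ i) (A i) \<and>
       (\<forall>s\<in>{1..S}.
          m dvd card (A i s) \<and>
          2 ^ i * Rs s \<le> real (card (A i s)) \<and>
          (\<forall>l\<in>A i s. split_error_prob (Y s) (P s) i l \<le> 2 powr (- ((2 ^ i) powr \<beta>)))) \<and>
       code_rate (2 ^ i) (messages S (A i)) = (\<Sum>s=1..S. real (card (A i s))) / 2 ^ i \<and>
       R \<le> code_rate (2 ^ i) (messages S (A i))"
    proof eventually_elim
      case (elim i)
      have rate: "code_rate (2 ^ i) (messages S (A i)) = (\<Sum>s=1..S. real (card (A i s))) / 2 ^ i"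
        by (rule parallel_polar_scheme.code_rate_messages[OF scheme])
      have "2 ^ i * R \<le> (\<Sum>s=1..S. real (card (A i s)))"
        unfolding sum_Rs[symmetric] sum_distrib_left using elim by (intro sum_mono) auto
      then have "R \<le> (\<Sum>s=1..S. real (card (A i s))) / 2 ^ i"
        by (simp add: field_simps)
      then show ?case
        using A(1,3) elim err rate by (simp add: thr_def)
    qed
  next
    fix b :: "nat \<Rightarrow> bit list" and d :: "nat \<Rightarrow> nat \<Rightarrow> 'y list \<Rightarrow> bit list \<Rightarrow> bit" and \<pi> :: "nat \<Rightarrow> nat"
    assume b: "\<forall>i. length (b i) = 2 ^ i - card (A i 1)"
      and d: "\<forall>i. \<forall>s\<in>{1..S}. sc_rule (Y s) (P s) i (d i s)" and \<pi>: "\<pi> permutes {1..S}"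
    let ?e = "\<lambda>i. scheme_error_prob S Y P m \<phi> C i (A i) (b i) (d i) \<pi>"
    have upper: "?e i \<le> real S * (2 ^ i * thr i)" for i
    proof -
      have "?e i \<le> (\<Sum>s=1..S. \<Sum>l\<in>A i s. split_error_prob (Y s) (P s) i l)"
        using b d \<pi> ch by (intro parallel_polar_scheme.scheme_error_prob_le[OF scheme]) auto
      also have "\<dots> \<le> (\<Sum>s=1..S. 2 ^ i * thr i)"
      proof (intro sum_mono)
        fix s assume s: "s \<in> {1..S}"
        have "(\<Sum>l\<in>A i s. split_error_prob (Y s) (P s) i l) \<le> real (card (A i s)) * thr i"
          using err[OF s] by (intro sum_bounded_above)
        also have "\<dots> \<le> 2 ^ i * thr i"
        proof (intro mult_right_mono)
          have "A i s \<subseteq> {..<2 ^ i}" using A(2)[OF s] by (auto simp: G_def)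
          then have "card (A i s) \<le> card {..<(2::nat) ^ i}" by (intro card_mono) auto
          then show "real (card (A i s)) \<le> 2 ^ i" by simp
        qed (simp add: thr_def)
        finally show "(\<Sum>l\<in>A i s. split_error_prob (Y s) (P s) i l) \<le> 2 ^ i * thr i" .
      qed
      finally show ?thesis by simp
    qed
    have lower: "0 \<le> ?e i" for i
    proof -
      have "0 \<le> (\<Prod>s=1..S. vec_channel (P s) (y s) (polar_encode S m \<phi> C i (A i) (b i) u (\<pi> s)))"
        if "y \<in> (\<Pi>\<^sub>E s\<in>{1..S}. blocks (Y s) (2 ^ i))" for y u
        using that ch(1) by (intro prod_nonneg ballI vec_channel_nonneg[of "Y s" _ _ "2 ^ i" for s])
          (auto simp: polar_encode_def)
      then show ?thesis
        unfolding scheme_error_prob_def block_error_prob_def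
        by (intro divide_nonneg_nonneg sum_nonneg mult_nonneg_nonneg) auto
    qed
    show "?e \<longlonglongrightarrow> 0"
    proof (rule tendsto_sandwich[OF _ _ tendsto_const])
      show "(\<lambda>i. real S * (2 ^ i * thr i)) \<longlonglongrightarrow> 0"
        unfolding thr_def \<beta>_def by (rule polar_error_bound_tendsto)
    qed (use lower upper in auto)
  qed
qed

end
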